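(* Let $k, N$ be positive integers with $k$ odd and $4\mid N$, and let $\chi$ be an even Dirichlet character modulo $N$. Suppose $f=\sum_{n=1}^{\infty} a_f(n) q^n \in S_{k/2}(N,\chi)$. Then $f \in S^{+}_{k/2}(N,\chi)$ if and only if $a_f(n)=0$ for all integers $n$ with $1 \leq n \leq B^{\prime}_k(N)$ and $n \equiv 2$ or $n\equiv (-1)^{\frac{k+1}{2}} \pmod 4$, where $B^{\prime}_k(N)= \frac{k}{24}\,[\mathrm{SL}_2(\mathbb{Z}):\Gamma_0(4N)]$.
   Context: Here $q=e^{2\pi i z}$ with $z$ in the upper half-plane $\mathbb{H}$. Let $\Theta(z)=\sum_{n\in\mathbb{Z}} q^{n^2}$ and, for $\gamma\in\Gamma_0(4)$, $j(\gamma,z)=\Theta(\gamma z)/\Theta(z)$. For $k$ odd, $4\mid N$ and $\chi$ a Dirichlet character modulo $N$, $M_{k/2}(N,\chi)$ is the space (in the sense of Shimura) of holomorphic functions $f$ on $\mathbb{H}$ with $f(\gamma z)=\chi(d)\,j(\gamma,z)^k f(z)$ for all $\gamma=\begin{pmatrix}a&b\\c&d\end{pmatrix}\in\Gamma_0(N)$, holomorphic at all cusps; $S_{k/2}(N,\chi)$ is the subspace of forms vanishing at all cusps. A character $\chi$ is even if $\chi(-1)=1$. Kohnen's $+$-subspace $S_{k/2}^{+}(N,\chi)$ is the subspace of $S_{k/2}(N,\chi)$ consisting of those $f = \sum_{n=1}^{\infty} a_f(n) q^n$ with $a_f(n)=0$ for all $n\ge 1$ with $n \equiv 2$ or $n\equiv(-1)^{\frac{k+1}{2}}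 \pmod 4$. *)

theory Defs
  imports
    "HOL-Complex_Analysis.Complex_Analysis"
    "HOL-Algebra.Coset"
    "HOL-Number_Theory.Cong"
begin

definition SL2Z :: "(int^2^2) monoid" where
  "SL2Z = \<lparr>carrier = {A. det A = 1}, mult = (**), one = mat 1\<rparr>"

definition Gamma0 :: "nat \<Rightarrow> (int^2^2) set" where
  "Gamma0 N = {A \<in> carrier SL2Z. int N dvd A $ 2 $ 1}"

lemma group_SL2Z: "group SL2Z"
proof (rule groupI)
  fix A assume A: "A \<in> carrier SL2Z"
  define B :: "int^2^2" where
    "B = vector [vector [A $ 2 $ 2, - A $ 1 $ 2], vector [- A $ 2 $ 1, A $ 1 $ 1]]"
  have "det B = 1" "B ** A = mat 1"
    using A by (auto simp: SL2Z_def B_def det_2 matrix_matrix_mult_def mat_def vec_eq_iff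
        forall_2 sum_2 vector_2 algebra_simps)
  then show "\<exists>B\<in>carrier SL2Z. B \<otimes>\<^bsub>SL2Z\<^esub> A = \<one>\<^bsub>SL2Z\<^esub>"
    by (auto simp: SL2Z_def)
qed (auto simp: SL2Z_def det_mul matrix_mul_assoc)

lemma subgroup_Gamma0: "subgroup (Gamma0 N) SL2Z"
proof (rule group.subgroupI[OF group_SL2Z])
  show "Gamma0 N \<noteq> {}"
  proof -
    have "(mat 1 :: int^2^2) $ 2 $ 1 = 0" by (simp add: mat_def)
    then have "mat 1 \<in> Gamma0 N" by (simp add: Gamma0_def SL2Z_def det_I)
    then show ?thesis by blast
  qed
next
  fix A B assume "A \<in> Gamma0 N" "B \<in> Gamma0 N"
  moreover have "(A ** B) $ 2 $ 1 = A $ 2 $ 1 * B $ 1 $ 1 + A $ 2 $ 2 * B $ 2 $ 1"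
    by (simp add: matrix_matrix_mult_def sum_2)
  ultimately show "A \<otimes>\<^bsub>SL2Z\<^esub> B \<in> Gamma0 N"
    by (simp add: Gamma0_def SL2Z_def det_mul)
next
  fix A assume A: "A \<in> Gamma0 N"
  define B :: "int^2^2" where
    "B = vector [vector [A $ 2 $ 2, - A $ 1 $ 2], vector [- A $ 2 $ 1, A $ 1 $ 1]]"
  have B: "B \<in> carrier SL2Z" "B \<otimes>\<^bsub>SL2Z\<^esub> A = \<one>\<^bsub>SL2Z\<^esub>" "int N dvd B $ 2 $ 1"
    using A by (auto simp: Gamma0_def SL2Z_def B_def det_2 matrix_matrix_mult_def mat_def
        vec_eq_iff forall_2 sum_2 vector_2 algebra_simps)
  then have "inv\<^bsub>SL2Z\<^esub> A = B"
    using A group.inv_equality[OF group_SL2Z] by (auto simp: Gamma0_def)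
  with B show "inv\<^bsub>SL2Z\<^esub> A \<in> Gamma0 N" by (simp add: Gamma0_def)
qed (auto simp: Gamma0_def)

definition Gamma0_index :: "nat \<Rightarrow> nat" where
  "Gamma0_index N = card (rcosets\<^bsub>SL2Z\<^esub> (Gamma0 N))"

definition upper_half_plane :: "complex set" where
  "upper_half_plane = {z. Im z > 0}"

definition moebius :: "int^2^2 \<Rightarrow> complex \<Rightarrow> complex" where
  "moebius A z = (of_int (A $ 1 $ 1) * z + of_int (A $ 1 $ 2)) /
                 (of_int (A $ 2 $ 1) * z + of_int (A $ 2 $ 2))"

text \<open>Characters modulo \<open>N\<close> are regarded as functions on all integers, extended by zero.\<close>

definition dirichlet_character :: "nat \<Rightarrow> (int \<Rightarrow> complex) \<Rightarrow> bool" where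
  "dirichlet_character N chi \<longleftrightarrow>
     (\<forall>a b. [a = b] (mod int N) \<longrightarrow> chi a = chi b) \<and>
     (\<forall>a b. chi (a * b) = chi a * chi b) \<and>
     (\<forall>a. chi a \<noteq> 0 \<longleftrightarrow> coprime a (int N))"

definition qexp :: "complex \<Rightarrow> complex" where
  "qexp z = exp (2 * of_real pi * \<i> * z)"

definition Theta :: "complex \<Rightarrow> complex" where
  "Theta z = (\<Sum>\<^sub>\<infinity>n::int. qexp z ^ nat (n\<^sup>2))"

definition theta_factor :: "int^2^2 \<Rightarrow> complex \<Rightarrow> complex" where
  "theta_factor A z = Theta (moebius A z) / Theta z"

text \<open>
  The holomorphic functions \<open>\<phi>\<close> for which \<open>(A, \<phi>)\<close> belongs to Shimura's extension of
  the group of Moebius transformations: square roots of \<open>c z + d\<close> up to a constant of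
  absolute value one.
\<close>

definition sqrt_factors :: "int^2^2 \<Rightarrow> (complex \<Rightarrow> complex) set" where
  "sqrt_factors A = {\<phi>. \<phi> holomorphic_on upper_half_plane \<and>
     (\<exists>t. norm t = 1 \<and> (\<forall>z\<in>upper_half_plane.
        \<phi> z ^ 2 = t * (of_int (A $ 2 $ 1) * z + of_int (A $ 2 $ 2))))}"

text \<open>
  Expansion of \<open>f | [(A, \<phi>)]\<^sub>k\<close>, that is, of \<open>f\<close> at the cusp \<open>A \<infinity>\<close>, without negative
  exponents. Here \<open>h\<close> plays the role of the width of the cusp and \<open>r\<close> is determined by
  the multiplier of the translation by \<open>h\<close>. The set of exponents \<open>(n + r) / h\<close> occurring
  with nonzero coefficient does not depend on the choice of \<open>h\<close>, nor on that of \<open>\<phi>\<close>.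
\<close>

definition cusp_expansion ::
  "nat \<Rightarrow> (complex \<Rightarrow> complex) \<Rightarrow> int^2^2 \<Rightarrow> (complex \<Rightarrow> complex) \<Rightarrow>
   real \<Rightarrow> real \<Rightarrow> (nat \<Rightarrow> complex) \<Rightarrow> bool" where
  "cusp_expansion k f A \<phi> h r c \<longleftrightarrow>
     h > 0 \<and> 0 \<le> r \<and> r < 1 \<and>
     (\<forall>z\<in>upper_half_plane.
        (\<lambda>n. c n * qexp (of_real ((real n + r) / h) * z)) sums (f (moebius A z) / \<phi> z ^ k))"

definition holomorphic_at_cusp :: "nat \<Rightarrow> (complex \<Rightarrow> complex) \<Rightarrow> int^2^2 \<Rightarrow> bool" where
  "holomorphic_at_cusp k f A \<longleftrightarrow>
     (\<forall>\<phi>\<in>sqrt_factors A. \<exists>h r c. cusp_expansion k f A \<phi> h r c)"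

definition vanishes_at_cusp :: "nat \<Rightarrow> (complex \<Rightarrow> complex) \<Rightarrow> int^2^2 \<Rightarrow> bool" where
  "vanishes_at_cusp k f A \<longleftrightarrow>
     (\<forall>\<phi>\<in>sqrt_factors A. \<exists>h r c. cusp_expansion k f A \<phi> h r c \<and> (r = 0 \<longrightarrow> c 0 = 0))"

text \<open>
  The parameter \<open>k\<close> is twice the weight. Only the values on the upper half-plane are
  relevant. Every cusp is of the form \<open>A \<infinity>\<close> for some \<open>A\<close> in the full modular group.
\<close>

definition modular_forms :: "nat \<Rightarrow> nat \<Rightarrow> (int \<Rightarrow> complex) \<Rightarrow> (complex \<Rightarrow> complex) set" where
  "modular_forms k N chi = {f.
     f holomorphic_on upper_half_plane \<and>
     (\<forall>A\<in>Gamma0 N. \<forall>z\<in>upper_half_plane.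
        f (moebius A z) = chi (A $ 2 $ 2) * theta_factor A z ^ k * f z) \<and>
     (\<forall>A\<in>carrier SL2Z. holomorphic_at_cusp k f A)}"

definition cusp_forms :: "nat \<Rightarrow> nat \<Rightarrow> (int \<Rightarrow> complex) \<Rightarrow> (complex \<Rightarrow> complex) set" where
  "cusp_forms k N chi =
     {f \<in> modular_forms k N chi. \<forall>A\<in>carrier SL2Z. vanishes_at_cusp k f A}"

text \<open>The value \<open>a 0\<close> is irrelevant: the expansion starts with the exponent one.\<close>

definition has_q_expansion :: "(complex \<Rightarrow> complex) \<Rightarrow> (nat \<Rightarrow> complex) \<Rightarrow> bool" where
  "has_q_expansion f a \<longleftrightarrow>
     (\<forall>z\<in>upper_half_plane. (\<lambda>n. a (Suc n) * qexp z ^ Suc n) sums f z)"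

definition excluded_exponent :: "nat \<Rightarrow> nat \<Rightarrow> bool" where
  "excluded_exponent k n \<longleftrightarrow>
     [int n = 2] (mod 4) \<or> [int n = (-1) ^ ((k + 1) div 2)] (mod 4)"

definition kohnen_plus_space ::
  "nat \<Rightarrow> nat \<Rightarrow> (int \<Rightarrow> complex) \<Rightarrow> (complex \<Rightarrow> complex) set" where
  "kohnen_plus_space k N chi = {f \<in> cusp_forms k N chi.
     \<exists>a. has_q_expansion f a \<and> (\<forall>n\<ge>1. excluded_exponent k n \<longrightarrow> a n = 0)}"

definition sturm_bound :: "nat \<Rightarrow> nat \<Rightarrow> real" where
  "sturm_bound k N = real k / 24 * real (Gamma0_index (4 * N))"

end

theory Submission
  imports Defs "HOL-Probability.Characteristic_Functions"
begin

text \<open>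
  Only one direction has content: if the coefficients of \<open>f\<close> at the excluded exponents vanish up to
  the bound, then they all vanish. Let \<open>g\<close> be the sum of the terms \<open>a n * q ^ n\<close> of \<open>f\<close> with
  excluded \<open>n\<close>. The idea is that \<open>g\<close> is again a form of weight \<open>k / 2\<close>, now of level \<open>4 * N\<close>, and
  that the stated bound is the Sturm bound for this level, so that \<open>g\<close> is zero.

  Why \<open>g\<close> has level \<open>4 * N\<close>. Whether \<open>n\<close> is excluded depends on \<open>n\<close> modulo 4, hence \<open>g\<close> is a
  combination of the functions \<open>f (z + j / 4)\<close>. Conjugation by the translation by \<open>j / 4\<close> maps
  \<open>\<Gamma>\<^sub>0(4N)\<close> into \<open>\<Gamma>\<^sub>0(N)\<close> and preserves the lower right entry modulo \<open>N\<close>, so the character does not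
  change. Neither does the theta factor: \<open>\<Theta> (z + j / 4) / \<Theta> z\<close> is a function of
  \<open>\<Theta> (z + 1/2) / \<Theta> z\<close>, and the latter quotient is multiplied by a power of \<open>\<i>\<close> under \<open>\<Gamma>\<^sub>0(4)\<close> with
  an exponent that is divisible by 4 on \<open>\<Gamma>\<^sub>0(16)\<close> (\<open>theta_Gamma0_4\<close>). The outcome is
  \<open>modular_form_quarter_shift\<close>.

  Why the Sturm bound holds. Put \<open>P = \<theta>\<^sub>2 \<theta>\<^sub>3 \<theta>\<^sub>4\<close>. It has no zero in the upper half-plane, it has order
  1/8 at infinity, and \<open>\<bar>P\<bar>\<^sup>4 y\<^sup>3\<close> with \<open>y = Im z\<close> is invariant under the full modular group. Multiply
  the functions \<open>\<bar>g\<bar>\<^sup>4 y\<^sup>k\<close>, translated by representatives of the \<open>d\<close> cosets of \<open>\<Gamma>\<^sub>0(4N)\<close>, and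
  divide the third power of the product by \<open>(\<bar>P\<bar>\<^sup>4 y\<^sup>3)\<close> to the power \<open>k d\<close>. The powers of \<open>y\<close> cancel,
  and what remains is the absolute value of a holomorphic function that is invariant under the modular
  group. It tends to zero at infinity as soon as \<open>g\<close> vanishes there to an order larger than
  \<open>k d / 24\<close>. Such a function attains its maximum, so it is constant by the maximum modulus principle,
  and the constant is zero (\<open>sturm_vanishing\<close>). Working with absolute values and fourth powers avoids
  the theta multiplier and all choices of square roots.

  What has to be known about \<open>\<Theta>\<close> is its inversion formula (\<open>Theta_inversion\<close>) and that it has no
  zeros (\<open>Theta_nonzero\<close>). The former says that the Fourier series of a periodized Gaussian
  represents the function at the origin; the latter follows from a duplication formula.
\<close>

(* The dollar sign denotes matrix entries below, not coefficients of power series. *)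
unbundle no Formal_Power_Series.fps_syntax

section \<open>The nome and sums over the integers\<close>

lemma norm_qexp: "norm (qexp z) = exp (- 2 * pi * Im z)"
  by (simp add: qexp_def norm_exp_eq_Re)

lemma qexp_add: "qexp (z + w) = qexp z * qexp w"
  by (simp add: qexp_def exp_add algebra_simps)

lemma qexp_power: "qexp z ^ n = qexp (of_nat n * z)"
  by (simp add: qexp_def exp_of_nat_mult[symmetric] algebra_simps)

lemma qexp_int: "qexp (of_int n) = 1"
  using exp_integer_2pi[of "of_int n"] by (simp add: qexp_def mult_ac)

lemma qexp_holomorphic [holomorphic_intros]:
  "f holomorphic_on S \<Longrightarrow> (\<lambda>z. qexp (f z)) holomorphic_on S"
  unfolding qexp_def by (intro holomorphic_intros)

lemma qexp_half: "qexp (1/2) = -1"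
  by (simp add: qexp_def field_simps)

lemma qexp_quarter: "qexp (1/4) = \<i>"
  by (simp add: qexp_def field_simps exp_eq_polar cis_conv_exp[symmetric] flip: cis_conv_exp)

lemma norm_qexp_less_1: "Im z > 0 \<Longrightarrow> norm (qexp z) < 1"
  by (simp add: norm_qexp)

lemma has_sum_geometric_int:
  fixes r :: real
  assumes r: "0 \<le> r" "r < 1"
  shows "((\<lambda>n::int. r ^ nat \<bar>n\<bar>) has_sum (2 * r / (1 - r))) (UNIV - {0})"
proof -
  have "((\<lambda>n::nat. r ^ Suc n) has_sum r / (1 - r)) UNIV"
    using r sums_mult[OF geometric_sums[of r], of r]
    by (intro norm_summable_imp_has_sum) (auto simp: power_abs summable_mult)
  then have "((\<lambda>n::int. r ^ nat \<bar>n\<bar>) has_sum r / (1 - r)) (range (\<lambda>n. int (Suc n)))"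
    and "((\<lambda>n::int. r ^ nat \<bar>n\<bar>) has_sum r / (1 - r)) (range (\<lambda>n. - int (Suc n)))"
    by (subst has_sum_reindex; auto simp: o_def inj_on_def nat_add_distrib simp del: of_nat_Suc)+
  then have "((\<lambda>n::int. r ^ nat \<bar>n\<bar>) has_sum (r / (1 - r) + r / (1 - r)))
      (range (\<lambda>n. int (Suc n)) \<union> range (\<lambda>n. - int (Suc n)))"
    by (rule has_sum_Un_disjoint) auto
  moreover have "range (\<lambda>n. int (Suc n)) \<union> range (\<lambda>n. - int (Suc n)) = UNIV - {0}"
  proof (intro equalityI subsetI)
    fix n :: int assume "n \<in> UNIV - {0}"
    then have "n = int (Suc (nat (n - 1))) \<or> n = - int (Suc (nat (- n - 1)))" by auto
    then show "n \<in> range (\<lambda>n. int (Suc n)) \<union> range (\<lambda>n. - int (Suc n))" by blast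
  qed auto
  ultimately show ?thesis by simp
qed

lemma summable_on_geometric_int:
  fixes r :: real
  assumes "0 \<le> r" "r < 1"
  shows "(\<lambda>n::int. r ^ nat \<bar>n\<bar>) summable_on UNIV"
  using has_sum_insert[OF _ has_sum_geometric_int[OF assms], of 0]
  by (auto intro: has_sum_imp_summable simp: insert_UNIV)

lemma square_power_le_abs_power:
  fixes r :: real
  assumes "0 \<le> r" "r \<le> 1"
  shows "r ^ nat (n\<^sup>2) \<le> r ^ nat \<bar>n\<bar>"
proof (rule power_decreasing)
  have "\<bar>n\<bar> * 1 \<le> \<bar>n\<bar> * \<bar>n\<bar>" by (cases "n = 0") (simp, intro mult_left_mono, auto)
  then have "\<bar>n\<bar> \<le> n\<^sup>2" by (simp add: power2_eq_square)
  then show "nat \<bar>n\<bar> \<le> nat (n\<^sup>2)" by linarith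
qed (use assms in auto)

text \<open>
  Uniform convergence near every point, in the form needed for sums over the integers: the majorant
  may depend on the point.
\<close>

lemma infsum_holomorphic:
  fixes f :: "'i \<Rightarrow> complex \<Rightarrow> complex"
  assumes "open S" and hol: "\<And>n. f n holomorphic_on S"
    and M: "\<And>x. x \<in> S \<Longrightarrow> \<exists>e>0. \<exists>M. M summable_on A \<and> (\<forall>n\<in>A. \<forall>z\<in>cball x e. norm (f n z) \<le> M n)"
  shows "(\<lambda>z. \<Sum>\<^sub>\<infinity>n\<in>A. f n z) holomorphic_on S"
  unfolding holomorphic_on_open[OF \<open>open S\<close>]
proof
  fix x assume x: "x \<in> S"
  obtain e M where e: "e > 0" and M: "M summable_on A" "\<And>n z. n \<in> A \<Longrightarrow> z \<in> cball x e \<Longrightarrow> norm (f n z) \<le> M n"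
    using assms(3)[OF x] by blast
  obtain d where d: "d > 0" "cball x d \<subseteq> S"
    using \<open>open S\<close> x open_contains_cball by blast
  define r where "r = min e d"
  have r: "r > 0" "cball x r \<subseteq> S" "cball x r \<subseteq> cball x e" using e d by (auto simp: r_def)
  have ul: "uniform_limit (cball x r) (\<lambda>X z. \<Sum>n\<in>X. f n z) (\<lambda>z. \<Sum>\<^sub>\<infinity>n\<in>A. f n z) (finite_subsets_at_top A)"
    by (rule Weierstrass_m_test_general[OF M(2) M(1)]) (use r(3) in auto)
  have "f n holomorphic_on cball x r" for n
    by (rule holomorphic_on_subset[OF hol r(2)])
  then have "(\<lambda>z. \<Sum>n\<in>X. f n z) holomorphic_on cball x r" for X
    by (intro holomorphic_on_sum)
  then have "eventually (\<lambda>X. continuous_on (cball x r) (\<lambda>z. \<Sum>n\<in>X. f n z) \<and> (\<lambda>z. \<Sum>n\<in>X. f n z) holomorphic_on ball x r)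
     (finite_subsets_at_top A)"
    by (intro always_eventually allI conjI holomorphic_on_imp_continuous_on)
      (auto intro: holomorphic_on_subset[OF _ ball_subset_cball])
  then have "(\<lambda>z. \<Sum>\<^sub>\<infinity>n\<in>A. f n z) holomorphic_on ball x r"
    by (rule holomorphic_uniform_limit[OF _ ul]) simp
  then have "(\<lambda>z. \<Sum>\<^sub>\<infinity>n\<in>A. f n z) field_differentiable at x"
    by (rule holomorphic_on_imp_differentiable_at) (use r(1) in auto)
  then show "\<exists>f'. ((\<lambda>z. \<Sum>\<^sub>\<infinity>n\<in>A. f n z) has_field_derivative f') (at x)"
    unfolding field_differentiable_def .
qed

section \<open>The theta series and its zeros\<close>

lemma summable_Theta:
  assumes "norm q < 1"
  shows "(\<lambda>n::int. norm (q ^ nat (n\<^sup>2) :: complex)) summable_on UNIV"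
proof (rule summable_on_comparison_test)
  show "(\<lambda>n::int. norm q ^ nat \<bar>n\<bar>) summable_on UNIV"
    using assms by (intro summable_on_geometric_int) auto
  show "norm (q ^ nat (n\<^sup>2)) \<le> norm q ^ nat \<bar>n\<bar>" for n :: int
    unfolding norm_power using assms by (intro square_power_le_abs_power) auto
qed auto

lemma open_upper_half_plane: "open upper_half_plane"
  unfolding upper_half_plane_def by (rule open_halfspace_Im_gt)

lemma connected_upper_half_plane: "connected upper_half_plane"
  unfolding upper_half_plane_def by (intro convex_connected convex_halfspace_Im_gt)

lemma Theta_holomorphic: "Theta holomorphic_on upper_half_plane"
proof -
  have "(\<lambda>z. \<Sum>\<^sub>\<infinity>n::int. qexp z ^ nat (n\<^sup>2)) holomorphic_on upper_half_plane"
  proof (rule infsum_holomorphic[OF open_upper_half_plane])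
    show "(\<lambda>z. qexp z ^ nat (n\<^sup>2)) holomorphic_on upper_half_plane" for n :: int
      by (intro holomorphic_intros)
    fix x assume "x \<in> upper_half_plane"
    then have x: "Im x > 0" by (simp add: upper_half_plane_def)
    define r where "r = exp (- pi * Im x)"
    have r: "0 \<le> r" "r < 1" using x by (auto simp: r_def)
    have "norm (qexp z ^ nat (n\<^sup>2)) \<le> r ^ nat \<bar>n\<bar>" if "z \<in> cball x (Im x / 2)" for z and n :: int
    proof -
      have "\<bar>Im x - Im z\<bar> \<le> Im x / 2"
        using that abs_Im_le_cmod[of "x - z"] by (auto simp: dist_norm)
      then have "Im z \<ge> Im x / 2" by linarith
      then have "norm (qexp z) \<le> r" unfolding norm_qexp r_def by simp
      then have "norm (qexp z) ^ nat (n\<^sup>2) \<le> r ^ nat (n\<^sup>2)" by (intro power_mono) auto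
      also have "\<dots> \<le> r ^ nat \<bar>n\<bar>" using r by (intro square_power_le_abs_power) auto
      finally show ?thesis by (simp add: norm_power)
    qed
    then show "\<exists>e>0. \<exists>M. M summable_on UNIV \<and>
           (\<forall>n::int\<in>UNIV. \<forall>z\<in>cball x e. norm (qexp z ^ nat (n\<^sup>2)) \<le> M n)"
      using x summable_on_geometric_int[OF r] by (intro exI[of _ "Im x / 2"] conjI exI) auto
  qed
  then show ?thesis unfolding Theta_def .
qed

lemma has_sum_Theta: "Im z > 0 \<Longrightarrow> ((\<lambda>n::int. qexp z ^ nat (n\<^sup>2)) has_sum Theta z) UNIV"
  unfolding Theta_def
  by (intro has_sum_infsum abs_summable_summable[OF summable_Theta] norm_qexp_less_1)

lemma Theta_plus_1: "Theta (z + 1) = Theta z"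
  using qexp_int[of 1] by (simp add: Theta_def qexp_add)

lemma Theta_plus_int: "Theta (z + of_int m) = Theta z"
  using qexp_int[of m] by (simp add: Theta_def qexp_add)

text \<open>
  The terms with \<open>n\<close> even form a theta series in \<open>4 z\<close>. Most identities below arise from this
  splitting.
\<close>

lemma has_sum_Theta_even:
  assumes "Im z > 0"
  shows "((\<lambda>n::int. qexp z ^ nat (n\<^sup>2)) has_sum Theta (4 * z)) {n. even n}"
proof -
  have "((\<lambda>n::int. qexp (4 * z) ^ nat (n\<^sup>2)) has_sum Theta (4 * z)) UNIV"
    using has_sum_Theta[of "4 * z"] assms by simp
  also have "(\<lambda>n::int. qexp (4 * z) ^ nat (n\<^sup>2)) = (\<lambda>n. qexp z ^ nat (n\<^sup>2)) \<circ> (\<lambda>n. 2 * n)"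
    by (auto simp: qexp_power fun_eq_iff power_mult_distrib nat_mult_distrib mult_ac)
  finally have "((\<lambda>n::int. qexp z ^ nat (n\<^sup>2)) has_sum Theta (4 * z)) (range (\<lambda>n. 2 * n))"
    by (subst has_sum_reindex) (auto simp: inj_on_def o_def power_mult_distrib)
  also have "range (\<lambda>n::int. 2 * n) = {n. even n}" by (auto simp: dvd_def)
  finally show ?thesis .
qed

lemma has_sum_Theta_odd:
  assumes "Im z > 0"
  shows "((\<lambda>n::int. qexp z ^ nat (n\<^sup>2)) has_sum Theta z - Theta (4 * z)) {n. odd n}"
proof -
  have "((\<lambda>n::int. qexp z ^ nat (n\<^sup>2)) has_sum Theta z - Theta (4 * z)) (UNIV - {n. even n})"
    using has_sum_Diff[OF has_sum_Theta[OF assms] has_sum_Theta_even[OF assms]] by simp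
  also have "UNIV - {n::int. even n} = {n. odd n}" by auto
  finally show ?thesis .
qed

lemma even_square_power_unity:
  fixes w :: complex
  assumes "w ^ 4 = 1" "even n"
  shows "w ^ nat (n\<^sup>2) = 1"
proof -
  obtain j where "n = 2 * j" using assms by blast
  then have "nat (n\<^sup>2) = 4 * nat (j\<^sup>2)" by (simp add: nat_mult_distrib power_mult_distrib)
  then show ?thesis by (simp only: power_mult assms(1) power_one)
qed

text \<open>
  Squares are 0 or 1 modulo 4; therefore multiplying the nome by a fourth root of unity multiplies
  the odd terms of the theta series by that root and leaves the even ones alone.
\<close>

lemma odd_square_power_unity:
  fixes w :: complex
  assumes "w ^ 4 = 1" "odd n"
  shows "w ^ nat (n\<^sup>2) = w"
proof -
  obtain j where "n = 2 * j + 1" using assms(2) oddE by blast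
  then have *: "n\<^sup>2 = 4 * (j\<^sup>2 + j) + 1" by (simp add: power2_eq_square algebra_simps)
  have "j\<^sup>2 + j = j * (j + 1)" by (simp add: power2_eq_square algebra_simps)
  also have "\<dots> \<ge> 0" by (cases "j \<ge> 0") (auto intro: mult_nonpos_nonpos)
  finally have "nat (n\<^sup>2) = 4 * nat (j\<^sup>2 + j) + 1"
    unfolding * by (simp add: nat_add_distrib nat_mult_distrib)
  then show ?thesis by (simp only: power_add power_mult assms(1) power_one) simp
qed

lemma Theta_shift:
  assumes z: "Im z > 0" "Im (z + w) > 0" and w: "qexp w ^ 4 = 1"
  shows "Theta (z + w) = Theta (4 * z) + qexp w * (Theta z - Theta (4 * z))"
proof -
  have "((\<lambda>n::int. qexp (z + w) ^ nat (n\<^sup>2)) has_sum Theta (4 * z)) {n. even n}"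
    using has_sum_Theta_even[OF z(1)]
    by (rule has_sum_cong[THEN iffD1, rotated])
      (auto simp: qexp_add power_mult_distrib even_square_power_unity[OF w])
  moreover have "((\<lambda>n::int. qexp (z + w) ^ nat (n\<^sup>2)) has_sum qexp w * (Theta z - Theta (4 * z))) {n. odd n}"
    using has_sum_cmult_right[OF has_sum_Theta_odd[OF z(1)], of "qexp w"]
    by (rule has_sum_cong[THEN iffD1, rotated])
      (auto simp: qexp_add power_mult_distrib odd_square_power_unity[OF w])
  ultimately have "((\<lambda>n::int. qexp (z + w) ^ nat (n\<^sup>2)) has_sum
      (Theta (4 * z) + qexp w * (Theta z - Theta (4 * z)))) ({n. even n} \<union> {n. odd n})"
    by (rule has_sum_Un_disjoint) auto
  also have "{n. even n} \<union> {n::int. odd n} = UNIV" by auto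
  finally show ?thesis
    using has_sum_Theta[OF z(2)] by (auto intro: has_sum_unique)
qed

lemma Theta_half_shift:
  assumes "Im z > 0"
  shows "Theta z + Theta (z + 1/2) = 2 * Theta (4 * z)"
  using Theta_shift[of z "1/2"] assms by (simp add: qexp_half algebra_simps)

text \<open>
  In the double series for the left-hand side the terms with \<open>m + n\<close> odd cancel in pairs, since
  exchanging \<open>m\<close> and \<open>n\<close> changes their sign. On the others \<open>m = u + v\<close> and \<open>n = u - v\<close> turns the
  exponent \<open>m\<^sup>2 + n\<^sup>2\<close> into \<open>2 u\<^sup>2 + 2 v\<^sup>2\<close>.
\<close>

lemma theta_product_identity:
  assumes "Im z > 0"
  shows "Theta z * Theta (z + 1/2) = Theta (2 * z + 1/2) ^ 2"
proof -
  define q where "q = qexp z"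
  define s where "s n = (if even n then 1 else -1 :: complex)" for n :: int
  have q: "norm q < 1" unfolding q_def using assms by (rule norm_qexp_less_1)
  have s: "qexp (w + 1/2) ^ nat (n\<^sup>2) = s n * qexp w ^ nat (n\<^sup>2)" for n w
    using even_square_power_unity[of "-1" n] odd_square_power_unity[of "-1" n]
    by (auto simp: qexp_add qexp_half s_def power_minus[of "qexp w"])
  define F where "F = (\<lambda>(m::int, n::int). s n * q ^ nat (m\<^sup>2 + n\<^sup>2))"
  have prod: "((\<lambda>(m, n). f m * g n) has_sum a * b) (UNIV \<times> UNIV)"
    if "(f has_sum a) UNIV" "(g has_sum b) UNIV" "(\<lambda>n. norm (f n)) summable_on UNIV" "(\<lambda>n. norm (g n)) summable_on UNIV"
    for f g :: "int \<Rightarrow> complex" and a b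
  proof (rule has_sum_SigmaI)
    show "((\<lambda>n. case (m, n) of (m, n) \<Rightarrow> f m * g n) has_sum f m * b) UNIV" for m
      using has_sum_cmult_right[OF that(2)] by simp
    show "((\<lambda>m. f m * b) has_sum a * b) UNIV"
      using has_sum_cmult_left[OF that(1)] by simp
    have "(\<lambda>(m, n). norm (f m) * norm (g n)) summable_on UNIV \<times> UNIV"
    proof (rule summable_on_SigmaI)
      show "((\<lambda>n. case (m, n) of (m, n) \<Rightarrow> norm (f m) * norm (g n)) has_sum
          norm (f m) * (\<Sum>\<^sub>\<infinity>n. norm (g n))) UNIV" for m
        using has_sum_cmult_right[OF has_sum_infsum[OF that(4)]] by simp
      show "(\<lambda>m. norm (f m) * (\<Sum>\<^sub>\<infinity>n. norm (g n))) summable_on UNIV"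
        using that(3) by (rule summable_on_cmult_left)
    qed auto
    then have "(\<lambda>x. norm (case x of (m, n) \<Rightarrow> f m * g n)) summable_on UNIV \<times> UNIV"
      by (simp add: case_prod_unfold norm_mult)
    then show "(\<lambda>(m, n). f m * g n) summable_on UNIV \<times> UNIV"
      by (rule abs_summable_summable)
  qed
  have summable: "(\<lambda>n. norm (qexp w ^ nat (n\<^sup>2))) summable_on UNIV" if "Im w > 0" for w
    using that by (intro summable_Theta norm_qexp_less_1)
  have sq: "nat (m\<^sup>2 + n\<^sup>2) = nat (m\<^sup>2) + nat (n\<^sup>2)" for m n :: int
    by (simp add: nat_add_distrib)
  have F: "(F has_sum Theta z * Theta (z + 1/2)) UNIV"
    using prod[OF has_sum_Theta has_sum_Theta summable summable, of z "z + 1/2"] assms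
    by (simp add: s F_def q_def sq power_add mult_ac)
  have "F summable_on {(m, n). odd (m + n)}"
    using F by (intro summable_on_subset[OF has_sum_imp_summable]) auto
  then obtain S where S: "(F has_sum S) {(m, n). odd (m + n)}"
    using has_sum_infsum by blast
  \<comment> \<open>exchanging \<open>m\<close> and \<open>n\<close> changes the sign of the terms with \<open>m + n\<close> odd\<close>
  have "((\<lambda>x. - F x) has_sum S) {(m, n). odd (m + n)}"
    using S by (rule has_sum_reindex_bij_witness[of _ prod.swap prod.swap, THEN iffD1, rotated -1])
      (auto simp: F_def s_def add.commute)
  then have "(F has_sum - S) {(m, n). odd (m + n)}"
    by (simp add: has_sum_uminus)
  then have "S = - S" using S by (rule has_sum_unique[rotated])
  then have "S = 0" by simp
  with S have "(F has_sum 0) {(m, n). odd (m + n)}" by simp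
  moreover have "((\<lambda>(u, v). qexp (2 * z + 1/2) ^ nat (u\<^sup>2) * qexp (2 * z + 1/2) ^ nat (v\<^sup>2))
      has_sum Theta (2 * z + 1/2) ^ 2) (UNIV \<times> UNIV)"
    using prod[OF has_sum_Theta has_sum_Theta summable summable, of "2 * z + 1/2" "2 * z + 1/2"] assms
    by (simp add: power2_eq_square)
  then have "(F has_sum Theta (2 * z + 1/2) ^ 2) {(m, n). even (m + n)}"
  proof (rule has_sum_reindex_bij_witness[of _ "\<lambda>(m, n). ((m + n) div 2, (m - n) div 2)"
        "\<lambda>(u, v). (u + v, u - v)", THEN iffD1, rotated -1])
    fix x :: "int \<times> int" assume "x \<in> UNIV \<times> UNIV"
    obtain u v where x: "x = (u, v)" by (cases x)
    have sq2: "(u + v)\<^sup>2 + (u - v)\<^sup>2 = 2 * u\<^sup>2 + 2 * v\<^sup>2"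
      by (simp add: power2_eq_square algebra_simps)
    have "nat ((u + v)\<^sup>2 + (u - v)\<^sup>2) = 2 * nat (u\<^sup>2) + 2 * nat (v\<^sup>2)"
      unfolding sq2 by (simp add: nat_add_distrib nat_mult_distrib)
    then have "q ^ nat ((u + v)\<^sup>2 + (u - v)\<^sup>2) = qexp (2 * z) ^ nat (u\<^sup>2) * qexp (2 * z) ^ nat (v\<^sup>2)"
      by (simp add: q_def power_add power_mult qexp_power)
    moreover have "s (u - v) = s u * s v" by (auto simp: s_def)
    ultimately show "F (case x of (u, v) \<Rightarrow> (u + v, u - v)) =
        (case x of (u, v) \<Rightarrow> qexp (2 * z + 1/2) ^ nat (u\<^sup>2) * qexp (2 * z + 1/2) ^ nat (v\<^sup>2))"
      by (simp add: x F_def s)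
  qed (auto, presburger+)
  ultimately have "(F has_sum 0 + Theta (2 * z + 1/2) ^ 2) ({(m, n). odd (m + n)} \<union> {(m, n). even (m + n)})"
    by (rule has_sum_Un_disjoint) auto
  also have "{(m, n). odd (m + n)} \<union> {(m, n). even (m + n)} = (UNIV :: (int \<times> int) set)" by auto
  finally show ?thesis using F by (auto intro: has_sum_unique)
qed

lemma norm_Theta_minus_1_le:
  assumes z: "Im z \<ge> 1"
  shows "norm (Theta z - 1) \<le> 4 * exp (- 2 * pi * Im z)"
proof -
  define r where "r = exp (- 2 * pi * Im z)"
  have "2 * pi * Im z \<ge> 2 * 3 * 1" using z pi_gt3 by (intro mult_mono) auto
  then have "exp (2 * pi * Im z) \<ge> 1 + 6" using exp_ge_add_one_self[of "2 * pi * Im z"] by linarith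
  then have r: "0 < r" "r \<le> 1/2" by (auto simp: r_def exp_minus field_simps)
  have sum: "((\<lambda>n::int. qexp z ^ nat (n\<^sup>2)) has_sum (Theta z - 1)) (UNIV - {0})"
    by (rule has_sum_Diff) (use has_sum_Theta[of z] z in \<open>auto intro: has_sum_finiteI\<close>)
  have le: "norm (qexp z ^ nat (n\<^sup>2)) \<le> r ^ nat \<bar>n\<bar>" for n :: int
    unfolding norm_power norm_qexp r_def[symmetric] using r by (intro square_power_le_abs_power) auto
  have "((\<lambda>n::int. r ^ nat \<bar>n\<bar>) has_sum (2 * r / (1 - r))) (UNIV - {0})"
    using r by (intro has_sum_geometric_int) auto
  then have "norm (Theta z - 1) \<le> 2 * r / (1 - r)"
    by (rule norm_infsum_le[OF sum _ le])
  also have "\<dots> \<le> 4 * r" using r by (simp add: field_simps)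
  finally show ?thesis by (simp add: r_def)
qed

lemma norm_Theta_half_minus_1_le:
  assumes z: "Im z \<ge> 1"
  shows "norm (Theta (z + 1/2) - 1) \<le> 4 * exp (- 2 * pi * Im z)"
  using norm_Theta_minus_1_le[of "z + 1/2"] assms by simp

lemma exp_minus_2pi_less:
  assumes "1 \<le> y"
  shows "exp (- 2 * pi * y) < 1 / 16"
proof -
  have "2 * pi * y \<ge> 2 * pi * 1" using assms by (intro mult_left_mono) auto
  moreover have "exp (4 * ln 2 :: real) = 16" by (simp add: exp_of_nat_mult[of 4 "ln 2", simplified])
  moreover have "4 * ln 2 < (2 * pi :: real)" using ln_le_minus_one[of 2] pi_gt3 by simp
  ultimately have "exp (2 * pi * y) > 16" by (smt (verit) exp_less_mono)
  then show ?thesis by (simp add: exp_minus field_simps)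
qed

lemma Im_complex_of_real_mult: "Im (complex_of_real c * z) = c * Im z"
  by simp

text \<open>
  By the duplication formula a zero \<open>z\<close> of \<open>\<Theta>\<close> makes \<open>\<Theta> (w + 1/2)\<close> vanish at \<open>w = 2 z\<close>, and then,
  again by that formula, at \<open>4 z\<close>, \<open>8 z\<close> and so on. But \<open>\<Theta>\<close> tends to 1 at infinity.
\<close>

lemma Theta_nonzero:
  assumes z: "Im z > 0"
  shows "Theta z \<noteq> 0"
proof
  assume "Theta z = 0"
  have zero: "Theta (2 ^ Suc n * z + 1/2) = 0" for n
  proof (induction n)
    case 0
    show ?case using theta_product_identity[OF z] \<open>Theta z = 0\<close> by simp
  next
    case (Suc n)
    show ?case
      using theta_product_identity[of "2 ^ Suc n * z"] Suc z by (simp add: mult_ac)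
  qed
  obtain n where "1 / Im z < 2 ^ n" using real_arch_pow[of 2 "1 / Im z"] by auto
  then have "1 < 2 ^ Suc n * Im z" using z by (simp add: field_simps)
  moreover have "Im (2 ^ Suc n * z) = 2 ^ Suc n * Im z"
    using Im_complex_of_real_mult[of "2 ^ Suc n" z] by simp
  ultimately have "Im (2 ^ Suc n * z) \<ge> 1" by simp
  from norm_Theta_half_minus_1_le[OF this] exp_minus_2pi_less[OF this] zero[of n] show False by simp
qed

section \<open>Fourier series at the origin\<close>

lemma qexp_eq_1_iff: "qexp z = 1 \<longleftrightarrow> (\<exists>n::int. z = of_int n)"
  unfolding qexp_def exp_eq_1 by (auto simp: complex_eq_iff)

lemma fourier_integrand_derivative:
  fixes n :: int
  assumes h: "h holomorphic_on ball 0 1" and x: "x \<in> {-1/2..1/2}"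
  shows "((\<lambda>x. h (of_real x) * qexp (- of_int n * of_real x)) has_vector_derivative
    (deriv h (of_real x) * qexp (- of_int n * of_real x)
      - 2 * of_real pi * \<i> * of_int n * (h (of_real x) * qexp (- of_int n * of_real x))))
    (at x within {-1/2..1/2})"
proof -
  have "complex_of_real x \<in> ball 0 1" using x by (auto simp: abs_real_def)
  then have "(h has_field_derivative deriv h (of_real x)) (at (of_real x))"
    by (intro holomorphic_derivI[OF h]) auto
  then have "((\<lambda>z. h z * qexp (- of_int n * z)) has_field_derivative
    (deriv h (of_real x) * qexp (- of_int n * of_real x)
      - 2 * of_real pi * \<i> * of_int n * (h (of_real x) * qexp (- of_int n * of_real x)))) (at (of_real x))"
    unfolding qexp_def by (auto intro!: derivative_eq_intros simp: algebra_simps)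
  then show ?thesis
    by (intro has_vector_derivative_real_field)
qed

definition fourier_coeff :: "(complex \<Rightarrow> complex) \<Rightarrow> int \<Rightarrow> complex" where
  "fourier_coeff h n = integral {-1/2..1/2} (\<lambda>x. h (of_real x) * qexp (- of_int n * of_real x))"

lemma continuous_on_fourier_integrand:
  assumes h: "h holomorphic_on ball 0 1"
  shows "continuous_on {-1/2..1/2::real} (\<lambda>x. h (of_real x) * qexp (- of_int n * of_real x))"
proof -
  have "continuous_on (of_real ` {-1/2..1/2::real}) (\<lambda>z. h z * qexp (- of_int n * z))"
    by (intro holomorphic_on_imp_continuous_on holomorphic_intros holomorphic_on_subset[OF h])
      (auto simp: abs_real_def)
  then show ?thesis by (rule continuous_on_compose2) (auto intro!: continuous_intros)
qed

lemma fourier_coeff_by_parts: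
  assumes h: "h holomorphic_on ball 0 1"
  shows "2 * of_real pi * \<i> * of_int n * fourier_coeff h n =
    fourier_coeff (deriv h) n - (h (1/2) * qexp (- of_int n / 2) - h (-1/2) * qexp (of_int n / 2))"
proof -
  have d: "deriv h holomorphic_on ball 0 1"
    by (intro holomorphic_deriv h) auto
  have "((\<lambda>x. deriv h (of_real x) * qexp (- of_int n * of_real x)
      - 2 * of_real pi * \<i> * of_int n * (h (of_real x) * qexp (- of_int n * of_real x))) has_integral
      (h (of_real (1/2)) * qexp (- of_int n * of_real (1/2)) - h (of_real (-1/2)) * qexp (- of_int n * of_real (-1/2)))) {-1/2..1/2::real}"
    by (rule fundamental_theorem_of_calculus) (use fourier_integrand_derivative[OF h] in auto)
  moreover have "((\<lambda>x. deriv h (of_real x) * qexp (- of_int n * of_real x)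
      - 2 * of_real pi * \<i> * of_int n * (h (of_real x) * qexp (- of_int n * of_real x))) has_integral
      fourier_coeff (deriv h) n - 2 * of_real pi * \<i> * of_int n * fourier_coeff h n) {-1/2..1/2::real}"
    unfolding fourier_coeff_def
    by (intro has_integral_diff has_integral_mult_right integrable_integral
        integrable_continuous_interval continuous_on_fourier_integrand h d)
  ultimately have "h (of_real (1/2)) * qexp (- of_int n * of_real (1/2)) - h (of_real (-1/2)) * qexp (- of_int n * of_real (-1/2))
      = fourier_coeff (deriv h) n - 2 * of_real pi * \<i> * of_int n * fourier_coeff h n"
    by (rule has_integral_unique)
  then show ?thesis by (simp add: algebra_simps)
qed

lemma norm_qexp_real [simp]: "norm (qexp (of_real x)) = 1"
  by (simp add: norm_qexp)

lemma norm_fourier_coeff_bounded: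
  assumes h: "h holomorphic_on ball 0 1"
  obtains B where "B \<ge> 0" "\<And>n. norm (fourier_coeff h n) \<le> B"
proof -
  have "compact ((\<lambda>x. h (of_real x)) ` {-1/2..1/2::real})"
    using continuous_on_fourier_integrand[OF h, of 0]
    by (intro compact_continuous_image) (auto simp: qexp_def)
  then obtain B where B: "\<And>x. x \<in> {-1/2..1/2::real} \<Longrightarrow> norm (h (of_real x)) \<le> B"
    by (force dest!: compact_imp_bounded simp: bounded_iff)
  have "norm (fourier_coeff h n) \<le> B * (1/2 - (-1/2))" for n
    unfolding fourier_coeff_def
  proof (rule integral_bound[OF _ continuous_on_fourier_integrand[OF h]])
    fix t :: real assume "t \<in> {-1/2..1/2}"
    then show "norm (h (of_real t) * qexp (- of_int n * of_real t)) \<le> B"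
      using B[of t] norm_qexp_real[of "- of_int n * t"] by (simp add: norm_mult del: norm_qexp_real)
  qed auto
  moreover have "B \<ge> 0" using B[of 0] norm_ge_zero[of "h 0"] by (simp del: norm_ge_zero)
  ultimately show ?thesis using that by simp
qed

text \<open>
  The quantitative form that integration by parts gives: the coefficients are \<open>O(1 / n)\<close>. The
  boundary terms do not cancel for a function without period 1, but they stay bounded.
\<close>

lemma riemann_lebesgue:
  assumes h: "h holomorphic_on ball 0 1"
  obtains C where "\<And>n. \<bar>of_int n\<bar> * norm (fourier_coeff h n) \<le> C"
proof -
  have d: "deriv h holomorphic_on ball 0 1"
    by (intro holomorphic_deriv h) auto
  obtain B where B: "\<And>n. norm (fourier_coeff (deriv h) n) \<le> B"
    using norm_fourier_coeff_bounded[OF d] by blast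
  have "\<bar>of_int n\<bar> * norm (fourier_coeff h n) \<le> B + (norm (h (1/2)) + norm (h (-1/2)))" for n
  proof -
    have "1 * (\<bar>of_int n\<bar> * norm (fourier_coeff h n)) \<le> 2 * pi * (\<bar>of_int n\<bar> * norm (fourier_coeff h n))"
      using pi_gt3 by (intro mult_right_mono) auto
    also have "\<dots> = norm (2 * of_real pi * \<i> * of_int n * fourier_coeff h n)"
      by (simp add: norm_mult)
    also have "\<dots> \<le> norm (fourier_coeff (deriv h) n) +
        (norm (h (1/2) * qexp (- of_int n / 2)) + norm (h (-1/2) * qexp (of_int n / 2)))"
      unfolding fourier_coeff_by_parts[OF h]
      by (intro norm_triangle_ineq4[THEN order_trans] add_left_mono norm_triangle_ineq4)
    also have "\<dots> \<le> B + (norm (h (1/2)) + norm (h (-1/2)))"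
      using norm_qexp_real[of "- of_int n / 2"] norm_qexp_real[of "of_int n / 2"] B
      by (simp add: norm_mult del: norm_qexp_real)
    finally show ?thesis by simp
  qed
  then show ?thesis using that by blast
qed

lemma fourier_coeff_tendsto_0:
  assumes h: "h holomorphic_on ball 0 1" and m: "\<And>n. m n \<ge> int n"
  shows "(\<lambda>n. fourier_coeff h (m n)) \<longlonglongrightarrow> 0" and "(\<lambda>n. fourier_coeff h (- m n)) \<longlonglongrightarrow> 0"
proof -
  obtain C where C: "\<And>n. \<bar>of_int n\<bar> * norm (fourier_coeff h n) \<le> C"
    using riemann_lebesgue[OF h] by blast
  have *: "norm (fourier_coeff h k) \<le> C / of_nat n" if "n > 0" "\<bar>k\<bar> \<ge> int n" for n k
  proof -
    have "real n * norm (fourier_coeff h k) \<le> \<bar>of_int k\<bar> * norm (fourier_coeff h k)"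
      using that by (intro mult_right_mono) auto
    with C[of k] that show ?thesis by (simp add: field_simps)
  qed
  have lim: "(\<lambda>n. C / real n) \<longlonglongrightarrow> 0" by real_asymp
  have "norm (fourier_coeff h (m n)) \<le> C / real n" "norm (fourier_coeff h (- m n)) \<le> C / real n"
    if "n \<ge> 1" for n
    using that m[of n] by (intro *; linarith)+
  then have "\<forall>\<^sub>F n in sequentially. norm (fourier_coeff h (m n)) \<le> C / real n"
    and "\<forall>\<^sub>F n in sequentially. norm (fourier_coeff h (- m n)) \<le> C / real n"
    by (auto intro: eventually_sequentiallyI[of 1])
  then show "(\<lambda>n. fourier_coeff h (m n)) \<longlonglongrightarrow> 0" "(\<lambda>n. fourier_coeff h (- m n)) \<longlonglongrightarrow> 0"
    using lim by (auto intro: Lim_null_comparison)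
qed

lemma atLeastAtMost_minus_Suc:
  "{- int (Suc M)..int (Suc M)} = insert (- int (Suc M)) (insert (int (Suc M)) {- int M..int M})"
  by auto

lemma sum_symmetric_Suc:
  fixes f :: "int \<Rightarrow> 'a::comm_monoid_add"
  shows "sum f {- int (Suc M)..int (Suc M)} = f (- int (Suc M)) + (f (int (Suc M)) + sum f {- int M..int M})"
  unfolding atLeastAtMost_minus_Suc by (subst sum.insert; simp)+

lemma fourier_coeff_const: "fourier_coeff (\<lambda>_. c) n = (if n = 0 then c else 0)"
proof (cases "n = 0")
  case True
  then show ?thesis by (simp add: fourier_coeff_def qexp_def)
next
  case False
  have "qexp (of_int n / 2) = qexp (- of_int n / 2 + of_int n)" by (simp add: field_simps)
  also have "\<dots> = qexp (- of_int n / 2)" by (simp only: qexp_add qexp_int mult_1_right)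
  finally have "2 * of_real pi * \<i> * of_int n * fourier_coeff (\<lambda>_. c) n = fourier_coeff (\<lambda>_. 0) n"
    using fourier_coeff_by_parts[of "\<lambda>_. c" n] by simp
  then show ?thesis using False by (simp add: fourier_coeff_def)
qed

text \<open>
  Chernoff's argument. The function \<open>F - F 0\<close> is divisible by \<open>qexp - 1\<close>, which has only a simple
  zero in the disc. If \<open>h\<close> is the quotient, then apart from the constant \<open>F 0\<close> the coefficient with
  index \<open>m\<close> of \<open>F\<close> is the difference of two neighbouring coefficients of \<open>h\<close>. So the partial sums
  telescope, and the end terms tend to zero.
\<close>

lemma fourier_series_at_0:
  assumes F: "F holomorphic_on ball 0 1"
  shows "(\<lambda>M. \<Sum>m\<in>{- int M..int M}. fourier_coeff F m) \<longlonglongrightarrow> F 0"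
proof -
  \<comment> \<open>the quotient \<open>h\<close>, with the removable singularity at zero removed in numerator and denominator\<close>
  define p where "p z = (if z = 0 then deriv F 0 else (F z - F 0) / (z - 0))" for z
  define r where "r z = (if z = 0 then deriv qexp 0 else (qexp z - qexp 0) / (z - 0))" for z
  have p: "p holomorphic_on ball 0 1" and r: "r holomorphic_on ball 0 1"
    unfolding p_def r_def by (intro pole_lemma_open F qexp_holomorphic holomorphic_intros open_ball)+
  have "(qexp has_field_derivative 2 * of_real pi * \<i>) (at 0)"
    unfolding qexp_def by (auto intro!: derivative_eq_intros)
  then have "deriv qexp 0 = 2 * of_real pi * \<i>" by (rule DERIV_imp_deriv)
  then have r0: "r z \<noteq> 0" if "z \<in> ball 0 1" for z
    using that by (auto simp: r_def qexp_eq_1_iff qexp_def[of 0])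
  define h where "h z = p z / r z" for z
  have h: "h holomorphic_on ball 0 1"
    unfolding h_def by (intro holomorphic_on_divide p r r0)
  have F_eq_0: "F z = F 0 + h z * (qexp z - 1)" if "z \<in> ball 0 1" for z
    using r0[OF that] by (auto simp: h_def p_def r_def qexp_def[of 0])
  then have F_eq: "F (of_real x) * qexp (- of_int m * of_real x) = F 0 * qexp (- of_int m * of_real x)
      + h (of_real x) * qexp (- of_int (m - 1) * of_real x) - h (of_real x) * qexp (- of_int m * of_real x)"
    if "x \<in> {-1/2..1/2}" for x m
  proof -
    have "qexp (- of_int (m - 1) * of_real x) = qexp (of_real x + - of_int m * of_real x)"
      by (simp add: algebra_simps)
    then have "qexp (- of_int (m - 1) * of_real x) = qexp (of_real x) * qexp (- of_int m * of_real x)"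
      by (simp only: qexp_add)
    moreover have "of_real x \<in> ball (0::complex) 1" using that by (auto simp: abs_real_def)
    then have "F (of_real x) = F 0 + h (of_real x) * (qexp (of_real x) - 1)"
      by (rule F_eq_0)
    moreover have "(F0 + b * (Q - 1)) * R = F0 * R + b * (Q * R) - b * R" for F0 b Q R :: complex
      by (simp add: algebra_simps)
    ultimately show ?thesis by (simp only:)
  qed
  have step: "fourier_coeff F m = (if m = 0 then F 0 else 0) + fourier_coeff h (m - 1) - fourier_coeff h m" for m
  proof -
    have "fourier_coeff F m = integral {-1/2..1/2} (\<lambda>x. F 0 * qexp (- of_int m * of_real x)
      + h (of_real x) * qexp (- of_int (m - 1) * of_real x) - h (of_real x) * qexp (- of_int m * of_real x))"
      unfolding fourier_coeff_def by (intro integral_cong F_eq)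
    also have "\<dots> = fourier_coeff (\<lambda>_. F 0) m + fourier_coeff h (m - 1) - fourier_coeff h m"
      unfolding fourier_coeff_def
      by (subst integral_diff integral_add;
          (intro integrable_add integrable_continuous_interval continuous_on_fourier_integrand h holomorphic_intros)?)+
         simp
    finally show ?thesis by (simp add: fourier_coeff_const)
  qed
  have "(\<Sum>m\<in>{- int M..int M}. fourier_coeff F m) =
      F 0 + fourier_coeff h (- int (Suc M)) - fourier_coeff h (int M)" for M
  proof (induction M)
    case 0
    show ?case by (simp add: step)
  next
    case (Suc M)
    have "- int (Suc M) - 1 = - int (Suc (Suc M))" "int (Suc M) - 1 = int M" by auto
    then show ?case unfolding sum_symmetric_Suc Suc by (simp only: step) simp
  qed
  moreover have "(\<lambda>M. F 0 + fourier_coeff h (- int (Suc M)) - fourier_coeff h (int M)) \<longlonglongrightarrow> F 0 + 0 - 0"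
    by (intro tendsto_intros fourier_coeff_tendsto_0[OF h]) auto
  ultimately show ?thesis by simp
qed

text \<open>
  This turns unconditional sums over the integers into limits of symmetric partial sums, the shape in
  which Fourier series appear here.
\<close>

lemma filterlim_symmetric_interval:
  "filterlim (\<lambda>M. {- int M..int M}) (finite_subsets_at_top UNIV) sequentially"
  unfolding filterlim_finite_subsets_at_top
proof safe
  fix X :: "int set" assume X: "finite X"
  have "X \<subseteq> {- int M..int M}" if "M \<ge> nat (\<Sum>x\<in>X. \<bar>x\<bar>)" for M
  proof
    fix x assume "x \<in> X"
    then have "\<bar>x\<bar> \<le> (\<Sum>x\<in>X. \<bar>x\<bar>)" using X by (intro member_le_sum) auto
    then show "x \<in> {- int M..int M}" using that by auto
  qed
  then show "\<forall>\<^sub>F M in sequentially. finite {- int M..int M} \<and> X \<subseteq> {- int M..int M} \<and> {- int M..int M} \<subseteq> UNIV"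
    by (intro eventually_sequentiallyI[of "nat (\<Sum>x\<in>X. \<bar>x\<bar>)"]) auto
qed

lemma has_sum_imp_symmetric_LIMSEQ:
  assumes "(f has_sum S) (UNIV :: int set)"
  shows "(\<lambda>M. \<Sum>m\<in>{- int M..int M}. f m) \<longlonglongrightarrow> S"
  using filterlim_compose[OF _ filterlim_symmetric_interval] assms unfolding has_sum_def .

section \<open>The inversion formula of the theta series\<close>

context
  fixes t :: real
  assumes t: "t > 0"
begin

definition gaussian :: "complex \<Rightarrow> complex" where
  "gaussian w = exp (- (of_real pi * of_real t * w\<^sup>2))"

text \<open>
  The characteristic function of the standard normal distribution after the substitution
  \<open>y = sqrt (2 * pi * t) * x\<close>.
\<close>

lemma gaussian_integral:
  fixes m :: int
  defines "g \<equiv> (\<lambda>x. gaussian (of_real x) * qexp (- of_int m * of_real x))"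
  shows "integrable lborel g"
    and "integral\<^sup>L lborel g = exp (- of_real (pi * of_int (m\<^sup>2) / t)) / of_real (sqrt t)"
proof -
  define c where "c = sqrt (2 * pi * t)"
  have c: "c > 0" "c\<^sup>2 = 2 * pi * t" using t by (auto simp: c_def)
  \<comment> \<open>the frequency at which the characteristic function is evaluated, so that \<open>u * (c * x) = - 2 * pi * m * x\<close>\<close>
  define u where "u = - 2 * pi * of_int m / c"
  define G where "G y = std_normal_density y *\<^sub>R iexp (u * y)" for y
  have intG: "integrable lborel G"
  proof (rule Bochner_Integration.integrable_bound)
    show "integrable lborel std_normal_density"
      by simp
    show "G \<in> borel_measurable lborel" unfolding G_def by measurable
    show "AE x in lborel. norm (G x) \<le> norm (std_normal_density x)"
      by (simp add: G_def)
  qed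
  have G: "integral\<^sup>L lborel G = of_real (exp (- (u\<^sup>2) / 2))"
  proof -
    have "char std_normal_distribution u = integral\<^sup>L lborel G"
      unfolding char_def G_def by (subst integral_density) auto
    then show ?thesis by (simp add: char_std_normal_distribution)
  qed
  have scale: "G (0 + c * x) = g x / of_real (sqrt (2 * pi))" for x
  proof -
    have "u * (c * x) = - 2 * pi * of_int m * x" using c by (simp add: u_def)
    then have 1: "iexp (u * (0 + c * x)) = qexp (- of_int m * of_real x)"
      by (simp add: qexp_def mult_ac)
    have "- (0 + c * x)\<^sup>2 / 2 = - (pi * t * x\<^sup>2)" using c by (simp add: power_mult_distrib)
    then have "of_real (exp (- (0 + c * x)\<^sup>2 / 2)) = exp (complex_of_real (- (pi * t * x\<^sup>2)))"
      by (simp only: exp_of_real)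
    also have "\<dots> = gaussian (of_real x)"
      by (simp add: gaussian_def)
    finally have "of_real (exp (- (0 + c * x)\<^sup>2 / 2)) = gaussian (of_real x)" .
    then show ?thesis
      unfolding G_def g_def 1 std_normal_density_def by (simp add: scaleR_conv_of_real)
  qed
  have "integrable lborel (\<lambda>x. G (0 + c * x))"
    using intG c by (intro lborel_integrable_real_affine) auto
  then have "integrable lborel (\<lambda>x. of_real (sqrt (2 * pi)) * (g x / of_real (sqrt (2 * pi))))"
    unfolding scale by (rule integrable_mult_right)
  then show "integrable lborel g" by simp
  have "integral\<^sup>L lborel G = \<bar>c\<bar> *\<^sub>R integral\<^sup>L lborel (\<lambda>x. G (0 + c * x))"
    using c by (intro lborel_integral_real_affine) auto
  also have "\<dots> = of_real (c / sqrt (2 * pi)) * integral\<^sup>L lborel g"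
    unfolding scale using c by (simp add: scaleR_conv_of_real)
  also have "c / sqrt (2 * pi) = sqrt t" by (simp add: c_def real_sqrt_mult)
  finally have "integral\<^sup>L lborel g = of_real (exp (- (u\<^sup>2) / 2)) / of_real (sqrt t)"
    using t unfolding G by (simp add: field_simps)
  also have "u\<^sup>2 / 2 = pi * of_int (m\<^sup>2) / t"
    using t unfolding u_def power_divide c(2) by (simp add: power_mult_distrib power2_eq_square field_simps)
  then have "- (u\<^sup>2) / 2 = - (pi * of_int (m\<^sup>2) / t)" by simp
  finally show "integral\<^sup>L lborel g = exp (- of_real (pi * of_int (m\<^sup>2) / t)) / of_real (sqrt t)"
    by (simp only: exp_of_real[symmetric] of_real_minus)
qed

text \<open>
  A bound that is uniform on the unit disc. It comes from \<open>(x + n)\<^sup>2 \<ge> n\<^sup>2 / 2 - x\<^sup>2\<close>.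
\<close>

lemma gaussian_bound:
  assumes "norm w \<le> 1"
  shows "norm (gaussian (w + of_int n)) \<le> exp (2 * pi * t) * exp (- pi * t / 2) ^ nat \<bar>n\<bar>"
proof -
  define x y where "x = Re w" and "y = Im w"
  have w: "x\<^sup>2 \<le> 1" "y\<^sup>2 \<le> 1"
    using assms abs_Re_le_cmod[of w] abs_Im_le_cmod[of w] by (simp_all add: x_def y_def abs_square_le_1)
  have "\<bar>n\<bar> * 1 \<le> \<bar>n\<bar> * \<bar>n\<bar>" by (cases "n = 0") (simp, intro mult_left_mono, auto)
  then have "\<bar>n\<bar> \<le> n\<^sup>2" by (simp add: power2_eq_square)
  then have "real_of_int \<bar>n\<bar> \<le> real_of_int (n\<^sup>2)" by (rule of_int_le_iff[THEN iffD2])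
  then have n: "\<bar>real_of_int n\<bar> \<le> (real_of_int n)\<^sup>2" by simp
  have "0 \<le> (of_int n + 2 * x)\<^sup>2" by simp
  then have "(of_int n)\<^sup>2 / 2 - x\<^sup>2 \<le> (x + of_int n)\<^sup>2" by (simp add: power2_eq_square algebra_simps)
  with n w have "\<bar>of_int n\<bar> / 2 - 2 \<le> (x + of_int n)\<^sup>2 - y\<^sup>2" by linarith
  then have "(pi * t) * (\<bar>of_int n\<bar> / 2 - 2) \<le> (pi * t) * ((x + of_int n)\<^sup>2 - y\<^sup>2)"
    using t by (intro mult_left_mono) auto
  then have "norm (gaussian (w + of_int n)) \<le> exp (- ((pi * t) * (\<bar>of_int n\<bar> / 2 - 2)))"
    by (simp add: gaussian_def norm_exp_eq_Re power2_eq_square x_def y_def algebra_simps)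
  also have "\<dots> = exp (2 * pi * t + of_nat (nat \<bar>n\<bar>) * (- pi * t / 2))"
    by (simp add: algebra_simps)
  also have "\<dots> = exp (2 * pi * t) * exp (- pi * t / 2) ^ nat \<bar>n\<bar>"
    by (simp only: exp_add exp_of_nat_mult)
  finally show ?thesis .
qed

lemma gaussian_bound_summable:
  "(\<lambda>n::int. exp (2 * pi * t) * exp (- pi * t / 2) ^ nat \<bar>n\<bar>) summable_on UNIV"
  using t by (intro summable_on_cmult_right summable_on_geometric_int) auto

definition periodized_gaussian :: "complex \<Rightarrow> complex" where
  "periodized_gaussian w = (\<Sum>\<^sub>\<infinity>n::int. gaussian (w + of_int n))"

lemma periodized_gaussian_holomorphic: "periodized_gaussian holomorphic_on ball 0 1"
  unfolding periodized_gaussian_def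
proof (rule infsum_holomorphic)
  show "(\<lambda>w. gaussian (w + of_int n)) holomorphic_on ball 0 1" for n :: int
    unfolding gaussian_def by (intro holomorphic_intros)
  fix x :: complex assume "x \<in> ball 0 1"
  then obtain e where "e > 0" "cball x e \<subseteq> ball 0 1"
    using open_contains_cball open_ball by blast
  moreover from this have "\<forall>n::int\<in>UNIV. \<forall>z\<in>cball x e. norm (gaussian (z + of_int n)) \<le>
      exp (2 * pi * t) * exp (- pi * t / 2) ^ nat \<bar>n\<bar>"
    by (intro ballI gaussian_bound) force
  ultimately show "\<exists>e>0. \<exists>M. M summable_on UNIV \<and> (\<forall>n::int\<in>UNIV. \<forall>z\<in>cball x e. norm (gaussian (z + of_int n)) \<le> M n)"
    using gaussian_bound_summable by blast
qed auto

text \<open>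
  Unfolding: the integrals of the translates over one period add up to the integral over the real
  line, because the exponential has period 1.
\<close>

lemma fourier_coeff_periodized_gaussian:
  "fourier_coeff periodized_gaussian m = exp (- of_real (pi * of_int (m\<^sup>2) / t)) / of_real (sqrt t)"
proof -
  define g where "g = (\<lambda>x::real. gaussian (of_real x) * qexp (- of_int m * of_real x))"
  have cont: "continuous_on A g" for A
    unfolding g_def gaussian_def qexp_def by (intro continuous_intros)
  then have int: "g integrable_on {a..b}" for a b by (rule integrable_continuous_interval)
  have bound: "norm (g (x + of_int n)) \<le> exp (2 * pi * t) * exp (- pi * t / 2) ^ nat \<bar>n\<bar>"
    if "x \<in> {-1/2..1/2}" for x and n :: int
  proof -
    have "norm (g (x + of_int n)) = norm (gaussian (of_real x + of_int n))"
      using norm_qexp_real[of "- of_int m * (x + of_int n)"] by (simp add: g_def norm_mult del: norm_qexp_real)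
    also have "\<dots> \<le> exp (2 * pi * t) * exp (- pi * t / 2) ^ nat \<bar>n\<bar>"
      using that by (intro gaussian_bound) (auto simp: abs_real_def)
    finally show ?thesis .
  qed
  have "uniform_limit {-1/2..1/2} (\<lambda>X x. \<Sum>n\<in>X. g (x + of_int n)) (\<lambda>x. \<Sum>\<^sub>\<infinity>n::int. g (x + of_int n)) (finite_subsets_at_top UNIV)"
    by (rule Weierstrass_m_test_general[OF bound gaussian_bound_summable])
  then have ul: "uniform_limit {-1/2..1/2} (\<lambda>M x. \<Sum>n\<in>{- int M..int M}. g (x + of_int n)) (\<lambda>x. \<Sum>\<^sub>\<infinity>n::int. g (x + of_int n)) sequentially"
    by (rule filterlim_compose[OF _ filterlim_symmetric_interval])
  have "(\<Sum>\<^sub>\<infinity>n::int. g (x + of_int n)) = periodized_gaussian (of_real x) * qexp (- of_int m * of_real x)" for x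
  proof -
    have "qexp (- of_int m * of_real (x + of_int n)) = qexp (- of_int m * of_real x)" for n
    proof -
      have "- of_int m * complex_of_real (x + of_int n) = - of_int m * of_real x + of_int (- m * n)"
        by (simp add: algebra_simps)
      then show ?thesis by (simp only: qexp_add qexp_int mult_1_right)
    qed
    then show ?thesis
      unfolding g_def periodized_gaussian_def by (simp add: infsum_cmult_left')
  qed
  then have F: "fourier_coeff periodized_gaussian m = integral {-1/2..1/2} (\<lambda>x. \<Sum>\<^sub>\<infinity>n::int. g (x + of_int n))"
    unfolding fourier_coeff_def by (intro integral_cong) simp
  have shift: "integral {-1/2..1/2} (\<lambda>x. g (x + c)) = integral {c-1/2..c+1/2} g" for c
    using integral_shift_Icc_real[of "-1/2" "1/2" g c] by (simp add: o_def add.commute)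
  have "integral {-1/2..1/2} (\<lambda>x. \<Sum>n\<in>{- int M..int M}. g (x + of_int n)) = integral {-(real M + 1/2)..real M + 1/2} g" for M
  proof -
    have "integral {-1/2..1/2} (\<lambda>x. \<Sum>n\<in>{- int M..int M}. g (x + of_int n)) =
        (\<Sum>n\<in>{- int M..int M}. integral {-1/2..1/2} (\<lambda>x. g (x + of_int n)))"
      by (intro integral_sum integrable_continuous_interval continuous_on_compose2[OF cont[of UNIV]]) (auto intro!: continuous_intros)
    also have "\<dots> = (\<Sum>n\<in>{- int M..int M}. integral {of_int n-1/2..of_int n+1/2} g)"
      by (simp only: shift)
    also have "\<dots> = integral {-(real M + 1/2)..real M + 1/2} g"
    proof (induction M)
      case 0
      show ?case by simp
    next
      case (Suc M)
      have e1: "integral {-(real (Suc M) + 1/2)..-(real M + 1/2)} g + integral {-(real M + 1/2)..real M + 1/2} g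
          = integral {-(real (Suc M) + 1/2)..real M + 1/2} g"
        by (intro Henstock_Kurzweil_Integration.integral_combine int) auto
      have e2: "integral {-(real (Suc M) + 1/2)..real M + 1/2} g + integral {real M + 1/2..real (Suc M) + 1/2} g
          = integral {-(real (Suc M) + 1/2)..real (Suc M) + 1/2} g"
        by (intro Henstock_Kurzweil_Integration.integral_combine int) auto
      have e3: "of_int (- int (Suc M)) - 1/2 = -(real (Suc M) + 1/2)"
        "of_int (- int (Suc M)) + 1/2 = -(real M + 1/2)"
        "of_int (int (Suc M)) - 1/2 = real M + 1/2"
        "of_int (int (Suc M)) + 1/2 = real (Suc M) + 1/2"
        by simp_all
      show ?case
        unfolding sum_symmetric_Suc Suc e3 e2[symmetric] e1[symmetric] by (simp only: add_ac)
    qed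
    finally show ?thesis .
  qed
  moreover have "(\<lambda>M. integral {-1/2..1/2} (\<lambda>x. \<Sum>n\<in>{- int M..int M}. g (x + of_int n))) \<longlonglongrightarrow>
      integral {-1/2..1/2} (\<lambda>x. \<Sum>\<^sub>\<infinity>n::int. g (x + of_int n))"
  proof -
    obtain I J where IJ: "\<And>M. ((\<lambda>x. \<Sum>n\<in>{- int M..int M}. g (x + of_int n)) has_integral I M) {-1/2..1/2}"
       "((\<lambda>x. \<Sum>\<^sub>\<infinity>n::int. g (x + of_int n)) has_integral J) {-1/2..1/2}" "I \<longlonglongrightarrow> J"
      by (rule uniform_limit_integral[OF ul])
        (auto intro!: continuous_intros continuous_on_compose2[OF cont[of UNIV]])
    show ?thesis
      using IJ(3) integral_unique[OF IJ(1)] integral_unique[OF IJ(2)] by simp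
  qed
  moreover have "(\<lambda>M. integral {-(real M + 1/2)..real M + 1/2} g) \<longlonglongrightarrow> integral\<^sup>L lborel g"
  proof -
    have g: "integrable lborel g" unfolding g_def by (rule gaussian_integral)
    have "(\<lambda>M. LINT x|lborel. indicator {-(real M + 1/2)..real M + 1/2} x *\<^sub>R g x) \<longlonglongrightarrow> integral\<^sup>L lborel g"
    proof (rule integral_dominated_convergence[where w = "\<lambda>x. norm (g x)"])
      show "AE x in lborel. (\<lambda>M. indicator {-(real M + 1/2)..real M + 1/2} x *\<^sub>R g x) \<longlonglongrightarrow> g x"
      proof (intro AE_I2 tendsto_eventually)
        fix x :: real
        obtain N where N: "\<bar>x\<bar> \<le> real N" using real_arch_simple by blast
        show "\<forall>\<^sub>F M in sequentially. indicator {-(real M + 1/2)..real M + 1/2} x *\<^sub>R g x = g x"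
          using N by (intro eventually_sequentiallyI[of N]) (auto simp: indicator_def abs_real_def split: if_splits)
      qed
    qed (use g in \<open>auto intro!: AE_I2 simp: indicator_def\<close>)
    moreover have "(LINT x|lborel. indicator {a..b} x *\<^sub>R g x) = integral {a..b} g" for a b
      using set_borel_integral_eq_integral(2)[of "{a..b}" g] g
      by (simp add: set_lebesgue_integral_def set_integrable_def integrable_mult_indicator)
    ultimately show ?thesis by simp
  qed
  ultimately have "fourier_coeff periodized_gaussian m = integral\<^sup>L lborel g"
    unfolding F by (metis (no_types, lifting) LIMSEQ_unique ext)
  then show ?thesis unfolding g_def gaussian_integral .
qed

lemma Theta_inversion_imaginary: "Theta (\<i> * of_real (1 / (2 * t))) = of_real (sqrt t) * Theta (\<i> * of_real (t / 2))"
proof -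
  have q: "qexp (\<i> * of_real (s / 2)) ^ nat (n\<^sup>2) = exp (- of_real (pi * of_int (n\<^sup>2) * s))" for n :: int and s
  proof -
    have "qexp (\<i> * of_real (s / 2)) = exp (- of_real (pi * s))" by (simp add: qexp_def)
    then have "qexp (\<i> * of_real (s / 2)) ^ nat (n\<^sup>2) = exp (of_nat (nat (n\<^sup>2)) * - of_real (pi * s))"
      by (simp only: exp_of_nat_mult)
    also have "of_nat (nat (n\<^sup>2)) = (of_int (n\<^sup>2) :: complex)" by (simp only: of_nat_nat zero_le_power2)
    finally show ?thesis by (simp add: mult_ac)
  qed
  have "periodized_gaussian 0 = Theta (\<i> * of_real (t / 2))"
    unfolding periodized_gaussian_def Theta_def q by (simp add: gaussian_def mult_ac)
  then have "(\<lambda>M. \<Sum>m\<in>{- int M..int M}. fourier_coeff periodized_gaussian m) \<longlonglongrightarrow> Theta (\<i> * of_real (t / 2))"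
    using fourier_series_at_0[OF periodized_gaussian_holomorphic] by simp
  moreover have "((\<lambda>m::int. exp (- of_real (pi * of_int (m\<^sup>2) / t))) has_sum Theta (\<i> * of_real (1 / t / 2))) UNIV"
    using has_sum_Theta[of "\<i> * of_real (1 / t / 2)"] t unfolding q by simp
  then have "((\<lambda>m::int. exp (- of_real (pi * of_int (m\<^sup>2) / t)) * (1 / of_real (sqrt t))) has_sum
     Theta (\<i> * of_real (1 / t / 2)) * (1 / of_real (sqrt t))) UNIV"
    by (rule has_sum_cmult_left)
  then have "(\<lambda>M. \<Sum>m\<in>{- int M..int M}. fourier_coeff periodized_gaussian m) \<longlonglongrightarrow>
      Theta (\<i> * of_real (1 / t / 2)) * (1 / of_real (sqrt t))"
    unfolding fourier_coeff_periodized_gaussian by (intro has_sum_imp_symmetric_LIMSEQ) simp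
  ultimately have "Theta (\<i> * of_real (t / 2)) = Theta (\<i> * of_real (1 / t / 2)) * (1 / of_real (sqrt t))"
    by (rule LIMSEQ_unique)
  then show ?thesis using t by (simp add: field_simps)
qed

end

text \<open>
  The principal branch is holomorphic here, since \<open>- 2 * \<i> * z\<close> has positive real part on the upper
  half-plane.
\<close>

definition inversion_factor :: "complex \<Rightarrow> complex" where
  "inversion_factor z = csqrt (- 2 * \<i> * z)"

lemma inversion_factor_holomorphic: "inversion_factor holomorphic_on upper_half_plane"
  unfolding inversion_factor_def
  by (intro holomorphic_intros) (auto simp: upper_half_plane_def complex_nonpos_Reals_iff)

lemma Im_inversion: "Im z > 0 \<Longrightarrow> Im (- 1 / (4 * z)) > 0"
  by (simp add: Im_divide zero_less_divide_iff power2_eq_square add_pos_nonneg add_nonneg_pos sum_squares_gt_zero_iff)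

text \<open>
  On the imaginary axis this is the statement that the Fourier series of the periodized Gaussian
  converges to its value at the origin. Both sides are holomorphic, so it holds everywhere.
\<close>

theorem Theta_inversion:
  assumes z: "Im z > 0"
  shows "Theta (- 1 / (4 * z)) = inversion_factor z * Theta z"
proof -
  have "Theta (- 1 / (4 * z)) - inversion_factor z * Theta z = 0"
  proof (rule analytic_continuation[where f = "\<lambda>z. Theta (- 1 / (4 * z)) - inversion_factor z * Theta z"
        and S = upper_half_plane and U = "(\<lambda>t. \<i> * of_real (t / 2)) ` {0<..}" and \<xi> = "\<i>"])
    have "(\<lambda>z. Theta (- 1 / (4 * z))) holomorphic_on upper_half_plane"
    proof (rule holomorphic_on_compose_gen[OF _ Theta_holomorphic, of "\<lambda>z. - 1 / (4 * z)", unfolded o_def])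
      show "(\<lambda>z. - 1 / (4 * z)) holomorphic_on upper_half_plane"
        by (intro holomorphic_intros) (auto simp: upper_half_plane_def)
      show "(\<lambda>z. - 1 / (4 * z)) ` upper_half_plane \<subseteq> upper_half_plane"
        unfolding upper_half_plane_def using Im_inversion by blast
    qed
    then show "(\<lambda>z. Theta (- 1 / (4 * z)) - inversion_factor z * Theta z) holomorphic_on upper_half_plane"
      by (intro holomorphic_intros Theta_holomorphic inversion_factor_holomorphic)
    show "\<i> islimpt (\<lambda>t. \<i> * of_real (t / 2)) ` {0<..}"
    proof (subst islimpt_sequential, intro exI[of _ "\<lambda>n. \<i> * of_real (1 + 1 / real (Suc n))"] conjI allI)
      show "\<i> * of_real (1 + 1 / real (Suc n)) \<in> (\<lambda>t. \<i> * of_real (t / 2)) ` {0<..} - {\<i>}" for n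
        by (auto intro!: image_eqI[of _ _ "2 * (1 + 1 / real (Suc n))"] simp: complex_eq_iff add_pos_pos)
      have "(\<lambda>n. 1 + 1 / real (Suc n)) \<longlonglongrightarrow> 1" by real_asymp
      then have "(\<lambda>n. \<i> * of_real (1 + 1 / real (Suc n))) \<longlonglongrightarrow> \<i> * of_real 1"
        by (intro tendsto_intros)
      then show "(\<lambda>n. \<i> * of_real (1 + 1 / real (Suc n))) \<longlonglongrightarrow> \<i>" by simp
    qed
    show "Theta (- 1 / (4 * w)) - inversion_factor w * Theta w = 0"
      if w: "w \<in> (\<lambda>t. \<i> * of_real (t / 2)) ` {0<..}" for w
    proof -
      obtain t where t: "t > 0" "w = \<i> * of_real (t / 2)" using w by auto
      have "- 2 * \<i> * w = of_real t" unfolding t(2) by (simp add: complex_eq_iff)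
      then have "inversion_factor w = of_real (sqrt t)"
        using t(1) by (simp only: inversion_factor_def) simp
      moreover have "- 1 / (4 * w) = \<i> * of_real (1 / (2 * t))" using t by (simp add: field_simps)
      moreover have "Theta (\<i> * of_real (1 / (2 * t))) = of_real (sqrt t) * Theta w"
        unfolding t(2) by (rule Theta_inversion_imaginary[OF t(1)])
      ultimately show ?thesis by simp
    qed
  qed (use z open_upper_half_plane connected_upper_half_plane in \<open>auto simp: upper_half_plane_def\<close>)
  then show ?thesis by simp
qed

section \<open>The three theta constants\<close>

lemma inversion_factor_norm: "norm (inversion_factor z) ^ 2 = 2 * norm z"
proof -
  have "inversion_factor z ^ 2 = - 2 * \<i> * z" by (simp add: inversion_factor_def)
  then have "norm (inversion_factor z ^ 2) = norm (- 2 * \<i> * z)" by simp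
  then show ?thesis by (simp add: norm_mult norm_power)
qed

lemma inversion_factor_quarter: "inversion_factor (z / 4) = inversion_factor z / 2"
  unfolding inversion_factor_def
proof (rule csqrt_unique)
  show "(csqrt (- 2 * \<i> * z) / 2)\<^sup>2 = - 2 * \<i> * (z / 4)"
    by (simp add: power_divide)
  show "0 < Re (csqrt (- 2 * \<i> * z) / 2) \<or> Re (csqrt (- 2 * \<i> * z) / 2) = 0 \<and> 0 \<le> Im (csqrt (- 2 * \<i> * z) / 2)"
    using csqrt_principal[of "- 2 * \<i> * z"] by (simp add: Re_divide_numeral Im_divide_numeral)
qed

lemma Im_upper_nonzero: "Im z > 0 \<Longrightarrow> z \<noteq> 0" by auto

text \<open>
  In the classical notation, with \<open>\<tau> = 2 z\<close>: \<open>Theta z = \<theta>\<^sub>3(\<tau>)\<close>, \<open>Theta (z + 1/2) = \<theta>\<^sub>4(\<tau>)\<close> and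
  \<open>theta2 z = \<theta>\<^sub>2(\<tau>)\<close>. The difference leaves the terms with odd \<open>n\<close> in \<open>Theta (z / 4)\<close>.
\<close>

definition theta2 :: "complex \<Rightarrow> complex" where
  "theta2 z = Theta (z / 4) - Theta z"

lemma inversion_factor_times_4: "inversion_factor (4 * z) = 2 * inversion_factor z"
proof -
  have "inversion_factor z = inversion_factor (4 * z) / 2"
    using inversion_factor_quarter[of "4 * z"] by simp
  then have "2 * inversion_factor z = 2 * (inversion_factor (4 * z) / 2)" by (rule arg_cong)
  then show ?thesis by simp
qed

lemma Theta_half_inversion:
  assumes z: "Im z > 0"
  shows "Theta (- 1 / (4 * z) + 1/2) = inversion_factor z * theta2 z"
proof -
  have 1: "4 * (- 1 / (4 * z)) = - 1 / (4 * (z / 4))" using z by (simp add: field_simps Im_upper_nonzero)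
  have "Theta (- 1 / (4 * z) + 1/2) = 2 * Theta (4 * (- 1 / (4 * z))) - Theta (- 1 / (4 * z))"
    using Theta_half_shift[OF Im_inversion[OF z]] by (simp add: algebra_simps)
  also have "\<dots> = 2 * (inversion_factor (z / 4) * Theta (z / 4)) - inversion_factor z * Theta z"
    unfolding 1 using z by (subst (1 2) Theta_inversion) auto
  finally show ?thesis by (simp add: inversion_factor_quarter theta2_def algebra_simps)
qed

lemma theta2_inversion:
  assumes z: "Im z > 0"
  shows "theta2 (- 1 / (4 * z)) = inversion_factor z * Theta (z + 1/2)"
proof -
  have 1: "- 1 / (4 * z) / 4 = - 1 / (4 * (4 * z))" by simp
  have "theta2 (- 1 / (4 * z)) = inversion_factor (4 * z) * Theta (4 * z) - inversion_factor z * Theta z"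
    unfolding theta2_def 1 using z by (subst (1 2) Theta_inversion) auto
  also have "\<dots> = inversion_factor z * (2 * Theta (4 * z) - Theta z)"
    unfolding inversion_factor_times_4 by (simp add: right_diff_distrib)
  also have "2 * Theta (4 * z) - Theta z = Theta (z + 1/2)"
    using Theta_half_shift[OF z] by (simp add: algebra_simps)
  finally show ?thesis .
qed

lemma has_sum_theta2:
  assumes "Im z > 0"
  shows "((\<lambda>n::int. qexp (z / 4) ^ nat (n\<^sup>2)) has_sum theta2 z) {n. odd n}"
  using has_sum_Theta_odd[of "z / 4"] assms by (simp add: theta2_def)

lemma odd_square_power_unity_8:
  fixes w :: complex
  assumes "w ^ 8 = 1" "odd n"
  shows "w ^ nat (n\<^sup>2) = w"
proof -
  obtain j where "n = 2 * j + 1" using assms(2) oddE by blast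
  then have *: "n\<^sup>2 = 4 * (j * (j + 1)) + 1" by (simp add: power2_eq_square algebra_simps)
  have "even (j * (j + 1))" by simp
  then obtain i where i: "j * (j + 1) = 2 * i" by blast
  have "j * (j + 1) \<ge> 0" by (cases "j \<ge> 0") (auto intro: mult_nonpos_nonpos)
  then have "nat (n\<^sup>2) = 8 * nat i + 1"
    unfolding * i by (simp add: nat_add_distrib nat_mult_distrib)
  then show ?thesis by (simp only: power_add power_mult assms(1) power_one) simp
qed

text \<open>
  Odd squares are 1 modulo 8, so an eighth root of unity can be taken out of the series.
\<close>

lemma theta2_shift:
  assumes z: "Im z > 0" "Im (z + w) > 0" and w: "qexp (w / 4) ^ 8 = 1"
  shows "theta2 (z + w) = qexp (w / 4) * theta2 z"
proof -
  have "((\<lambda>n::int. qexp ((z + w) / 4) ^ nat (n\<^sup>2)) has_sum qexp (w / 4) * theta2 z) {n. odd n}"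
    using has_sum_cmult_right[OF has_sum_theta2[OF z(1)], of "qexp (w / 4)"]
    by (rule has_sum_cong[THEN iffD1, rotated])
      (simp add: add_divide_distrib qexp_add power_mult_distrib odd_square_power_unity_8[OF w])
  then show ?thesis using has_sum_theta2[OF z(2)] by (auto intro: has_sum_unique)
qed

section \<open>Moebius transformations and generators of modular groups\<close>

definition mat2 :: "int \<Rightarrow> int \<Rightarrow> int \<Rightarrow> int \<Rightarrow> int^2^2" where
  "mat2 a b c d = vector [vector [a, b], vector [c, d]]"

lemma mat2_sel [simp]:
  "mat2 a b c d $ 1 $ 1 = a" "mat2 a b c d $ 1 $ 2 = b" "mat2 a b c d $ 2 $ 1 = c" "mat2 a b c d $ 2 $ 2 = d"
  by (simp_all add: mat2_def vector_2)

lemma matrix_mult_sel: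
  fixes A B :: "int^2^2"
  shows "(A ** B) $ i $ j = A $ i $ 1 * B $ 1 $ j + A $ i $ 2 * B $ 2 $ j"
  by (simp add: matrix_matrix_mult_def sum_2)

definition SL2 :: "(int^2^2) set" where "SL2 = {A. det A = 1}"

lemma carrier_SL2Z: "carrier SL2Z = SL2" by (simp add: SL2Z_def SL2_def)

lemma SL2_iff:
  fixes A :: "int^2^2"
  shows "A \<in> SL2 \<longleftrightarrow> A $ 1 $ 1 * A $ 2 $ 2 - A $ 1 $ 2 * A $ 2 $ 1 = 1"
  by (simp add: SL2_def det_2)

lemma SL2_mult: "A \<in> SL2 \<Longrightarrow> B \<in> SL2 \<Longrightarrow> A ** B \<in> SL2"
  by (simp add: SL2_def det_mul)

lemma Gamma0_iff:
  fixes A :: "int^2^2"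
  shows "A \<in> Gamma0 N \<longleftrightarrow> A \<in> SL2 \<and> int N dvd A $ 2 $ 1"
  by (simp add: Gamma0_def carrier_SL2Z)

definition moebius_denom :: "int^2^2 \<Rightarrow> complex \<Rightarrow> complex" where
  "moebius_denom A z = of_int (A $ 2 $ 1) * z + of_int (A $ 2 $ 2)"

lemma moebius_denom_nonzero:
  assumes "A \<in> SL2" "Im z > 0"
  shows "moebius_denom A z \<noteq> 0"
proof
  assume "moebius_denom A z = 0"
  then have "Im (moebius_denom A z) = 0" "Re (moebius_denom A z) = 0" by simp_all
  then have "A $ 2 $ 1 = 0" "A $ 2 $ 2 = 0" using assms(2) by (simp_all add: moebius_denom_def)
  then show False using assms(1) by (simp add: SL2_iff)
qed

lemma moebius_eq_divide_denom:
  fixes A :: "int^2^2"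
  shows "moebius A z = (of_int (A $ 1 $ 1) * z + of_int (A $ 1 $ 2)) / moebius_denom A z"
  by (simp add: moebius_def moebius_denom_def)

lemma Im_moebius:
  assumes "A \<in> SL2" "Im z > 0"
  shows "Im (moebius A z) = Im z / norm (moebius_denom A z) ^ 2"
proof -
  have "(Im (of_int (A $ 1 $ 1) * z + of_int (A $ 1 $ 2)) * Re (moebius_denom A z) - Re (of_int (A $ 1 $ 1) * z + of_int (A $ 1 $ 2)) * Im (moebius_denom A z))
     = Im z * of_int (A $ 1 $ 1 * A $ 2 $ 2 - A $ 1 $ 2 * A $ 2 $ 1)"
    by (simp add: moebius_denom_def algebra_simps)
  also have "\<dots> = Im z" using assms(1) by (simp add: SL2_iff del: of_int_diff of_int_mult)
  finally show ?thesis unfolding moebius_eq_divide_denom Im_divide cmod_power2 by simp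
qed

lemma Im_moebius_pos: "A \<in> SL2 \<Longrightarrow> Im z > 0 \<Longrightarrow> Im (moebius A z) > 0"
  by (simp add: Im_moebius moebius_denom_nonzero)

lemma
  assumes "B \<in> SL2" "Im z > 0"
  shows moebius_mult: "moebius (A ** B) z = moebius A (moebius B z)"
    and moebius_denom_mult: "moebius_denom (A ** B) z = moebius_denom A (moebius B z) * moebius_denom B z"
proof -
  have B: "of_int (B $ 2 $ 1) * z + of_int (B $ 2 $ 2) \<noteq> 0"
    using moebius_denom_nonzero[OF assms] by (simp add: moebius_denom_def)
  show d: "moebius_denom (A ** B) z = moebius_denom A (moebius B z) * moebius_denom B z"
    using B by (simp add: moebius_denom_def moebius_def matrix_mult_sel field_simps)
  have "of_int ((A ** B) $ 1 $ 1) * z + of_int ((A ** B) $ 1 $ 2) =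
     (of_int (A $ 1 $ 1) * moebius B z + of_int (A $ 1 $ 2)) * moebius_denom B z"
    using B by (simp add: moebius_denom_def moebius_def matrix_mult_sel field_simps)
  then show "moebius (A ** B) z = moebius A (moebius B z)"
    unfolding moebius_eq_divide_denom[of "A ** B"] moebius_eq_divide_denom[of A] d using moebius_denom_nonzero[OF assms] by simp
qed

lemma moebius_holomorphic: "A \<in> SL2 \<Longrightarrow> moebius A holomorphic_on upper_half_plane"
  unfolding moebius_def using moebius_denom_nonzero[of A]
  by (intro holomorphic_intros) (auto simp: upper_half_plane_def moebius_denom_def)

lemma mat2_translation [simp]: "mat2 1 n 0 1 \<in> SL2" by (simp add: SL2_iff)

lemma moebius_translation [simp]: "moebius (mat2 1 n 0 1) z = z + of_int n"
  by (simp add: moebius_def)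

lemma moebius_upper_triangular:
  fixes A :: "int^2^2"
  assumes "A \<in> SL2" "A $ 2 $ 1 = 0"
  obtains n where "\<And>z. moebius A z = z + of_int n"
proof -
  have "A $ 1 $ 1 * A $ 2 $ 2 = 1" using assms by (simp add: SL2_iff)
  then have "(A $ 1 $ 1 = 1 \<and> A $ 2 $ 2 = 1) \<or> (A $ 1 $ 1 = -1 \<and> A $ 2 $ 2 = -1)"
    using zmult_eq_1_iff by auto
  then have "\<exists>n. \<forall>z. moebius A z = z + of_int n"
    using assms(2) by (auto simp: moebius_def intro: exI[of _ "A $ 1 $ 2"] exI[of _ "- A $ 1 $ 2"])
  then show ?thesis using that by blast
qed

lemma SL2_odd:
  fixes A :: "int^2^2"
  assumes "A \<in> SL2" "even (A $ 2 $ 1)"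
  shows "odd (A $ 2 $ 2)"
proof
  assume "even (A $ 2 $ 2)"
  then have "even (A $ 1 $ 1 * A $ 2 $ 2 - A $ 1 $ 2 * A $ 2 $ 1)" using assms(2) by auto
  moreover have "A $ 1 $ 1 * A $ 2 $ 2 - A $ 1 $ 2 * A $ 2 $ 1 = 1" using assms(1) by (simp only: SL2_iff)
  ultimately show False by (metis odd_one)
qed

text \<open>
  The group \<open>\<Gamma>\<^sub>0(4)\<close> is generated by \<open>- 1\<close>, by translations and by the transposed translations by
  multiples of 4. This is a Euclidean algorithm on the bottom row \<open>(c, d)\<close>: \<open>d\<close> can be made smaller
  when \<open>\<bar>c\<bar> < 2 \<bar>d\<bar>\<close> and \<open>c\<close> when \<open>\<bar>c\<bar> > 2 \<bar>d\<bar>\<close>; equality cannot occur because \<open>4\<close> divides \<open>c\<close> and \<open>d\<close>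
  is odd.
\<close>

lemma Gamma0_4_induct [consumes 1, case_names triangular T W]:
  fixes P :: "int^2^2 \<Rightarrow> bool" and A :: "int^2^2"
  assumes "A \<in> Gamma0 4"
    and triangular: "\<And>A. A \<in> Gamma0 4 \<Longrightarrow> A $ 2 $ 1 = 0 \<Longrightarrow> P A"
    and T: "\<And>A n. A \<in> Gamma0 4 \<Longrightarrow> P (A ** mat2 1 n 0 1) \<Longrightarrow> P A"
    and W: "\<And>A n. A \<in> Gamma0 4 \<Longrightarrow> P (A ** mat2 1 0 (4 * n) 1) \<Longrightarrow> P A"
  shows "P A"
  using assms(1)
proof (induction "nat (\<bar>A $ 2 $ 1\<bar> + \<bar>A $ 2 $ 2\<bar>)" arbitrary: A rule: less_induct)
  case less
  define c d where "c = A $ 2 $ 1" and "d = A $ 2 $ 2"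
  have A: "A \<in> SL2" "4 dvd c" using less.prems by (auto simp: Gamma0_iff c_def)
  show ?case
  proof (cases "c = 0")
    case True
    then show ?thesis using less.prems triangular by (simp add: c_def)
  next
    case False
    have mem: "A ** mat2 1 n 0 1 \<in> Gamma0 4" "A ** mat2 1 0 (4 * n) 1 \<in> Gamma0 4" for n
      using A SL2_mult[OF A(1)] by (auto simp: Gamma0_iff SL2_iff[of "mat2 _ _ _ _"] matrix_mult_sel c_def)
    have row: "(A ** mat2 1 n 0 1) $ 2 $ 1 = c" "(A ** mat2 1 n 0 1) $ 2 $ 2 = d + n * c"
      "(A ** mat2 1 0 (4 * n) 1) $ 2 $ 1 = c + 4 * n * d" "(A ** mat2 1 0 (4 * n) 1) $ 2 $ 2 = d" for n
      by (simp_all add: matrix_mult_sel c_def d_def algebra_simps)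
    obtain c' where c': "c = 4 * c'" using A(2) by blast
    have "odd d" unfolding d_def by (rule SL2_odd[OF A(1)]) (use c' in \<open>simp add: c_def\<close>)
    have "\<exists>n. \<bar>d + n * c\<bar> < \<bar>d\<bar> \<or> \<bar>c + 4 * n * d\<bar> < \<bar>c\<bar>"
    proof (cases "\<bar>c\<bar> < 2 * \<bar>d\<bar>")
      case True
      then have "\<bar>d + 1 * c\<bar> < \<bar>d\<bar> \<or> \<bar>d + (-1) * c\<bar> < \<bar>d\<bar>" using False by (auto simp: abs_if split: if_splits)
      then show ?thesis by blast
    next
      case False
      moreover have "\<bar>c\<bar> \<noteq> 2 * \<bar>d\<bar>" using \<open>odd d\<close> unfolding c' by presburger
      ultimately have "2 * \<bar>d\<bar> < \<bar>c\<bar>" by linarith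
      moreover have "d \<noteq> 0" using \<open>odd d\<close> by auto
      ultimately have "\<bar>c + 4 * 1 * d\<bar> < \<bar>c\<bar> \<or> \<bar>c + 4 * (-1) * d\<bar> < \<bar>c\<bar>" by (auto simp: abs_if split: if_splits)
      then show ?thesis by blast
    qed
    then obtain n where "\<bar>d + n * c\<bar> < \<bar>d\<bar> \<or> \<bar>c + 4 * n * d\<bar> < \<bar>c\<bar>" by blast
    then show ?thesis
    proof
      assume "\<bar>d + n * c\<bar> < \<bar>d\<bar>"
      then have "P (A ** mat2 1 n 0 1)" by (intro less.hyps mem) (simp add: row flip: c_def d_def)
      then show ?thesis by (rule T[OF less.prems])
    next
      assume "\<bar>c + 4 * n * d\<bar> < \<bar>c\<bar>"
      then have "P (A ** mat2 1 0 (4 * n) 1)" by (intro less.hyps mem) (simp add: row flip: c_def d_def)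
      then show ?thesis by (rule W[OF less.prems])
    qed
  qed
qed

text \<open>
  The same for the modular group, with the ordinary Euclidean algorithm and the inversion
  \<open>z \<mapsto> - 1 / z\<close>.
\<close>

lemma SL2_induct [consumes 1, case_names triangular T S]:
  fixes P :: "int^2^2 \<Rightarrow> bool" and A :: "int^2^2"
  assumes "A \<in> SL2"
    and triangular: "\<And>A. A \<in> SL2 \<Longrightarrow> A $ 2 $ 1 = 0 \<Longrightarrow> P A"
    and T: "\<And>A n. A \<in> SL2 \<Longrightarrow> P (A ** mat2 1 n 0 1) \<Longrightarrow> P A"
    and S: "\<And>A. A \<in> SL2 \<Longrightarrow> P (A ** mat2 0 (-1) 1 0) \<Longrightarrow> P A"
  shows "P A"
  using assms(1)
proof (induction "nat \<bar>A $ 2 $ 1\<bar>" arbitrary: A rule: less_induct)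
  case less
  define c d where "c = A $ 2 $ 1" and "d = A $ 2 $ 2"
  show ?case
  proof (cases "c = 0")
    case True
    then show ?thesis using less.prems triangular by (simp add: c_def)
  next
    case False
    define B where "B = A ** mat2 1 (- (d div c)) 0 1"
    have B: "B \<in> SL2" unfolding B_def by (intro SL2_mult less.prems) simp
    have "B $ 2 $ 2 = d mod c" by (simp add: B_def matrix_mult_sel c_def d_def minus_div_mult_eq_mod[symmetric])
    then have "(B ** mat2 0 (-1) 1 0) $ 2 $ 1 = d mod c" by (simp add: matrix_mult_sel)
    then have "\<bar>(B ** mat2 0 (-1) 1 0) $ 2 $ 1\<bar> < \<bar>c\<bar>" using abs_mod_less[OF False] by simp
    then have "P (B ** mat2 0 (-1) 1 0)"
      by (intro less.hyps SL2_mult B) (auto simp: c_def SL2_iff)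
    then have "P B" by (rule S[OF B])
    then show ?thesis unfolding B_def by (rule T[OF less.prems])
  qed
qed

section \<open>The theta series under \<open>\<Gamma>\<^sub>0(4)\<close>\<close>

definition theta_ratio :: "complex \<Rightarrow> complex" where
  "theta_ratio z = Theta (z + 1/2) / Theta z"

definition theta_norm :: "complex \<Rightarrow> real" where
  "theta_norm z = norm (Theta z) ^ 4 * Im z"

lemma theta_norm_plus_int: "theta_norm (z + of_int n) = theta_norm z"
  by (simp add: theta_norm_def Theta_plus_int)

lemma theta_ratio_plus_int: "theta_ratio (z + of_int n) = theta_ratio z"
  using Theta_plus_int[of "z + 1/2" n] by (simp add: theta_ratio_def Theta_plus_int algebra_simps)

lemma Im_inversion_eq: "Im z > 0 \<Longrightarrow> Im (- 1 / (4 * z)) = Im z / (4 * norm z ^ 2)"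
proof -
  assume "Im z > 0"
  have "Im (- 1 / (4 * z)) = 4 * Im z / (16 * (norm z ^ 2))"
    unfolding cmod_power2 by (simp add: Im_divide power2_eq_square algebra_simps)
  then show ?thesis by simp
qed

lemma theta_norm_inversion:
  assumes z: "Im z > 0"
  shows "theta_norm (- 1 / (4 * z)) = theta_norm z"
proof -
  have "norm (inversion_factor z) ^ 4 = (norm (inversion_factor z) ^ 2) ^ 2" by (simp flip: power_mult)
  also have "\<dots> = 4 * norm z ^ 2" by (simp add: inversion_factor_norm power_mult_distrib)
  finally show ?thesis
    using z unfolding theta_norm_def Theta_inversion[OF z] norm_mult power_mult_distrib Im_inversion_eq[OF z]
    by (simp add: field_simps Im_upper_nonzero)
qed

text \<open>
  The transposed translations are conjugate to translations under \<open>z \<mapsto> - 1 / (4 z)\<close>. This reduces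
  the behaviour of \<open>\<Theta>\<close> under them to the inversion formula.
\<close>

lemma moebius_W:
  assumes z: "Im z > 0"
  shows "moebius (mat2 1 0 (4 * n) 1) z = - 1 / (4 * (- 1 / (4 * z) + of_int (- n)))"
proof -
  have "mat2 1 0 (4 * n) 1 \<in> SL2" by (simp add: SL2_iff)
  then have "4 * of_int n * z + 1 \<noteq> 0" using moebius_denom_nonzero[of "mat2 1 0 (4 * n) 1" z] z by (simp add: moebius_denom_def)
  moreover have "z \<noteq> 0" using z by auto
  then have "4 * (- 1 / (4 * z) + of_int (- n)) = - (4 * of_int n * z + 1) / z" by (simp add: field_simps)
  moreover have "- 1 / (- v / z) = z / v" for v by simp
  ultimately have "- 1 / (4 * (- 1 / (4 * z) + of_int (- n))) = z / (4 * of_int n * z + 1)" by (simp only:)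
  then show ?thesis by (simp add: moebius_def)
qed

lemma qexp_quarter_int: "qexp (of_int n / 4) = \<i> powi n"
proof -
  have "qexp (of_int n / 4) = exp (of_int n * (2 * of_real pi * \<i> / 4))" by (simp add: qexp_def mult_ac)
  also have "\<dots> = qexp (1 / 4) powi n" by (simp add: exp_power_int qexp_def)
  finally show ?thesis by (simp only: qexp_quarter)
qed

lemma theta_norm_W:
  assumes z: "Im z > 0"
  shows "theta_norm (moebius (mat2 1 0 (4 * n) 1) z) = theta_norm z"
proof -
  have "Im (- 1 / (4 * z) + of_int (- n)) > 0" using Im_inversion[OF z] by (simp only: plus_complex.sel) simp
  then show ?thesis
    unfolding moebius_W[OF z] by (simp only: theta_norm_inversion theta_norm_plus_int z)
qed

text \<open>
  The inversion exchanges \<open>\<Theta> (z + 1/2)\<close> with \<open>\<theta>\<^sub>2\<close>, and a translation multiplies \<open>\<theta>\<^sub>2\<close> by a power of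
  \<open>\<i>\<close>.
\<close>

lemma theta_ratio_W:
  assumes z: "Im z > 0"
  shows "theta_ratio (moebius (mat2 1 0 (4 * n) 1) z) = \<i> powi (- n) * theta_ratio z"
proof -
  define w where "w = - 1 / (4 * z)"
  have w: "Im w > 0" "Im (w + of_int (- n)) > 0" using Im_inversion[OF z] by (simp_all add: w_def)
  have "qexp (of_int (- n) / 4) ^ 8 = 1"
    using qexp_int[of "- 2 * n"] by (simp add: qexp_power)
  then have "theta2 (w + of_int (- n)) = \<i> powi (- n) * theta2 w"
    using theta2_shift[OF w] by (simp only: qexp_quarter_int)
  then have 1: "theta_ratio (- 1 / (4 * (w + of_int (- n)))) = \<i> powi (- n) * (theta2 w / Theta w)"
    unfolding theta_ratio_def Theta_half_inversion[OF w(2)] Theta_inversion[OF w(2)] Theta_plus_int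
    using Theta_nonzero[of "- 1 / (4 * (w + of_int (- n)))"] Im_inversion[OF w(2)] Theta_inversion[OF w(2)] by simp
  have 2: "theta2 w / Theta w = theta_ratio z"
    unfolding w_def theta_ratio_def Theta_inversion[OF z] theta2_inversion[OF z]
    using Theta_nonzero[of "- 1 / (4 * z)"] Im_inversion[OF z] Theta_inversion[OF z] by simp
  show ?thesis unfolding moebius_W[OF z] using 1 unfolding 2 unfolding w_def .
qed

lemma i_powi_cong:
  assumes "[m = n] (mod 4)"
  shows "\<i> powi m = \<i> powi n"
proof -
  obtain q where q: "m = n + 4 * q" using assms by (metis cong_iff_lin cong_sym)
  have "\<i> powi (4 * q) = (\<i> powi 4) powi q" by (rule power_int_mult)
  then show ?thesis unfolding q by (simp add: power_int_add)
qed

text \<open>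
  With bottom row \<open>(c, d)\<close> the exponent \<open>- c d / 4\<close> is additive modulo 4 along the generators: a
  translation by \<open>n\<close> changes \<open>c d / 4\<close> by \<open>n c\<^sup>2 / 4\<close>, a multiple of 4, and a transposed translation
  changes it by \<open>n d\<^sup>2\<close>, where \<open>d\<^sup>2\<close> is 1 modulo 4.
\<close>

lemma theta_Gamma0_4:
  fixes A :: "int^2^2"
  assumes "A \<in> Gamma0 4" and "Im z > 0"
  shows "theta_norm (moebius A z) = theta_norm z \<and>
    theta_ratio (moebius A z) = \<i> powi (- (A $ 2 $ 1 * A $ 2 $ 2 div 4)) * theta_ratio z"
  using assms
proof (induction A arbitrary: z rule: Gamma0_4_induct)
  case (triangular A)
  obtain n where "\<And>z. moebius A z = z + of_int n"
    using triangular moebius_upper_triangular by (metis Gamma0_iff)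
  then show ?case using triangular by (simp add: theta_norm_plus_int theta_ratio_plus_int)
next
  case (T A n)
  define c d where "c = A $ 2 $ 1" and "d = A $ 2 $ 2"
  obtain c' where c': "c = 4 * c'" using T by (auto simp: Gamma0_iff c_def)
  have e: "(A ** mat2 1 n 0 1) $ 2 $ 1 * (A ** mat2 1 n 0 1) $ 2 $ 2 div 4 = c * d div 4 + 4 * (n * c'\<^sup>2)"
    by (simp add: matrix_mult_sel c_def[symmetric] d_def[symmetric] c' power2_eq_square algebra_simps)
  have "moebius A z = moebius (A ** mat2 1 n 0 1) (z + of_int (- n))"
    using T.prems by (subst moebius_mult) simp_all
  moreover have "\<i> powi (- (c * d div 4 + 4 * (n * c'\<^sup>2))) = \<i> powi (- (c * d div 4))"
    by (intro i_powi_cong) (simp add: cong_iff_dvd_diff)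
  ultimately show ?case
    using T.IH[of "z + of_int (- n)"] T.prems unfolding e
    by (simp add: theta_norm_plus_int theta_ratio_plus_int c_def d_def del: of_int_minus)
next
  case (W A n)
  define c d where "c = A $ 2 $ 1" and "d = A $ 2 $ 2"
  obtain c' where c': "c = 4 * c'" using W by (auto simp: Gamma0_iff c_def)
  have "odd d" unfolding d_def by (rule SL2_odd) (use W c' in \<open>auto simp: c_def Gamma0_iff\<close>)
  have e: "(A ** mat2 1 0 (4 * n) 1) $ 2 $ 1 * (A ** mat2 1 0 (4 * n) 1) $ 2 $ 2 div 4 = c * d div 4 + n * d\<^sup>2"
    by (simp add: matrix_mult_sel c_def[symmetric] d_def[symmetric] c' power2_eq_square algebra_simps)
  have SL: "mat2 1 0 (4 * m) 1 \<in> SL2" for m by (simp add: SL2_iff)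
  define w where "w = moebius (mat2 1 0 (4 * (- n)) 1) z"
  have w: "Im w > 0" unfolding w_def by (intro Im_moebius_pos SL W.prems)
  have "(A ** mat2 1 0 (4 * n) 1) ** mat2 1 0 (4 * (- n)) 1 = A"
    by (simp add: vec_eq_iff forall_2 matrix_mult_sel)
  then have Aw: "moebius A z = moebius (A ** mat2 1 0 (4 * n) 1) w"
    unfolding w_def using moebius_mult[OF SL W.prems] by metis
  have "[d\<^sup>2 = 1] (mod 4)"
  proof -
    obtain j where "d = 2 * j + 1" using \<open>odd d\<close> oddE by blast
    then have "d\<^sup>2 - 1 = 4 * (j\<^sup>2 + j)" by (simp add: power2_eq_square algebra_simps)
    then show ?thesis by (simp add: cong_iff_dvd_diff)
  qed
  then have "[- (c * d div 4 + n * d\<^sup>2) + n = - (c * d div 4 + n * 1) + n] (mod 4)"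
    by (intro cong_add cong_minus_minus_iff[THEN iffD2] cong_mult cong_refl)
  then have "\<i> powi (- (c * d div 4 + n * d\<^sup>2) + n) = \<i> powi (- (c * d div 4))"
    using i_powi_cong by fastforce
  then have eq: "\<i> powi (- (c * d div 4 + n * d\<^sup>2)) * \<i> powi n = \<i> powi (- (c * d div 4))"
    by (simp add: power_int_add)
  have w_ratio: "theta_ratio w = \<i> powi n * theta_ratio z" and w_norm: "theta_norm w = theta_norm z"
    unfolding w_def using theta_ratio_W[OF W.prems, of "- n"] theta_norm_W[OF W.prems, of "- n"] by simp_all
  have "theta_norm (moebius A z) = theta_norm w \<and>
      theta_ratio (moebius A z) = \<i> powi (- (c * d div 4 + n * d\<^sup>2)) * theta_ratio w"
    using W.IH[OF w] unfolding e Aw .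
  then show ?case
    unfolding w_ratio w_norm mult.assoc[symmetric] eq unfolding c_def d_def .
qed

section \<open>A form without zeros for the full modular group\<close>

lemma SL2_invariant:
  fixes F :: "complex \<Rightarrow> 'a" and A :: "int^2^2"
  assumes T: "\<And>z. Im z > 0 \<Longrightarrow> F (z + 1) = F z" and S: "\<And>z. Im z > 0 \<Longrightarrow> F (- 1 / z) = F z"
    and "A \<in> SL2" "Im z > 0"
  shows "F (moebius A z) = F z"
proof -
  have T_nat: "F (z + of_nat n) = F z" if "Im z > 0" for z n
  proof (induction n)
    case (Suc n)
    then show ?case using T[of "z + of_nat n"] that by (simp add: add_ac)
  qed simp
  have T_int: "F (z + of_int n) = F z" if "Im z > 0" for z n
    using T_nat[of z "nat n"] T_nat[of "z + of_int n" "nat (- n)"] that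
    by (cases "n \<ge> 0") (simp_all add: of_nat_nat)
  show ?thesis
    using assms(3,4)
  proof (induction A arbitrary: z rule: SL2_induct)
    case (triangular A)
    then show ?case using moebius_upper_triangular[of A] T_int by metis
  next
    case (T A n)
    have "moebius A z = moebius (A ** mat2 1 n 0 1) (z + of_int (- n))"
      using T.prems by (subst moebius_mult) simp_all
    then show ?case using T.IH[of "z + of_int (- n)"] T_int[OF T.prems, of "- n"] T.prems by simp
  next
    case (S A)
    have SL: "mat2 0 (-1) 1 0 \<in> SL2" by (simp add: SL2_iff)
    have m: "moebius (mat2 0 (-1) 1 0) w = - 1 / w" for w by (simp add: moebius_def)
    have upper: "Im (- 1 / z) > 0" using Im_moebius_pos[OF SL S.prems] m by simp
    have "moebius A z = moebius (A ** mat2 0 (-1) 1 0) (- 1 / z)"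
      using moebius_mult[OF SL upper, of A] unfolding m by simp
    then show ?case using S.IH[OF upper] assms(2)[OF S.prems] by simp
  qed
qed

text \<open>
  The product \<open>\<theta>\<^sub>2 \<theta>\<^sub>3 \<theta>\<^sub>4\<close> at \<open>z\<close>, which is twice the third power of the Dedekind eta function.
\<close>

definition theta_product :: "complex \<Rightarrow> complex" where
  "theta_product z = Theta (z / 2) * Theta (z / 2 + 1/2) * theta2 (z / 2)"

lemma theta2_holomorphic: "theta2 holomorphic_on upper_half_plane"
proof -
  have "(\<lambda>z. Theta (z / 4)) holomorphic_on upper_half_plane"
    by (rule holomorphic_on_compose_gen[OF _ Theta_holomorphic, of "\<lambda>z. z / 4", unfolded o_def])
      (auto simp: upper_half_plane_def intro!: holomorphic_intros)
  then show ?thesis unfolding theta2_def by (intro holomorphic_intros Theta_holomorphic)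
qed

lemma theta_product_holomorphic: "theta_product holomorphic_on upper_half_plane"
proof -
  have "(\<lambda>z. Theta (z / 2)) holomorphic_on upper_half_plane"
    by (rule holomorphic_on_compose_gen[OF _ Theta_holomorphic, of "\<lambda>z. z / 2", unfolded o_def])
      (auto simp: upper_half_plane_def intro!: holomorphic_intros)
  moreover have "(\<lambda>z. Theta (z / 2 + 1/2)) holomorphic_on upper_half_plane"
    by (rule holomorphic_on_compose_gen[OF _ Theta_holomorphic, of "\<lambda>z. z / 2 + 1/2", unfolded o_def])
      (auto simp: upper_half_plane_def intro!: holomorphic_intros)
  moreover have "(\<lambda>z. theta2 (z / 2)) holomorphic_on upper_half_plane"
    by (rule holomorphic_on_compose_gen[OF _ theta2_holomorphic, of "\<lambda>z. z / 2", unfolded o_def])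
      (auto simp: upper_half_plane_def intro!: holomorphic_intros)
  ultimately show ?thesis unfolding theta_product_def by (intro holomorphic_intros)
qed

lemma theta2_nonzero:
  assumes "Im z > 0"
  shows "theta2 z \<noteq> 0"
  using Theta_nonzero[of "- 1 / (4 * z) + 1/2"] Im_inversion[OF assms] Theta_half_inversion[OF assms]
  by simp

lemma theta_product_nonzero: "Im z > 0 \<Longrightarrow> theta_product z \<noteq> 0"
  by (simp add: theta_product_def Theta_nonzero theta2_nonzero)

lemma theta_product_plus_1:
  assumes "Im z > 0"
  shows "theta_product (z + 1) = qexp (1/8) * theta_product z"
proof -
  have half: "(z + 1) / 2 = z / 2 + 1/2" by (simp add: field_simps)
  have "qexp (1/8) ^ 8 = 1" using qexp_int[of 1] by (simp add: qexp_power)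
  then have "theta2 (z / 2 + 1/2) = qexp (1/8) * theta2 (z / 2)"
    using theta2_shift[of "z / 2" "1/2"] assms by simp
  moreover have "Theta (z / 2 + 1/2 + 1/2) = Theta (z / 2)"
    using Theta_plus_1[of "z / 2"] by (simp add: add.assoc)
  ultimately show ?thesis unfolding theta_product_def half by simp
qed

lemma theta_product_inversion:
  assumes "Im z > 0"
  shows "theta_product (- 1 / z) = inversion_factor (z / 2) ^ 3 * theta_product z"
proof -
  have z: "Im (z / 2) > 0" using assms by simp
  have half: "- 1 / z / 2 = - 1 / (4 * (z / 2))" by simp
  show ?thesis
    unfolding theta_product_def half Theta_inversion[OF z] Theta_half_inversion[OF z] theta2_inversion[OF z]
    by (simp add: power3_eq_cube)
qed

definition theta_product_norm :: "complex \<Rightarrow> real" where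
  "theta_product_norm z = norm (theta_product z) ^ 4 * Im z ^ 3"

text \<open>
  Up to factors of the expected absolute value, the generators of the modular group permute the three
  theta constants.
\<close>

lemma theta_product_norm_SL2:
  assumes "A \<in> SL2" "Im z > 0"
  shows "theta_product_norm (moebius A z) = theta_product_norm z"
proof (rule SL2_invariant[OF _ _ assms])
  fix z assume z: "Im z > 0"
  show "theta_product_norm (z + 1) = theta_product_norm z"
    using norm_qexp_real[of "1/8"] by (simp add: theta_product_norm_def theta_product_plus_1[OF z] norm_mult del: norm_qexp_real)
  have "norm (inversion_factor (z / 2)) ^ 12 = (norm (inversion_factor (z / 2)) ^ 2) ^ 6" by (simp flip: power_mult)
  also have "\<dots> = norm z ^ 6" unfolding inversion_factor_norm by (simp add: norm_divide)
  finally have n: "norm (inversion_factor (z / 2)) ^ 12 = norm z ^ 6" .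
  have "Im (- 1 / z) = Im z / norm z ^ 2" by (simp add: Im_divide cmod_power2)
  then have i: "Im (- 1 / z) ^ 3 = Im z ^ 3 / norm z ^ 6" by (simp add: power_divide flip: power_mult)
  show "theta_product_norm (- 1 / z) = theta_product_norm z"
    unfolding theta_product_norm_def theta_product_inversion[OF z] norm_mult norm_power power_mult_distrib i
    using n z by (auto simp flip: power_mult)
qed

text \<open>
  The terms with \<open>n = 1\<close> and \<open>n = - 1\<close> contribute twice the bound, and the others together at most the
  bound.
\<close>

lemma theta2_lower_bound:
  assumes "Im z \<ge> 1"
  shows "norm (theta2 z) \<ge> norm (qexp (z / 4))"
proof -
  define w r where "w = qexp (z / 4)" and "r = norm w"
  have "r ^ 4 = norm (qexp z)" unfolding r_def w_def by (simp add: qexp_power flip: norm_power)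
  also have "\<dots> < 1/16" unfolding norm_qexp by (rule exp_minus_2pi_less[OF assms])
  finally have "(r ^ 2) ^ 2 < (1/4) ^ 2" by (simp add: power_divide flip: power_mult)
  then have r2: "r ^ 2 < 1/4" by (rule power2_less_imp_less) simp
  have r: "0 \<le> r" "0 < r" by (simp_all add: r_def w_def qexp_def)
  define X where "X = {n::int. odd n} - {1, -1}"
  have sum: "((\<lambda>n::int. w ^ nat (n\<^sup>2)) has_sum theta2 z - 2 * w) X"
    unfolding X_def by (rule has_sum_Diff)
      (use has_sum_theta2[of z] assms in \<open>auto intro!: has_sum_finiteI simp: w_def\<close>)
  have "((\<lambda>n::int. r * (r\<^sup>2) ^ nat \<bar>n\<bar>) has_sum r * (2 * r\<^sup>2 / (1 - r\<^sup>2))) (UNIV - {0})"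
    using r r2 by (intro has_sum_cmult_right has_sum_geometric_int) auto
  moreover from this have "(\<lambda>n::int. r * (r\<^sup>2) ^ nat \<bar>n\<bar>) summable_on X"
    by (rule summable_on_subset[OF has_sum_imp_summable]) (auto simp: X_def)
  then obtain T where T: "((\<lambda>n::int. r * (r\<^sup>2) ^ nat \<bar>n\<bar>) has_sum T) X"
    using has_sum_infsum by blast
  ultimately have "T \<le> r * (2 * r\<^sup>2 / (1 - r\<^sup>2))"
    by (intro has_sum_mono_neutral[OF T]) (use r in \<open>auto simp: X_def\<close>)
  also have "\<dots> \<le> r * 1"
    using r r2 by (intro mult_left_mono) (auto simp: field_simps)
  finally have "T \<le> r" by simp
  moreover have "norm (theta2 z - 2 * w) \<le> T"
  proof (rule norm_infsum_le[OF sum T])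
    fix n assume "n \<in> X"
    then have "\<bar>n\<bar> \<ge> 3" unfolding X_def by (simp, presburger)
    then have "3 * \<bar>n\<bar> \<le> \<bar>n\<bar> * \<bar>n\<bar>" by (intro mult_right_mono) auto
    with \<open>\<bar>n\<bar> \<ge> 3\<close> have "1 + 2 * \<bar>n\<bar> \<le> n\<^sup>2" by (simp add: power2_eq_square)
    then have "Suc (2 * nat \<bar>n\<bar>) \<le> nat (n\<^sup>2)" by linarith
    moreover have "r \<le> 1" using r r2 by (metis power2_le_imp_le one_power2 less_eq_real_def order_trans zero_le_one
          divide_le_eq_1_pos zero_less_numeral one_le_numeral)
    ultimately have "r ^ nat (n\<^sup>2) \<le> r ^ Suc (2 * nat \<bar>n\<bar>)"
      using r by (intro power_decreasing) auto
    then show "norm (w ^ nat (n\<^sup>2)) \<le> r * (r\<^sup>2) ^ nat \<bar>n\<bar>"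
      by (simp add: norm_power r_def power_mult)
  qed
  moreover have "norm (2 * w) \<le> norm (theta2 z) + norm (theta2 z - 2 * w)"
    by (metis norm_triangle_sub norm_minus_commute)
  ultimately show ?thesis by (simp add: r_def w_def norm_mult)
qed

text \<open>
  The order of vanishing at infinity is 1/8. That it is not larger is what makes the constant 24 in
  the Sturm bound come out exactly.
\<close>

lemma theta_product_lower_bound:
  assumes "Im z \<ge> 2"
  shows "norm (theta_product z) \<ge> exp (- pi * Im z / 4) / 4"
proof -
  have z: "Im (z / 2) \<ge> 1" using assms by simp
  have "4 * exp (- 2 * pi * Im (z / 2)) \<le> 1/2" using exp_minus_2pi_less[OF z] by simp
  then have "norm (Theta (z / 2) - 1) \<le> 1/2" "norm (Theta (z / 2 + 1/2) - 1) \<le> 1/2"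
    using norm_Theta_minus_1_le[OF z] norm_Theta_half_minus_1_le[OF z] by linarith+
  then have "norm (Theta (z / 2)) \<ge> 1/2" "norm (Theta (z / 2 + 1/2)) \<ge> 1/2"
    using norm_triangle_ineq3[of "Theta (z / 2)" 1] norm_triangle_ineq3[of "Theta (z / 2 + 1/2)" 1]
    by (auto simp: abs_le_iff)
  then have "1/2 * (1/2) \<le> norm (Theta (z / 2)) * norm (Theta (z / 2 + 1/2))"
    by (intro mult_mono) auto
  from mult_mono[OF this theta2_lower_bound[OF z]]
  show ?thesis by (simp add: theta_product_def norm_mult norm_qexp)
qed

section \<open>Reduction to the fundamental domain and the maximum modulus principle\<close>

lemma exists_minimal_denom:
  assumes z: "Im z > 0"
  obtains A where "A \<in> SL2" "\<And>B. B \<in> SL2 \<Longrightarrow> norm (moebius_denom A z) \<le> norm (moebius_denom B z)"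
proof -
  define c0 where "c0 = \<lceil>1 / Im z\<rceil>"
  define d0 where "d0 = \<lceil>1 + of_int c0 * norm z\<rceil>"
  define S where "S = (\<lambda>A. norm (moebius_denom A z)) ` {A \<in> SL2. norm (moebius_denom A z) \<le> 1}"
  have "S \<subseteq> (\<lambda>(c, d). norm (of_int c * z + of_int d)) ` ({- c0..c0} \<times> {- d0..d0})"
  proof
    fix x assume "x \<in> S"
    then obtain A where A: "x = norm (moebius_denom A z)" "norm (moebius_denom A z) \<le> 1" by (auto simp: S_def)
    have "\<bar>of_int (A $ 2 $ 1)\<bar> * Im z = \<bar>Im (moebius_denom A z)\<bar>" using z by (simp add: moebius_denom_def abs_mult)
    also have "\<dots> \<le> 1" using abs_Im_le_cmod A(2) order_trans by blast
    finally have "\<bar>of_int (A $ 2 $ 1)\<bar> \<le> 1 / Im z" using z by (simp add: field_simps)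
    then have "of_int \<bar>A $ 2 $ 1\<bar> \<le> real_of_int c0" unfolding c0_def by (simp add: le_of_int_ceiling order_trans)
    then have c: "\<bar>A $ 2 $ 1\<bar> \<le> c0" by (simp only: of_int_le_iff)
    have "norm (of_int (A $ 2 $ 2) :: complex) \<le> norm (moebius_denom A z) + norm (of_int (A $ 2 $ 1) * z)"
      using norm_triangle_ineq4[of "moebius_denom A z" "of_int (A $ 2 $ 1) * z"] by (simp add: moebius_denom_def)
    also have "\<dots> \<le> 1 + of_int c0 * norm z"
      using A(2) c by (intro add_mono) (auto simp: norm_mult intro!: mult_right_mono)
    also have "\<dots> \<le> of_int d0" unfolding d0_def by (rule le_of_int_ceiling)
    finally have "of_int \<bar>A $ 2 $ 2\<bar> \<le> real_of_int d0" by simp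
    then have d: "\<bar>A $ 2 $ 2\<bar> \<le> d0" by (simp only: of_int_le_iff)
    show "x \<in> (\<lambda>(c, d). norm (of_int c * z + of_int d)) ` ({- c0..c0} \<times> {- d0..d0})"
      using c d by (intro image_eqI[of _ _ "(A $ 2 $ 1, A $ 2 $ 2)"]) (auto simp: A(1) moebius_denom_def)
  qed
  then have fin: "finite S" by (rule finite_subset) auto
  have one: "mat2 1 0 0 1 \<in> SL2" "norm (moebius_denom (mat2 1 0 0 1) z) = 1" by (simp_all add: moebius_denom_def)
  then have "1 \<in> S" by (auto simp: S_def intro!: image_eqI[of _ _ "mat2 1 0 0 1"])
  then have "Min S \<in> S" by (intro Min_in fin) auto
  then obtain A where A: "A \<in> SL2" "norm (moebius_denom A z) \<le> 1" "norm (moebius_denom A z) = Min S" by (auto simp: S_def)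
  have "norm (moebius_denom A z) \<le> norm (moebius_denom B z)" if "B \<in> SL2" for B
  proof (cases "norm (moebius_denom B z) \<le> 1")
    case True
    then show ?thesis unfolding A(3) using that fin by (auto simp: S_def)
  qed (use A(2) in auto)
  with A(1) that show ?thesis by blast
qed

lemma SL2_reduction:
  assumes z: "Im z > 0"
  obtains A where "A \<in> SL2" "\<bar>Re (moebius A z)\<bar> \<le> 1/2" "Im (moebius A z) \<ge> 1/2"
proof -
  obtain A where A: "A \<in> SL2" "\<And>B. B \<in> SL2 \<Longrightarrow> norm (moebius_denom A z) \<le> norm (moebius_denom B z)"
    using exists_minimal_denom[OF z] by blast
  \<comment> \<open>a translation makes the real part small and does not change the denominator; minimality of the
      denominator, applied to the inversion, then keeps the point outside the unit disc\<close>
  define n where "n = - round (Re (moebius A z))"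
  define B where "B = mat2 1 n 0 1 ** A"
  define w where "w = moebius B z"
  have B: "B \<in> SL2" unfolding B_def by (intro SL2_mult A) simp
  have denB: "moebius_denom B z = moebius_denom A z" unfolding B_def by (simp add: moebius_denom_mult[OF A(1) z] moebius_denom_def[of "mat2 _ _ _ _"])
  have w_eq: "w = moebius A z + of_int n" unfolding w_def B_def by (simp add: moebius_mult[OF A(1) z])
  have Re: "\<bar>Re w\<bar> \<le> 1/2"
    using of_int_round_abs_le[of "Re (moebius A z)"] by (simp add: w_eq n_def abs_minus_commute)
  have S: "mat2 0 (-1) 1 0 \<in> SL2" by (simp add: SL2_iff)
  have "norm (moebius_denom A z) \<le> norm (moebius_denom (mat2 0 (-1) 1 0 ** B) z)" by (intro A(2) SL2_mult S B)
  also have "moebius_denom (mat2 0 (-1) 1 0 ** B) z = w * moebius_denom A z"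
    by (simp add: moebius_denom_mult[OF B z] denB w_def moebius_denom_def[of "mat2 _ _ _ _"])
  finally have "1 \<le> norm w" using moebius_denom_nonzero[OF A(1) z] by (simp add: norm_mult)
  then have "1 \<le> norm w ^ 2" by simp
  moreover have "(Re w)\<^sup>2 \<le> (1/2)\<^sup>2" using Re abs_le_square_iff[of "Re w" "1/2"] by simp
  ultimately have "(1/2)\<^sup>2 \<le> (Im w)\<^sup>2" unfolding cmod_power2 by (simp add: power2_eq_square)
  moreover have "Im w > 0" unfolding w_def by (rule Im_moebius_pos[OF B z])
  ultimately have "1/2 \<le> Im w" by (metis power2_le_imp_le less_imp_le)
  with B Re that show ?thesis unfolding w_def by blast
qed

text \<open>
  Decay at infinity and invariance force the absolute value to attain its maximum over the whole
  half-plane within a compact part of the fundamental domain. The maximum modulus principle then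
  makes the function constant, and the decay makes the constant zero.
\<close>

lemma SL2_invariant_vanishing:
  assumes hol: "\<Phi> holomorphic_on upper_half_plane"
    and inv: "\<And>A z. A \<in> SL2 \<Longrightarrow> Im z > 0 \<Longrightarrow> norm (\<Phi> (moebius A z)) = norm (\<Phi> z)"
    and decay: "\<And>\<epsilon>. \<epsilon> > 0 \<Longrightarrow> \<forall>\<^sub>F y in at_top. \<forall>z. Im z = y \<longrightarrow> norm (\<Phi> z) < \<epsilon>"
    and z: "Im z > 0"
  shows "\<Phi> z = 0"
proof (rule ccontr)
  assume nz: "\<Phi> z \<noteq> 0"
  then obtain Y where Y: "\<And>w. Im w \<ge> Y \<Longrightarrow> norm (\<Phi> w) < norm (\<Phi> z)"
    using decay[of "norm (\<Phi> z)"] unfolding eventually_at_top_linorder by auto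
  define K where "K = {w. Re w \<in> {-1/2..1/2} \<and> Im w \<in> {1/2..Y}}"
  have K_box: "K = cbox (Complex (-1/2) (1/2)) (Complex (1/2) Y)"
    by (auto simp: K_def in_cbox_complex_iff)
  have K: "K \<subseteq> upper_half_plane" by (auto simp: K_def upper_half_plane_def)
  have reduce: "\<exists>w'\<in>K. norm (\<Phi> w') = norm (\<Phi> w)" if w: "Im w > 0" "norm (\<Phi> w) \<ge> norm (\<Phi> z)" for w
  proof -
    obtain A where A: "A \<in> SL2" "\<bar>Re (moebius A w)\<bar> \<le> 1/2" "Im (moebius A w) \<ge> 1/2"
      using SL2_reduction[OF w(1)] by blast
    have "norm (\<Phi> (moebius A w)) = norm (\<Phi> w)" by (rule inv[OF A(1) w(1)])
    moreover from this have "\<not> Im (moebius A w) \<ge> Y" using Y[of "moebius A w"] w(2) by auto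
    ultimately show ?thesis using A(2,3) by (intro bexI[of _ "moebius A w"]) (auto simp: K_def abs_le_iff)
  qed
  have "continuous_on K (\<lambda>w. norm (\<Phi> w))"
    by (intro continuous_on_norm holomorphic_on_imp_continuous_on holomorphic_on_subset[OF hol K])
  moreover have "K \<noteq> {}" using reduce[OF z] by auto
  moreover have "compact K" unfolding K_box by (rule compact_cbox)
  ultimately obtain x where x: "x \<in> K" "\<And>w. w \<in> K \<Longrightarrow> norm (\<Phi> w) \<le> norm (\<Phi> x)"
    using continuous_attains_sup by metis
  have max: "norm (\<Phi> w) \<le> norm (\<Phi> x)" if w: "w \<in> upper_half_plane" for w
  proof (cases "norm (\<Phi> w) \<ge> norm (\<Phi> z)")
    case True
    then obtain w' where "w' \<in> K" "norm (\<Phi> w') = norm (\<Phi> w)"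
      using reduce[of w] w by (auto simp: upper_half_plane_def)
    then show ?thesis using x(2)[of w'] by simp
  next
    case False
    moreover obtain z' where "z' \<in> K" "norm (\<Phi> z') = norm (\<Phi> z)"
      using reduce[OF z] by auto
    ultimately show ?thesis using x(2)[of z'] by simp
  qed
  have "\<Phi> constant_on upper_half_plane"
    using maximum_modulus_principle[OF hol open_upper_half_plane connected_upper_half_plane
        open_upper_half_plane subset_refl subsetD[OF K x(1)] max] .
  then obtain c where c: "\<And>w. Im w > 0 \<Longrightarrow> \<Phi> w = c" unfolding constant_on_def upper_half_plane_def by auto
  have "Im (Complex 0 (max 1 Y)) > 0" "Im (Complex 0 (max 1 Y)) \<ge> Y" by auto
  then show False using Y[of "Complex 0 (max 1 Y)"] c[of "Complex 0 (max 1 Y)"] c[OF z] by simp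
qed

lemma prod_holomorphic_not_identically_zero:
  assumes "open S" "connected S" "S \<noteq> {}" and "finite I"
    and "\<And>i. i \<in> I \<Longrightarrow> f i holomorphic_on S"
    and "\<And>i. i \<in> I \<Longrightarrow> \<exists>z\<in>S. f i z \<noteq> 0"
  shows "\<exists>z\<in>S. (\<Prod>i\<in>I. f i z) \<noteq> (0::complex)"
  using assms(4-6)
proof (induction I rule: finite_induct)
  case empty
  then show ?case using assms(3) by auto
next
  case (insert i I)
  then obtain z where z: "z \<in> S" "(\<Prod>i\<in>I. f i z) \<noteq> 0" by auto
  show ?case
  proof (rule ccontr)
    assume no: "\<not> ?thesis"
    \<comment> \<open>otherwise \<open>f i\<close> vanishes on the open set where the product of the other factors does not\<close>
    define U where "U = {w \<in> S. (\<Prod>i\<in>I. f i w) \<in> - {0}}"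
    have "continuous_on S (\<lambda>w. \<Prod>i\<in>I. f i w)"
      using insert.prems by (intro continuous_on_prod holomorphic_on_imp_continuous_on) auto
    moreover have "open (- {0::complex})" by auto
    ultimately have "open (S \<inter> (\<lambda>w. \<Prod>i\<in>I. f i w) -` (- {0}))"
      using \<open>open S\<close> by (intro continuous_open_preimage)
    also have "S \<inter> (\<lambda>w. \<Prod>i\<in>I. f i w) -` (- {0}) = U" by (auto simp: U_def)
    finally have "open U" .
    moreover have "z \<in> U" using z by (simp add: U_def)
    ultimately have "z islimpt U" by (simp add: interior_limit_point interior_open)
    moreover have "f i w = 0" if "w \<in> U" for w
      using no that insert.hyps by (auto simp: U_def)
    ultimately have "f i w = 0" if "w \<in> S" for w
      using analytic_continuation[of "f i" S U z w] insert.prems \<open>open S\<close> \<open>connected S\<close> z that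
      by (auto simp: U_def)
    then show False using insert.prems by blast
  qed
qed

section \<open>Products over the cosets of \<open>\<Gamma>\<^sub>0(M)\<close>\<close>

definition Gamma0_cosets :: "nat \<Rightarrow> (int^2^2) set set" where
  "Gamma0_cosets M = rcosets\<^bsub>SL2Z\<^esub> (Gamma0 M)"

definition coset_rep :: "(int^2^2) set \<Rightarrow> int^2^2" where
  "coset_rep C = (SOME A. A \<in> C)"

interpretation SL2Z: group SL2Z by (rule group_SL2Z)

lemma Gamma0_subset: "Gamma0 M \<subseteq> carrier SL2Z"
  by (rule subgroup.subset[OF subgroup_Gamma0])

lemma Gamma0_cosets_nonempty: "C \<in> Gamma0_cosets M \<Longrightarrow> C \<noteq> {}"
  unfolding Gamma0_cosets_def RCOSETS_def using SL2Z.rcos_self[OF _ subgroup_Gamma0] by blast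

lemma coset_rep_in: "C \<in> Gamma0_cosets M \<Longrightarrow> coset_rep C \<in> C"
  unfolding coset_rep_def using Gamma0_cosets_nonempty[of C M] by (simp add: some_in_eq)

lemma Gamma0_cosets_eq:
  assumes "C \<in> Gamma0_cosets M" "A \<in> C"
  shows "C = Gamma0 M #>\<^bsub>SL2Z\<^esub> A" "A \<in> SL2"
proof -
  obtain B where B: "C = Gamma0 M #>\<^bsub>SL2Z\<^esub> B" "B \<in> carrier SL2Z"
    using assms(1) by (auto simp: Gamma0_cosets_def RCOSETS_def)
  then show "C = Gamma0 M #>\<^bsub>SL2Z\<^esub> A"
    using SL2Z.repr_independence[OF _ B(2) subgroup_Gamma0] assms(2) by blast
  show "A \<in> SL2" using assms(2) B SL2Z.r_coset_subset_G[OF Gamma0_subset B(2)]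
    by (auto simp: carrier_SL2Z)
qed

lemma coset_rep_SL2: "C \<in> Gamma0_cosets M \<Longrightarrow> coset_rep C \<in> SL2"
  by (rule Gamma0_cosets_eq(2)[OF _ coset_rep_in])

lemma Gamma0_cosets_same:
  assumes "C \<in> Gamma0_cosets M" "A \<in> C" "B \<in> C"
  obtains G where "G \<in> Gamma0 M" "A = G ** B"
proof -
  have "A \<in> Gamma0 M #>\<^bsub>SL2Z\<^esub> B"
    by (rule subst[OF Gamma0_cosets_eq(1)[OF assms(1,3)], where P = "\<lambda>C. A \<in> C"]) (rule assms(2))
  then show ?thesis using that by (auto simp: r_coset_def SL2Z_def)
qed

text \<open>
  Right translation permutes the right cosets; this is what makes a product over the cosets invariant
  under the full group.
\<close>

lemma coset_translate:
  assumes "A \<in> SL2"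
  shows "bij_betw (\<lambda>C. C #>\<^bsub>SL2Z\<^esub> A) (Gamma0_cosets M) (Gamma0_cosets M)"
proof -
  have A: "A \<in> carrier SL2Z" "inv\<^bsub>SL2Z\<^esub> A \<in> carrier SL2Z" using assms by (simp_all add: carrier_SL2Z[symmetric])
  have sub: "C \<subseteq> carrier SL2Z" if "C \<in> Gamma0_cosets M" for C
    using subgroup.rcosets_carrier[OF subgroup_Gamma0 group_SL2Z] that by (auto simp: Gamma0_cosets_def)
  have mem: "C #>\<^bsub>SL2Z\<^esub> B \<in> Gamma0_cosets M" if C: "C \<in> Gamma0_cosets M" and B: "B \<in> carrier SL2Z" for B C
  proof -
    obtain D where D: "C = Gamma0 M #>\<^bsub>SL2Z\<^esub> D" "D \<in> carrier SL2Z"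
      using C by (auto simp: Gamma0_cosets_def RCOSETS_def)
    then have "C #>\<^bsub>SL2Z\<^esub> B = Gamma0 M #>\<^bsub>SL2Z\<^esub> (D \<otimes>\<^bsub>SL2Z\<^esub> B)"
      using B Gamma0_subset by (simp add: SL2Z.coset_mult_assoc)
    then show ?thesis unfolding Gamma0_cosets_def using D B Gamma0_subset by (simp add: SL2Z.rcosetsI)
  qed
  show ?thesis
    by (rule bij_betw_byWitness[where f' = "\<lambda>C. C #>\<^bsub>SL2Z\<^esub> inv\<^bsub>SL2Z\<^esub> A"])
      (use A mem sub in \<open>auto simp: SL2Z.coset_mult_assoc\<close>)
qed

lemma prod_cosets_invariant:
  fixes F :: "complex \<Rightarrow> real"
  assumes F: "\<And>G z. G \<in> Gamma0 M \<Longrightarrow> Im z > 0 \<Longrightarrow> F (moebius G z) = F z"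
    and A: "A \<in> SL2" and z: "Im z > 0"
  shows "(\<Prod>C\<in>Gamma0_cosets M. F (moebius (coset_rep C) (moebius A z))) = (\<Prod>C\<in>Gamma0_cosets M. F (moebius (coset_rep C) z))"
proof -
  have "F (moebius (coset_rep C) (moebius A z)) = F (moebius (coset_rep (C #>\<^bsub>SL2Z\<^esub> A)) z)" if C: "C \<in> Gamma0_cosets M" for C
  proof -
    have CA: "C #>\<^bsub>SL2Z\<^esub> A \<in> Gamma0_cosets M"
      using coset_translate[OF A] C by (auto simp: bij_betw_def)
    have "coset_rep C ** A \<in> C #>\<^bsub>SL2Z\<^esub> A"
      using coset_rep_in[OF C] by (auto simp: r_coset_def SL2Z_def)
    then obtain G where G: "G \<in> Gamma0 M" "coset_rep C ** A = G ** coset_rep (C #>\<^bsub>SL2Z\<^esub> A)"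
      using Gamma0_cosets_same[OF CA] coset_rep_in[OF CA] by metis
    have "F (moebius (coset_rep C) (moebius A z)) = F (moebius G (moebius (coset_rep (C #>\<^bsub>SL2Z\<^esub> A)) z))"
      using G(2) moebius_mult[OF A z, of "coset_rep C"] moebius_mult[OF coset_rep_SL2[OF CA] z, of G] by simp
    also have "\<dots> = F (moebius (coset_rep (C #>\<^bsub>SL2Z\<^esub> A)) z)"
      by (intro F G Im_moebius_pos coset_rep_SL2[OF CA] z)
    finally show ?thesis .
  qed
  then have "(\<Prod>C\<in>Gamma0_cosets M. F (moebius (coset_rep C) (moebius A z))) =
      (\<Prod>C\<in>Gamma0_cosets M. F (moebius (coset_rep (C #>\<^bsub>SL2Z\<^esub> A)) z))"
    by (intro prod.cong) auto
  also have "\<dots> = (\<Prod>C\<in>Gamma0_cosets M. F (moebius (coset_rep C) z))"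
    by (rule prod.reindex_bij_betw[OF coset_translate[OF A]])
  finally show ?thesis .
qed

text \<open>
  The bottom row modulo \<open>M\<close> determines the coset. Finiteness matters because the index is defined by a
  cardinality, which would be zero otherwise.
\<close>

lemma finite_Gamma0_cosets:
  assumes "M > 0"
  shows "finite (Gamma0_cosets M)"
proof (rule finite_imageD)
  define row where "row = (\<lambda>C. (coset_rep C $ 2 $ 1 mod int M, coset_rep C $ 2 $ 2 mod int M))"
  have "row ` Gamma0_cosets M \<subseteq> {0..<int M} \<times> {0..<int M}"
    using assms by (auto simp: row_def)
  then show "finite (row ` Gamma0_cosets M)" by (rule finite_subset) auto
  show "inj_on row (Gamma0_cosets M)"
  proof (rule inj_onI)
    fix C D assume C: "C \<in> Gamma0_cosets M" and D: "D \<in> Gamma0_cosets M" and eq: "row C = row D"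
    define A B where "A = coset_rep C" and "B = coset_rep D"
    have A: "A \<in> SL2" "A \<in> C" and B: "B \<in> SL2" "B \<in> D" using C D by (auto simp: A_def B_def coset_rep_SL2 coset_rep_in)
    define B' where "B' = mat2 (B $ 2 $ 2) (- B $ 1 $ 2) (- B $ 2 $ 1) (B $ 1 $ 1)"
    have detB: "B $ 1 $ 1 * B $ 2 $ 2 - B $ 1 $ 2 * B $ 2 $ 1 = 1" using B(1) by (simp only: SL2_iff)
    then have B': "B' \<in> SL2" by (simp add: B'_def SL2_iff algebra_simps)
    have "B' ** B = mat 1"
      using detB by (simp add: vec_eq_iff forall_2 matrix_mult_sel B'_def mat_def algebra_simps)
    then have AB: "A = (A ** B') ** B" by (simp flip: matrix_mul_assoc)
    have "[A $ 2 $ 1 = B $ 2 $ 1] (mod int M)" "[A $ 2 $ 2 = B $ 2 $ 2] (mod int M)"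
      using eq by (auto simp: row_def A_def B_def cong_def)
    then have "[A $ 2 $ 1 * B $ 2 $ 2 - A $ 2 $ 2 * B $ 2 $ 1 = B $ 2 $ 1 * B $ 2 $ 2 - B $ 2 $ 2 * B $ 2 $ 1] (mod int M)"
      by (intro cong_diff cong_mult cong_refl)
    then have "int M dvd (A ** B') $ 2 $ 1"
      by (simp add: matrix_mult_sel B'_def cong_0_iff mult.commute)
    then have G: "A ** B' \<in> Gamma0 M" using SL2_mult[OF A(1) B'] by (simp add: Gamma0_iff)
    have "A \<in> Gamma0 M #>\<^bsub>SL2Z\<^esub> B"
      using G AB by (auto simp: r_coset_def SL2Z_def)
    also have "Gamma0 M #>\<^bsub>SL2Z\<^esub> B = D" using Gamma0_cosets_eq(1)[OF D B(2)] by simp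
    finally have "D = Gamma0 M #>\<^bsub>SL2Z\<^esub> A" by (rule Gamma0_cosets_eq(1)[OF D])
    then show "C = D" using Gamma0_cosets_eq(1)[OF C A(2)] by simp
  qed
qed

lemma Gamma0_in_cosets: "Gamma0 M \<in> Gamma0_cosets M"
  unfolding Gamma0_cosets_def using SL2Z.coset_mult_one[OF Gamma0_subset] SL2Z.rcosetsI[OF Gamma0_subset SL2Z.one_closed]
  by metis

section \<open>The Sturm bound\<close>

text \<open>
  The fourth power of \<open>\<bar>g\<bar>\<close> times \<open>y\<close> to the power \<open>k / 4\<close>, the function that is invariant under the
  group of a form \<open>g\<close> of weight \<open>k / 2\<close>.
\<close>

definition invariant_norm :: "nat \<Rightarrow> (complex \<Rightarrow> complex) \<Rightarrow> complex \<Rightarrow> real" where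
  "invariant_norm k g z = norm (g z) ^ 4 * Im z ^ k"

text \<open>
  Growth towards the cusp at infinity, uniform in the real part. Holomorphy at the cusps enters the
  argument in this form.
\<close>

abbreviation moderate_growth :: "nat \<Rightarrow> (complex \<Rightarrow> real) \<Rightarrow> bool" where
  "moderate_growth k F \<equiv> (\<exists>K. \<forall>\<^sub>F y in at_top. \<forall>z. Im z = y \<longrightarrow> F z \<le> K * y ^ k)"

text \<open>
  The holomorphic function behind the argument is \<open>\<Phi>\<close>, a product over the cosets divided by a power
  of the theta product. Up to powers of \<open>y\<close>, which cancel, the numerator decays like
  \<open>exp (- 24 * pi * m * y)\<close>, because one of its factors comes from the cusp at infinity and the others
  have moderate growth, while for \<open>d\<close> cosets the denominator is at least of the size of
  \<open>exp (- pi * k * d * y)\<close>.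
\<close>

theorem sturm_vanishing:
  fixes k M :: nat and m :: real
  assumes M: "M > 0" and hol: "g holomorphic_on upper_half_plane"
    and inv: "\<And>G z. G \<in> Gamma0 M \<Longrightarrow> Im z > 0 \<Longrightarrow> invariant_norm k g (moebius G z) = invariant_norm k g z"
    and growth: "\<And>A. A \<in> SL2 \<Longrightarrow>
      moderate_growth k (\<lambda>z. invariant_norm k g (moebius A z))"
    and order: "\<forall>\<^sub>F y in at_top. \<forall>z. Im z = y \<longrightarrow> norm (g z) \<le> K0 * exp (- 2 * pi * m * y)"
    and m: "m > real k / 24 * real (Gamma0_index M)"
    and z: "Im z > 0"
  shows "g z = 0"
proof -
  define RC where "RC = Gamma0_cosets M"
  define d where "d = card RC"
  have RC: "finite RC" "Gamma0 M \<in> RC" unfolding RC_def by (intro finite_Gamma0_cosets M Gamma0_in_cosets)+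
  have d: "d = Gamma0_index M" by (simp add: d_def RC_def Gamma0_index_def Gamma0_cosets_def)
  have SL: "coset_rep C \<in> SL2" if "C \<in> RC" for C using that by (simp add: RC_def coset_rep_SL2)
  define \<mu> where "\<mu> = invariant_norm k g"
  have \<mu>_nonneg: "\<mu> w \<ge> 0" if "Im w > 0" for w using that by (simp add: \<mu>_def invariant_norm_def)
  define N where "N w = (\<Prod>C\<in>RC. g (moebius (coset_rep C) w) ^ 4 / moebius_denom (coset_rep C) w ^ (2 * k))" for w
  define \<Phi> where "\<Phi> w = N w ^ 3 / theta_product w ^ (4 * k * d)" for w
  have g_hol: "(\<lambda>w. g (moebius (coset_rep C) w)) holomorphic_on upper_half_plane" if "C \<in> RC" for C
  proof (rule holomorphic_on_compose_gen[OF moebius_holomorphic[OF SL[OF that]] hol, unfolded o_def])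
    show "moebius (coset_rep C) ` upper_half_plane \<subseteq> upper_half_plane"
      using Im_moebius_pos[OF SL[OF that]] by (auto simp: upper_half_plane_def)
  qed
  have moebius_denom_hol: "moebius_denom A holomorphic_on upper_half_plane" for A
    unfolding moebius_denom_def by (intro holomorphic_intros)
  have N_hol: "N holomorphic_on upper_half_plane"
    unfolding N_def using moebius_denom_nonzero SL
    by (intro holomorphic_on_prod holomorphic_on_divide holomorphic_on_power g_hol moebius_denom_hol) (auto simp: upper_half_plane_def)
  have \<Phi>_hol: "\<Phi> holomorphic_on upper_half_plane"
    unfolding \<Phi>_def using theta_product_nonzero
    by (intro holomorphic_on_divide holomorphic_on_power N_hol theta_product_holomorphic) (auto simp: upper_half_plane_def)
  have N_norm: "norm (N w) * Im w ^ (k * d) = (\<Prod>C\<in>RC. \<mu> (moebius (coset_rep C) w))" if w: "Im w > 0" for w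
  proof -
    have "\<mu> (moebius (coset_rep C) w) = norm (g (moebius (coset_rep C) w) ^ 4 / moebius_denom (coset_rep C) w ^ (2 * k)) * Im w ^ k" if "C \<in> RC" for C
      by (simp add: \<mu>_def invariant_norm_def Im_moebius[OF SL[OF that] w] norm_divide norm_power power_divide flip: power_mult)
    then have "(\<Prod>C\<in>RC. \<mu> (moebius (coset_rep C) w)) = (\<Prod>C\<in>RC. norm (g (moebius (coset_rep C) w) ^ 4 / moebius_denom (coset_rep C) w ^ (2 * k)) * Im w ^ k)"
      by (intro prod.cong) auto
    also have "\<dots> = norm (N w) * Im w ^ (k * d)"
      by (simp add: prod.distrib N_def prod_norm d_def power_mult)
    finally show ?thesis by simp
  qed
  have \<Phi>_norm: "norm (\<Phi> w) = (\<Prod>C\<in>RC. \<mu> (moebius (coset_rep C) w)) ^ 3 / theta_product_norm w ^ (k * d)" if w: "Im w > 0" for w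
  proof -
    have "norm (\<Phi> w) = (norm (N w) * Im w ^ (k * d)) ^ 3 / (norm (theta_product w) ^ 4 * Im w ^ 3) ^ (k * d)"
      using w by (simp add: \<Phi>_def norm_divide norm_power power_mult_distrib mult_ac flip: power_mult)
    then show ?thesis unfolding N_norm[OF w] theta_product_norm_def .
  qed
  have "\<Phi> w = 0" if "Im w > 0" for w
  proof (rule SL2_invariant_vanishing[OF \<Phi>_hol _ _ that])
    fix A z assume A: "A \<in> SL2" and z: "Im z > 0"
    have "(\<Prod>C\<in>RC. \<mu> (moebius (coset_rep C) (moebius A z))) = (\<Prod>C\<in>RC. \<mu> (moebius (coset_rep C) z))"
      unfolding RC_def \<mu>_def by (rule prod_cosets_invariant[where F = "invariant_norm k g", OF inv A z])
    then show "norm (\<Phi> (moebius A z)) = norm (\<Phi> z)"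
      using z by (simp add: \<Phi>_norm Im_moebius_pos A theta_product_norm_SL2)
  next
    fix \<epsilon> :: real assume "\<epsilon> > 0"
    have "\<forall>C\<in>RC. moderate_growth k (\<lambda>z. \<mu> (moebius (coset_rep C) z))"
      unfolding \<mu>_def by (intro ballI growth SL)
    then obtain K where K: "\<forall>C\<in>RC. \<forall>\<^sub>F y in at_top. \<forall>z. Im z = y \<longrightarrow> \<mu> (moebius (coset_rep C) z) \<le> K C * y ^ k"
      by (rule bchoice[THEN exE])
    define c where "c = (\<bar>K0\<bar> ^ 4 * (\<Prod>C\<in>RC - {Gamma0 M}. \<bar>K C\<bar>)) ^ 3 * 256 ^ (k * d)"
    \<comment> \<open>the rate of decay, positive by the hypothesis on \<open>m\<close>; the number 256 comes from the factor 1/4 in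
        the lower bound for the theta product\<close>
    define e where "e = (24 * m - k * d) * pi"
    have "e > 0" using m pi_gt_zero by (simp add: d e_def)
    then have "((\<lambda>y. c * exp (- e * y)) \<longlongrightarrow> 0) at_top" by real_asymp
    then have "\<forall>\<^sub>F y in at_top. c * exp (- e * y) < \<epsilon>"
      using \<open>\<epsilon> > 0\<close> by (rule order_tendstoD)
    moreover have "\<forall>\<^sub>F y in at_top. \<forall>C\<in>RC. \<forall>z. Im z = y \<longrightarrow> \<mu> (moebius (coset_rep C) z) \<le> K C * y ^ k"
      using K RC(1) by (simp add: eventually_ball_finite_distrib)
    moreover have "\<forall>\<^sub>F y::real in at_top. y \<ge> 2" by (rule eventually_ge_at_top)
    ultimately show "\<forall>\<^sub>F y in at_top. \<forall>z. Im z = y \<longrightarrow> norm (\<Phi> z) < \<epsilon>"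
      using order
    proof eventually_elim
      case (elim y)
      show ?case
      proof (intro allI impI)
        fix z assume z: "Im z = y"
        then have z0: "Im z > 0" using elim by simp
        have P: "\<mu> (moebius (coset_rep (Gamma0 M)) z) \<le> \<bar>K0\<bar> ^ 4 * exp (- 8 * pi * m * y) * y ^ k"
        proof -
          obtain G where "G \<in> Gamma0 M" "coset_rep (Gamma0 M) = G ** mat 1"
            using Gamma0_cosets_same[OF RC(2)[unfolded RC_def] coset_rep_in[OF RC(2)[unfolded RC_def]], of "mat 1"]
              subgroup.one_closed[OF subgroup_Gamma0[of M]] by (auto simp: SL2Z_def)
          then have "coset_rep (Gamma0 M) \<in> Gamma0 M" by simp
          then have "\<mu> (moebius (coset_rep (Gamma0 M)) z) = norm (g z) ^ 4 * y ^ k"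
            using inv z0 z by (simp add: \<mu>_def invariant_norm_def)
          also have "norm (g z) \<le> \<bar>K0\<bar> * exp (- 2 * pi * m * y)"
            using elim z by (smt (verit) exp_gt_zero mult_right_mono)
          then have "norm (g z) ^ 4 * y ^ k \<le> (\<bar>K0\<bar> * exp (- 2 * pi * m * y)) ^ 4 * y ^ k"
            using elim by (intro mult_right_mono power_mono) auto
          also have "(\<bar>K0\<bar> * exp (- 2 * pi * m * y)) ^ 4 = \<bar>K0\<bar> ^ 4 * exp (- 8 * pi * m * y)"
            by (simp add: power_mult_distrib flip: exp_of_nat_mult)
          finally show ?thesis .
        qed
        have "(\<Prod>C\<in>RC - {Gamma0 M}. \<mu> (moebius (coset_rep C) z)) \<le> (\<Prod>C\<in>RC - {Gamma0 M}. \<bar>K C\<bar> * y ^ k)"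
        proof (intro prod_mono conjI)
          fix C assume C: "C \<in> RC - {Gamma0 M}"
          show "0 \<le> \<mu> (moebius (coset_rep C) z)" using C by (intro \<mu>_nonneg Im_moebius_pos SL z0) auto
          have "\<mu> (moebius (coset_rep C) z) \<le> K C * y ^ k" using elim C z by auto
          also have "\<dots> \<le> \<bar>K C\<bar> * y ^ k" using elim by (intro mult_right_mono) auto
          finally show "\<mu> (moebius (coset_rep C) z) \<le> \<bar>K C\<bar> * y ^ k" .
        qed
        also have "\<dots> = (\<Prod>C\<in>RC - {Gamma0 M}. \<bar>K C\<bar>) * y ^ (k * (d - 1))"
          using RC by (simp add: prod.distrib d_def power_mult)
        finally have Q: "(\<Prod>C\<in>RC - {Gamma0 M}. \<mu> (moebius (coset_rep C) z)) \<le> (\<Prod>C\<in>RC - {Gamma0 M}. \<bar>K C\<bar>) * y ^ (k * (d - 1))" .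
        have "card RC > 0" using RC by (auto simp: card_gt_0_iff)
        then have dpos: "d = Suc (d - 1)" by (simp add: d_def)
        have "(\<Prod>C\<in>RC. \<mu> (moebius (coset_rep C) z)) = \<mu> (moebius (coset_rep (Gamma0 M)) z) * (\<Prod>C\<in>RC - {Gamma0 M}. \<mu> (moebius (coset_rep C) z))"
          using RC by (rule prod.remove)
        also have "\<dots> \<le> (\<bar>K0\<bar> ^ 4 * exp (- 8 * pi * m * y) * y ^ k) * ((\<Prod>C\<in>RC - {Gamma0 M}. \<bar>K C\<bar>) * y ^ (k * (d - 1)))"
          using elim by (intro mult_mono P Q prod_nonneg \<mu>_nonneg Im_moebius_pos SL z0 mult_nonneg_nonneg) auto
        also have "\<dots> = (\<bar>K0\<bar> ^ 4 * (\<Prod>C\<in>RC - {Gamma0 M}. \<bar>K C\<bar>)) * exp (- 8 * pi * m * y) * y ^ (k * d)"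
        proof -
          have "k * d = k + k * (d - 1)" by (subst dpos) simp
          then show ?thesis by (simp only: power_add mult_ac)
        qed
        finally have num: "(\<Prod>C\<in>RC. \<mu> (moebius (coset_rep C) z)) \<le> (\<bar>K0\<bar> ^ 4 * (\<Prod>C\<in>RC - {Gamma0 M}. \<bar>K C\<bar>)) * exp (- 8 * pi * m * y) * y ^ (k * d)" .
        have num0: "0 \<le> (\<Prod>C\<in>RC. \<mu> (moebius (coset_rep C) z))"
          by (intro prod_nonneg \<mu>_nonneg Im_moebius_pos SL z0)
        have "(exp (- pi * y / 4) / 4) ^ 4 * y ^ 3 \<le> theta_product_norm z"
          unfolding theta_product_norm_def z using theta_product_lower_bound[of z] elim z
          by (intro mult_right_mono power_mono) auto
        also have "(exp (- pi * y / 4) / 4) ^ 4 = exp (- pi * y) / 256"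
          by (simp add: power_divide flip: exp_of_nat_mult)
        finally have moebius_denom: "exp (- pi * y) / 256 * y ^ 3 \<le> theta_product_norm z" .
        have "norm (\<Phi> z) \<le> ((\<bar>K0\<bar> ^ 4 * (\<Prod>C\<in>RC - {Gamma0 M}. \<bar>K C\<bar>)) * exp (- 8 * pi * m * y) * y ^ (k * d)) ^ 3 /
            (exp (- pi * y) / 256 * y ^ 3) ^ (k * d)"
          unfolding \<Phi>_norm[OF z0] using elim num num0 moebius_denom by (intro frac_le power_mono zero_le_power zero_less_power) auto
        also have "\<dots> = c * (exp (- 8 * pi * m * y) ^ 3 / exp (- pi * y) ^ (k * d)) * (y ^ (k * d * 3) / y ^ (3 * (k * d)))"
          by (simp add: c_def power_mult_distrib power_divide flip: power_mult)
        also have "y ^ (k * d * 3) / y ^ (3 * (k * d)) = 1" using elim by (simp add: mult_ac)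
        also have "exp (- 8 * pi * m * y) ^ 3 / exp (- pi * y) ^ (k * d) = exp (- e * y)"
          by (simp add: e_def algebra_simps flip: exp_of_nat_mult exp_diff)
        also have "c * exp (- e * y) * 1 < \<epsilon>" using elim by simp
        finally show "norm (\<Phi> z) < \<epsilon>" .
      qed
    qed
  qed
  then have N0: "N w = 0" if "Im w > 0" for w
    using that theta_product_nonzero[OF that] by (auto simp: \<Phi>_def)
  show "g z = 0"
  proof (rule ccontr)
    assume gz: "g z \<noteq> 0"
    have "\<exists>w\<in>upper_half_plane. (\<Prod>C\<in>RC. g (moebius (coset_rep C) w)) \<noteq> 0"
    proof (rule prod_holomorphic_not_identically_zero[OF open_upper_half_plane connected_upper_half_plane _ RC(1) g_hol])
      show "upper_half_plane \<noteq> {}" using z by (auto simp: upper_half_plane_def)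
      fix C assume C: "C \<in> RC"
      define A where "A = coset_rep C"
      define A' where "A' = mat2 (A $ 2 $ 2) (- A $ 1 $ 2) (- A $ 2 $ 1) (A $ 1 $ 1)"
      have det: "A $ 1 $ 1 * A $ 2 $ 2 - A $ 1 $ 2 * A $ 2 $ 1 = 1" using SL[OF C] by (simp only: SL2_iff A_def)
      then have A': "A' \<in> SL2" by (simp add: A'_def SL2_iff algebra_simps)
      have "A ** A' = mat 1"
        using det by (simp add: vec_eq_iff forall_2 matrix_mult_sel A'_def mat_def algebra_simps)
      then have "moebius A (moebius A' z) = moebius (mat 1) z" using moebius_mult[OF A' z, of A] by simp
      also have "\<dots> = z" by (simp add: moebius_def mat_def)
      finally show "\<exists>w\<in>upper_half_plane. g (moebius (coset_rep C) w) \<noteq> 0"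
        using gz Im_moebius_pos[OF A' z] by (intro bexI[of _ "moebius A' z"]) (auto simp: A_def upper_half_plane_def)
    qed
    then obtain w where w: "Im w > 0" "(\<Prod>C\<in>RC. g (moebius (coset_rep C) w)) \<noteq> 0" by (auto simp: upper_half_plane_def)
    then show False using N0[OF w(1)] RC(1) moebius_denom_nonzero[OF SL w(1)] by (auto simp: N_def prod_zero_iff)
  qed
qed

section \<open>Expansions in powers of the nome\<close>

text \<open>
  The point zero is left out because the nome never takes this value.
\<close>

lemma powser_zero_coeffs:
  fixes c :: "nat \<Rightarrow> complex"
  assumes "\<And>w. w \<noteq> 0 \<Longrightarrow> norm w < 1 \<Longrightarrow> (\<lambda>n. c n * w ^ n) sums 0"
  shows "c n = 0"
  using assms
proof (induction n arbitrary: c rule: less_induct)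
  case (less n)
  have c0: "c 0 = 0"
  proof -
    have "((\<lambda>w::complex. 0) \<longlongrightarrow> c 0) (at 0)"
      by (rule powser_limit_0_strong[of 1]) (use less.prems in auto)
    then show ?thesis using tendsto_const[of 0 "at (0::complex)"] tendsto_unique[OF at_neq_bot] by metis
  qed
  show ?case
  proof (cases n)
    case 0
    then show ?thesis using c0 by simp
  next
    case (Suc m)
    have "(\<lambda>n. c (Suc n) * w ^ n) sums 0" if w: "w \<noteq> 0" "norm w < 1" for w
    proof -
      have "(\<lambda>n. c (Suc n) * w ^ Suc n) sums 0"
        using less.prems[OF w] c0 by (subst sums_Suc_iff) simp
      then have "(\<lambda>n. (c (Suc n) * w ^ Suc n) * (1 / w)) sums (0 * (1 / w))" by (rule sums_mult2)
      then show ?thesis using w by simp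
    qed
    then show ?thesis using less.IH[of m "\<lambda>n. c (Suc n)"] Suc by simp
  qed
qed

lemma powser_bounded:
  fixes c :: "nat \<Rightarrow> complex"
  assumes "\<And>w. w \<noteq> 0 \<Longrightarrow> norm w < 1 \<Longrightarrow> summable (\<lambda>n. c n * w ^ n)" and r: "0 < r" "r < 1"
  obtains K where "\<And>w s. norm w \<le> r \<Longrightarrow> (\<lambda>n. c n * w ^ n) sums s \<Longrightarrow> norm s \<le> K"
proof -
  have "summable (\<lambda>n. c n * complex_of_real ((1 + r) / 2) ^ n)"
    using r by (intro assms(1)) (auto simp del: of_real_add of_real_divide)
  then have "summable (\<lambda>n. norm (c n * complex_of_real r ^ n))"
    by (rule powser_insidea) (use r in \<open>auto simp del: of_real_add of_real_divide\<close>)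
  then have r_sum: "summable (\<lambda>n. norm (c n) * r ^ n)"
    using r by (simp add: norm_mult norm_power)
  have "norm s \<le> (\<Sum>n. norm (c n) * r ^ n)" if w: "norm w \<le> r" and s: "(\<lambda>n. c n * w ^ n) sums s" for w s
  proof -
    have le: "norm (c n * w ^ n) \<le> norm (c n) * r ^ n" for n
      using w by (simp add: norm_mult norm_power mult_left_mono power_mono)
    have "norm (\<Sum>n. c n * w ^ n) \<le> (\<Sum>n. norm (c n * w ^ n))"
      by (intro summable_norm summable_comparison_test'[OF r_sum]) (use le in auto)
    also have "\<dots> \<le> (\<Sum>n. norm (c n) * r ^ n)"
      by (intro suminf_le le r_sum summable_comparison_test'[OF r_sum]) (use le in auto)
    finally show ?thesis using s by (simp add: sums_iff)
  qed
  then show ?thesis using that by blast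
qed

text \<open>
  Statements about power series in the nome can thus be proved on the punctured unit disc.
\<close>

lemma qexp_surj:
  assumes "w \<noteq> 0" "norm w < 1"
  obtains z where "Im z > 0" "qexp z = w"
proof
  define z where "z = Ln w / (2 * of_real pi * \<i>)"
  have "2 * of_real pi * \<i> * z = Ln w" by (simp add: z_def)
  then show q: "qexp z = w" using assms(1) by (simp add: qexp_def)
  then have "exp (- 2 * pi * Im z) < 1" using assms(2) norm_qexp[of z] by simp
  then show "Im z > 0" using pi_gt_zero by (simp add: zero_less_mult_iff)
qed

lemma has_q_expansion_unique:
  assumes "has_q_expansion f a" "has_q_expansion f b" "n \<ge> 1"
  shows "a n = b n"
proof -
  have "(\<lambda>n. (a (Suc n) - b (Suc n)) * w ^ n) sums 0" if w: "w \<noteq> 0" "norm w < 1" for w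
  proof -
    obtain z where z: "Im z > 0" "qexp z = w" using qexp_surj[OF w] by blast
    have "(\<lambda>n. a (Suc n) * w ^ Suc n - b (Suc n) * w ^ Suc n) sums (f z - f z)"
      using assms z by (intro sums_diff) (auto simp: has_q_expansion_def upper_half_plane_def)
    then have "(\<lambda>n. (a (Suc n) * w ^ Suc n - b (Suc n) * w ^ Suc n) * (1 / w)) sums ((f z - f z) * (1 / w))"
      by (rule sums_mult2)
    moreover have "(a (Suc n) * w ^ Suc n - b (Suc n) * w ^ Suc n) * (1 / w) = (a (Suc n) - b (Suc n)) * w ^ n" for n
      using w by (simp add: left_diff_distrib diff_divide_distrib)
    ultimately show ?thesis by simp
  qed
  from powser_zero_coeffs[OF this, of "n - 1"] show ?thesis using assms(3) by simp
qed

lemma has_q_expansion_decay: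
  assumes q: "has_q_expansion g e" and zero: "\<And>n. 1 \<le> n \<Longrightarrow> n < m \<Longrightarrow> e n = 0" and m: "m \<ge> 1"
  obtains K where "\<And>z. Im z \<ge> 1 \<Longrightarrow> norm (g z) \<le> K * exp (- 2 * pi * real m * Im z)"
proof -
  have sums: "(\<lambda>n. e (n + m) * qexp z ^ n) sums (g z / qexp z ^ m)" if z: "Im z > 0" for z
  proof -
    have "(\<lambda>n. e (Suc n) * qexp z ^ Suc n) sums g z"
      using q z by (simp add: has_q_expansion_def upper_half_plane_def)
    moreover have "(\<Sum>n<m-1. e (Suc n) * qexp z ^ Suc n) = 0" using zero by (intro sum.neutral) auto
    ultimately have "(\<lambda>n. e (Suc (n + (m - 1))) * qexp z ^ Suc (n + (m - 1))) sums g z"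
      by (subst sums_iff_shift) simp
    then have "(\<lambda>n. e (n + m) * qexp z ^ (n + m)) sums g z" using m by simp
    then have "(\<lambda>n. (e (n + m) * qexp z ^ (n + m)) * (1 / qexp z ^ m)) sums (g z * (1 / qexp z ^ m))"
      by (rule sums_mult2)
    moreover have "qexp z \<noteq> 0" by (simp add: qexp_def)
    ultimately show ?thesis by (simp add: power_add)
  qed
  have "summable (\<lambda>n. e (n + m) * w ^ n)" if w: "w \<noteq> 0" "norm w < 1" for w
  proof -
    obtain z where "Im z > 0" "qexp z = w" using qexp_surj[OF w] by blast
    then show ?thesis using sums[of z] by (auto simp: sums_iff)
  qed
  then obtain K where K: "\<And>w s. norm w \<le> exp (- 2 * pi) \<Longrightarrow> (\<lambda>n. e (n + m) * w ^ n) sums s \<Longrightarrow> norm s \<le> K"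
    by (rule powser_bounded[where r = "exp (- 2 * pi)"]) auto
  have "norm (g z) \<le> K * exp (- 2 * pi * real m * Im z)" if z: "Im z \<ge> 1" for z
  proof -
    have "norm (g z / qexp z ^ m) \<le> K"
      by (rule K[OF _ sums]) (use z in \<open>auto simp: norm_qexp\<close>)
    moreover have "norm (qexp z ^ m) = exp (- 2 * pi * real m * Im z)"
      by (simp add: norm_power norm_qexp mult_ac flip: exp_of_nat_mult)
    ultimately show ?thesis by (simp add: norm_divide field_simps)
  qed
  then show ?thesis using that by blast
qed

section \<open>Growth at the cusps\<close>

lemma sqrt_factors_nonempty:
  assumes A: "A \<in> SL2"
  shows "sqrt_factors A \<noteq> {}"
proof (cases "A $ 2 $ 1 = 0")
  case True
  then have "A $ 1 $ 1 * A $ 2 $ 2 = 1" using A by (simp add: SL2_iff)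
  then have d: "A $ 2 $ 2 = 1 \<or> A $ 2 $ 2 = -1" using zmult_eq_1_iff by auto
  then have "(\<lambda>_. 1) \<in> sqrt_factors A"
    unfolding sqrt_factors_def using True
    by (auto intro!: exI[of _ "of_int (A $ 2 $ 2)"] holomorphic_intros)
  then show ?thesis by blast
next
  case False
  have "(\<lambda>z. csqrt (moebius_denom A z)) \<in> sqrt_factors A"
  proof -
    have "moebius_denom A z \<notin> \<real>\<^sub>\<le>\<^sub>0" if "Im z > 0" for z
      using False that by (auto simp: complex_nonpos_Reals_iff moebius_denom_def)
    then have "(\<lambda>z. csqrt (moebius_denom A z)) holomorphic_on upper_half_plane"
      by (intro holomorphic_on_csqrt') (auto simp: upper_half_plane_def moebius_denom_def intro!: holomorphic_intros)
    then show ?thesis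
      by (auto simp: sqrt_factors_def moebius_denom_def intro!: exI[of _ 1])
  qed
  then show ?thesis by blast
qed

text \<open>
  The expansion at the cusp is a power series in \<open>qexp (z / h)\<close>, times a factor of absolute value at
  most 1, and therefore bounded for \<open>Im z \<ge> h\<close>. The fourth power of the square root factor has the
  absolute value of the square of \<open>c z + d\<close>, which the imaginary part of the transformed point cancels.
\<close>

lemma holomorphic_at_cusp_growth:
  assumes A: "A \<in> SL2" and cusp: "holomorphic_at_cusp k f A"
  shows "moderate_growth k (\<lambda>z. invariant_norm k f (moebius A z))"
proof -
  obtain \<phi> where \<phi>: "\<phi> \<in> sqrt_factors A" using sqrt_factors_nonempty[OF A] by blast
  then obtain h r c where exp: "cusp_expansion k f A \<phi> h r c"
    using cusp unfolding holomorphic_at_cusp_def by blast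
  then have h: "h > 0" and r: "0 \<le> r" by (auto simp: cusp_expansion_def)
  obtain t where t: "norm t = 1" "\<And>z. Im z > 0 \<Longrightarrow> \<phi> z ^ 2 = t * moebius_denom A z"
    using \<phi> unfolding sqrt_factors_def moebius_denom_def upper_half_plane_def by blast
  have sums: "(\<lambda>n. c n * qexp (z / h) ^ n) sums (f (moebius A z) / \<phi> z ^ k / qexp (of_real (r / h) * z))"
    if z: "Im z > 0" for z
  proof -
    have "(\<lambda>n. c n * qexp (of_real ((real n + r) / h) * z)) sums (f (moebius A z) / \<phi> z ^ k)"
      using exp z by (auto simp: cusp_expansion_def upper_half_plane_def)
    then have "(\<lambda>n. c n * qexp (of_real ((real n + r) / h) * z) * (1 / qexp (of_real (r / h) * z)))
        sums (f (moebius A z) / \<phi> z ^ k * (1 / qexp (of_real (r / h) * z)))"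
      by (rule sums_mult2)
    moreover have "qexp (of_real ((real n + r) / h) * z) = qexp (z / h) ^ n * qexp (of_real (r / h) * z)" for n
    proof -
      have "of_real ((real n + r) / h) * z = of_nat n * (z / h) + of_real (r / h) * z"
        by (simp add: field_simps add_divide_distrib)
      then show ?thesis by (simp only: qexp_add qexp_power)
    qed
    moreover have "qexp (of_real (r / h) * z) \<noteq> 0" by (simp add: qexp_def)
    ultimately show ?thesis by (simp add: mult.assoc)
  qed
  have "summable (\<lambda>n. c n * w ^ n)" if w: "w \<noteq> 0" "norm w < 1" for w
  proof -
    obtain z where "Im z > 0" "qexp z = w" using qexp_surj[OF w] by blast
    then show ?thesis using sums[of "of_real h * z"] h by (auto simp: sums_iff)
  qed
  then obtain K where K: "\<And>w s. norm w \<le> exp (- 2 * pi) \<Longrightarrow> (\<lambda>n. c n * w ^ n) sums s \<Longrightarrow> norm s \<le> K"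
    by (rule powser_bounded[where r = "exp (- 2 * pi)"]) auto
  have "invariant_norm k f (moebius A z) \<le> K ^ 4 * y ^ k" if z: "Im z = y" and y: "y \<ge> h" for y z
  proof -
    have z0: "Im z > 0" using z y h by simp
    have "norm (qexp (z / h)) \<le> exp (- 2 * pi)"
      using z y h by (simp add: norm_qexp field_simps)
    then have "norm (f (moebius A z) / \<phi> z ^ k / qexp (of_real (r / h) * z)) \<le> K"
      by (rule K[OF _ sums[OF z0]])
    moreover have "norm (qexp (of_real (r / h) * z)) > 0" by (simp add: qexp_def)
    ultimately have "norm (f (moebius A z) / \<phi> z ^ k) \<le> K * norm (qexp (of_real (r / h) * z))"
      by (simp only: norm_divide[of "f (moebius A z) / \<phi> z ^ k"] pos_divide_le_eq)
    also have "\<dots> \<le> K * 1"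
    proof (rule mult_left_mono)
      show "norm (qexp (of_real (r / h) * z)) \<le> 1" using r h z0 by (simp add: norm_qexp)
      have "norm (c 0) \<le> K" by (rule K[OF _ powser_sums_zero]) simp
      then show "K \<ge> 0" using norm_ge_zero order_trans by blast
    qed
    finally have "norm (f (moebius A z)) / norm (\<phi> z) ^ k \<le> K"
      by (simp add: norm_divide norm_power)
    moreover have "\<phi> z \<noteq> 0"
      using t(2)[OF z0] moebius_denom_nonzero[OF A z0] t(1) by auto
    then have "norm (\<phi> z) ^ k > 0" by simp
    ultimately have "norm (f (moebius A z)) \<le> K * norm (\<phi> z) ^ k"
      by (simp only: pos_divide_le_eq)
    then have "norm (f (moebius A z)) ^ 4 \<le> (K * norm (\<phi> z) ^ k) ^ 4" by (intro power_mono) auto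
    also have "\<dots> = K ^ 4 * (norm (\<phi> z ^ 2)) ^ (2 * k)"
      by (simp add: power_mult_distrib norm_power mult_ac flip: power_mult)
    also have "norm (\<phi> z ^ 2) = norm (moebius_denom A z)" unfolding t(2)[OF z0] by (simp add: norm_mult t(1))
    finally have "invariant_norm k f (moebius A z) \<le> K ^ 4 * norm (moebius_denom A z) ^ (2 * k) * Im (moebius A z) ^ k"
      unfolding invariant_norm_def using Im_moebius_pos[OF A z0] by (intro mult_right_mono) auto
    also have "\<dots> = K ^ 4 * y ^ k"
      using moebius_denom_nonzero[OF A z0] z by (simp add: Im_moebius[OF A z0] power_divide flip: power_mult)
    finally show ?thesis .
  qed
  then show ?thesis
    by (intro exI[of _ "K ^ 4"] eventually_at_top_linorderI[of h]) auto
qed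

text \<open>
  Hermite normal form of an integral matrix with positive determinant: after division by its greatest
  common divisor the first column can be completed to a matrix of determinant 1.
\<close>

lemma primitive_column_completion:
  fixes x1 x2 x3 x4 :: int
  assumes det: "x1 * x4 - x2 * x3 > 0"
  obtains B p q s where "B \<in> SL2" "p > 0" "s > 0" "x1 = B $ 1 $ 1 * p" "x3 = B $ 2 $ 1 * p"
    "x2 = B $ 1 $ 1 * q + B $ 1 $ 2 * s" "x4 = B $ 2 $ 1 * q + B $ 2 $ 2 * s"
proof -
  define p where "p = gcd x1 x3"
  have "x1 \<noteq> 0 \<or> x3 \<noteq> 0" using det by auto
  then have p: "p > 0" by (simp add: p_def)
  define b1 b3 where "b1 = x1 div p" and "b3 = x3 div p"
  have x: "x1 = b1 * p" "x3 = b3 * p" by (simp_all add: b1_def b3_def p_def)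
  have "coprime b1 b3" using \<open>x1 \<noteq> 0 \<or> x3 \<noteq> 0\<close> div_gcd_coprime by (simp add: b1_def b3_def p_def)
  then obtain u v where uv: "u * b1 + v * b3 = 1"
    using bezout_int[of b1 b3] by (auto simp: coprime_iff_gcd_eq_1)
  define q s where "q = u * x2 + v * x4" and "s = b1 * x4 - b3 * x2"
  have "p * s = x1 * x4 - x2 * x3" by (simp add: s_def x algebra_simps)
  then have "s > 0" using det p zero_less_mult_pos by metis
  have "b1 * q + (- v) * s = (u * b1 + v * b3) * x2" by (simp add: q_def s_def algebra_simps)
  moreover have "b3 * q + u * s = (u * b1 + v * b3) * x4" by (simp add: q_def s_def algebra_simps)
  moreover have "mat2 b1 (- v) b3 u \<in> SL2" using uv by (simp add: SL2_iff algebra_simps)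
  ultimately show ?thesis
    using that[of "mat2 b1 (- v) b3 u" p s q] p \<open>s > 0\<close> x uv by simp
qed

text \<open>
  Translating \<open>A z\<close> by \<open>j / 4\<close> amounts to multiplying \<open>A\<close> by an integral matrix of determinant 16. By
  the Hermite normal form the result is \<open>B ((p z + q) / s)\<close> with \<open>B\<close> in the modular group, so that the
  growth of \<open>f\<close> at the cusp of \<open>B\<close> gives the claim.
\<close>

lemma shift_growth:
  fixes j :: int
  assumes A: "A \<in> SL2"
    and growth: "\<And>B. B \<in> SL2 \<Longrightarrow> moderate_growth k (\<lambda>z. invariant_norm k f (moebius B z))"
  shows "moderate_growth k (\<lambda>z. invariant_norm k f (moebius A z + of_int j / 4))"
proof -
  define a b c d where "a = A $ 1 $ 1" and "b = A $ 1 $ 2" and "c = A $ 2 $ 1" and "d = A $ 2 $ 2"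
  have det: "a * d - b * c = 1" using A by (simp add: SL2_iff a_def b_def c_def d_def)
  have "(4 * a + j * c) * (4 * d) - (4 * b + j * d) * (4 * c) = 16 * (a * d - b * c)" by (simp add: algebra_simps)
  then have "(4 * a + j * c) * (4 * d) - (4 * b + j * d) * (4 * c) > 0" using det by simp
  then obtain B p q s where B: "B \<in> SL2" and ps: "p > 0" "s > 0"
    and x: "4 * a + j * c = B $ 1 $ 1 * p" "4 * c = B $ 2 $ 1 * p"
    "4 * b + j * d = B $ 1 $ 1 * q + B $ 1 $ 2 * s" "4 * d = B $ 2 $ 1 * q + B $ 2 $ 2 * s"
    by (rule primitive_column_completion)
  have eq: "moebius A z + of_int j / 4 = moebius B ((of_int p * z + of_int q) / of_int s)" if z: "Im z > 0" for z
  proof -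
    have D: "of_int c * z + of_int d \<noteq> 0" using moebius_denom_nonzero[OF A z] by (simp add: moebius_denom_def c_def d_def)
    have "moebius A z + of_int j / 4 = (of_int (4 * a + j * c) * z + of_int (4 * b + j * d)) / (of_int (4 * c) * z + of_int (4 * d))"
      using D by (simp add: moebius_def a_def b_def c_def d_def divide_simps) (simp add: algebra_simps)
    also have "\<dots> = moebius B ((of_int p * z + of_int q) / of_int s)"
      unfolding x moebius_def using ps(2)
      by (simp add: divide_simps) (simp add: algebra_simps)
    finally show ?thesis .
  qed
  obtain K where K: "\<forall>\<^sub>F y in at_top. \<forall>z. Im z = y \<longrightarrow> invariant_norm k f (moebius B z) \<le> K * y ^ k"
    using growth[OF B] by blast
  define e where "e = real_of_int p / of_int s"
  have "e > 0" using ps by (simp add: e_def)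
  then have "filterlim (\<lambda>y. e * y) at_top at_top" by real_asymp
  with K have "\<forall>\<^sub>F y in at_top. \<forall>z. Im z = e * y \<longrightarrow> invariant_norm k f (moebius B z) \<le> K * (e * y) ^ k"
    by (rule eventually_compose_filterlim)
  moreover have "\<forall>\<^sub>F y::real in at_top. y > 0" by (rule eventually_gt_at_top)
  ultimately have "\<forall>\<^sub>F y in at_top. \<forall>z. Im z = y \<longrightarrow> invariant_norm k f (moebius A z + of_int j / 4) \<le> (K * e ^ k) * y ^ k"
  proof eventually_elim
    case (elim y)
    show ?case
    proof (intro allI impI)
      fix z assume z: "Im z = y"
      have "Im ((of_int p * z + of_int q) / of_int s) = e * y"
        using z Im_divide_of_real[of "of_int p * z + of_int q" "of_int s"] by (simp add: e_def)
      then have "invariant_norm k f (moebius B ((of_int p * z + of_int q) / of_int s)) \<le> K * (e * y) ^ k"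
        using elim by blast
      then show "invariant_norm k f (moebius A z + of_int j / 4) \<le> (K * e ^ k) * y ^ k"
        using eq[of z] elim z by (simp add: power_mult_distrib mult_ac)
    qed
  qed
  then show ?thesis by blast
qed

section \<open>The part with excluded exponents\<close>

text \<open>
  Expressing \<open>\<Theta> (4 z)\<close> by \<open>\<Theta> z\<close> and \<open>\<Theta> (z + 1/2)\<close> shows that the quotient of \<open>\<Theta> (z + j / 4)\<close> by
  \<open>\<Theta> z\<close> is a function of \<open>theta_ratio z\<close>, whose transformation is known.
\<close>

lemma Theta_quarter_shift:
  fixes j :: int
  assumes z: "Im z > 0"
  shows "Theta (z + of_int j / 4) =
    Theta z * ((1 + theta_ratio z) / 2 + qexp (of_int j / 4) * ((1 - theta_ratio z) / 2))"
proof -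
  have "qexp (of_int j / 4) ^ 4 = 1" using qexp_int[of j] by (simp add: qexp_power)
  then have "Theta (z + of_int j / 4) = Theta (4 * z) + qexp (of_int j / 4) * (Theta z - Theta (4 * z))"
    using z Im_divide_of_real[of "of_int j" 4] by (intro Theta_shift) auto
  moreover have half: "Theta (z + 1/2) = theta_ratio z * Theta z"
    using Theta_nonzero[OF z] by (simp add: theta_ratio_def)
  have even: "Theta (4 * z) = Theta z * ((1 + theta_ratio z) / 2)"
    using Theta_half_shift[OF z] unfolding half by (simp add: algebra_simps)
  have "Theta z - Theta (4 * z) = Theta z * ((1 - theta_ratio z) / 2)"
    unfolding even by (simp add: field_simps)
  ultimately show ?thesis by (simp only: even distrib_left mult.left_commute)
qed

lemma Theta_quarter_shift_factor:
  fixes j :: int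
  assumes A: "A \<in> Gamma0 16" and z: "Im z > 0"
  shows "Theta (moebius A z + of_int j / 4) / Theta (z + of_int j / 4) = theta_factor A z"
proof -
  have SL: "A \<in> SL2" and "16 dvd A $ 2 $ 1" using A by (auto simp: Gamma0_iff)
  then obtain c where c: "A $ 2 $ 1 = 16 * c" by blast
  then have "A \<in> Gamma0 4" using SL by (simp add: Gamma0_iff)
  then have "theta_ratio (moebius A z) = \<i> powi (- (A $ 2 $ 1 * A $ 2 $ 2 div 4)) * theta_ratio z"
    using theta_Gamma0_4 z by blast
  moreover have "\<i> powi (- (A $ 2 $ 1 * A $ 2 $ 2 div 4)) = \<i> powi 0"
    by (intro i_powi_cong) (simp add: c cong_0_iff)
  ultimately have ratio: "theta_ratio (moebius A z) = theta_ratio z" by simp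
  have "Im (z + of_int j / 4) > 0" using z Im_divide_of_real[of "of_int j" 4] by simp
  then have "Theta (z + of_int j / 4) \<noteq> 0" by (rule Theta_nonzero)
  then show ?thesis
    unfolding Theta_quarter_shift[OF z] Theta_quarter_shift[OF Im_moebius_pos[OF SL z]] ratio theta_factor_def
    by simp
qed

text \<open>
  The matrix \<open>B\<close> below is the conjugate of \<open>A\<close> by the translation by \<open>j / 4\<close>. Its entries are integers
  because 16 divides \<open>c\<close>, and because \<open>a d - b c = 1\<close> then makes \<open>a\<close> and \<open>d\<close> congruent modulo 4. It lies
  in \<open>\<Gamma>\<^sub>0(N)\<close>, and its lower right entry is congruent to \<open>d\<close> modulo \<open>N\<close>.
\<close>

lemma modular_form_quarter_shift:
  fixes j :: int
  assumes f: "f \<in> modular_forms k N chi" and chi: "dirichlet_character N chi" and "4 dvd N"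
    and A: "A \<in> Gamma0 (4 * N)" and z: "Im z > 0"
  shows "f (moebius A z + of_int j / 4) = chi (A $ 2 $ 2) * theta_factor A z ^ k * f (z + of_int j / 4)"
proof -
  define a b c d where "a = A $ 1 $ 1" and "b = A $ 1 $ 2" and "c = A $ 2 $ 1" and "d = A $ 2 $ 2"
  have SL: "A \<in> SL2" and "int (4 * N) dvd c" using A by (auto simp: Gamma0_iff c_def)
  then obtain c1 where "c = int (4 * N) * c1" by blast
  then have c1: "c = 4 * (int N * c1)" by simp
  obtain N' where N': "N = 4 * N'" using \<open>4 dvd N\<close> by blast
  define c' where "c' = int N' * c1"
  have c': "c = 16 * c'" using c1 by (simp add: c'_def N')
  have det: "a * d - b * c = 1" using SL by (simp add: SL2_iff a_def b_def c_def d_def)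
  have "odd d" unfolding d_def by (rule SL2_odd[OF SL]) (use c' in \<open>simp add: c_def\<close>)
  have "4 dvd d - a"
  proof -
    obtain i where i: "d = 2 * i + 1" using \<open>odd d\<close> oddE by blast
    have "(d - a) * d = d\<^sup>2 - 1 - b * c" using det by (simp add: power2_eq_square algebra_simps)
    also have "d\<^sup>2 - 1 = 4 * (i * (i + 1))" by (simp add: i power2_eq_square algebra_simps)
    also have "4 * (i * (i + 1)) - b * c = 4 * (i * (i + 1) - 4 * b * c')" by (simp add: c' algebra_simps)
    finally have "4 dvd (d - a) * d" by simp
    moreover have "coprime (2 ^ 2) d" using \<open>odd d\<close> by (intro coprime_power_left_iff[THEN iffD2]) simp
    ultimately show ?thesis by (simp add: coprime_dvd_mult_left_iff)
  qed
  then obtain e where e: "d = a + 4 * e" by (metis dvd_def diff_eq_eq add.commute)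
  define B where "B = mat2 (a + 4 * (j * c')) (b + j * e - j\<^sup>2 * c') c (d - 4 * (j * c'))"
  have "B $ 1 $ 1 * B $ 2 $ 2 - B $ 1 $ 2 * B $ 2 $ 1 = a * d - b * c"
    by (simp add: B_def e c' power2_eq_square algebra_simps)
  then have B_SL: "B \<in> SL2" using det by (simp add: SL2_iff)
  have B: "B \<in> Gamma0 N" using B_SL c1 by (simp add: Gamma0_iff B_def)
  define w where "w = z + of_int j / 4"
  have w: "Im w > 0" using z Im_divide_of_real[of "of_int j" 4] by (simp add: w_def)
  have Bw: "moebius B w = moebius A z + of_int j / 4"
  proof -
    have D: "of_int c * z + of_int d \<noteq> 0" using moebius_denom_nonzero[OF SL z] by (simp add: moebius_denom_def c_def d_def)
    have num: "of_int (B $ 1 $ 1) * w + of_int (B $ 1 $ 2) =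
        (of_int a * z + of_int b) + of_int j / 4 * (of_int c * z + of_int d)"
      by (simp add: B_def w_def e c' power2_eq_square field_simps)
    have moebius_denom: "of_int (B $ 2 $ 1) * w + of_int (B $ 2 $ 2) = of_int c * z + of_int d"
      by (simp add: B_def w_def c' field_simps)
    have "(X + J * Y) / Y = X / Y + J" if "Y \<noteq> 0" for X J Y :: complex
      using that by (simp add: add_divide_distrib)
    from this[OF D] show ?thesis
      unfolding moebius_def num moebius_denom by (simp only: a_def b_def c_def d_def)
  qed
  have "[B $ 2 $ 2 = d] (mod int N)"
    by (simp add: B_def cong_iff_dvd_diff c'_def N')
  then have chi_eq: "chi (B $ 2 $ 2) = chi d" using chi unfolding dirichlet_character_def by blast
  have "A \<in> Gamma0 16" using SL c' by (simp add: Gamma0_iff c_def)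
  then have "theta_factor B w = theta_factor A z"
    unfolding theta_factor_def[of B] Bw unfolding w_def by (rule Theta_quarter_shift_factor[OF _ z])
  moreover have "f (moebius B w) = chi (B $ 2 $ 2) * theta_factor B w ^ k * f w"
    using f B w by (simp add: modular_forms_def upper_half_plane_def)
  ultimately show ?thesis unfolding Bw chi_eq by (simp add: d_def w_def)
qed

text \<open>
  A character takes only finitely many values, so the powers of a value stay bounded; apply this also
  to an inverse modulo \<open>N\<close>.
\<close>

lemma norm_dirichlet_character:
  assumes chi: "dirichlet_character N chi" and N: "N > 0" and a: "coprime a (int N)"
  shows "norm (chi a) = 1"
proof -
  have mult: "chi (x * y) = chi x * chi y" for x y using chi by (simp add: dirichlet_character_def)
  have nz: "chi x \<noteq> 0 \<longleftrightarrow> coprime x (int N)" for x using chi by (simp add: dirichlet_character_def)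
  have cong: "[x = y] (mod int N) \<Longrightarrow> chi x = chi y" for x y using chi by (simp add: dirichlet_character_def)
  have one: "chi 1 = 1" using mult[of 1 1] nz[of 1] by simp
  have power: "chi (x ^ n) = chi x ^ n" for x n by (induction n) (simp_all add: one mult)
  define B where "B = Max ((\<lambda>x. norm (chi x)) ` {0..<int N})"
  have B: "norm (chi x) \<le> B" for x
  proof -
    have "chi x = chi (x mod int N)" by (intro cong) (simp add: cong_def)
    moreover have "x mod int N \<in> {0..<int N}" using N by simp
    ultimately show ?thesis unfolding B_def by (intro Max_ge) auto
  qed
  have le: "norm (chi x) \<le> 1" for x
  proof (rule ccontr)
    assume "\<not> norm (chi x) \<le> 1"
    then obtain n where "B < norm (chi x) ^ n" using real_arch_pow by fastforce
    then show False using B[of "x ^ n"] by (simp add: power norm_power)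
  qed
  obtain b where "[a * b = 1] (mod int N)" using a cong_solve_coprime_int by blast
  then have "chi a * chi b = 1" using cong[of "a * b" 1] by (simp add: mult one)
  then have "norm (chi a) * norm (chi b) = 1" by (metis norm_mult norm_one)
  then show ?thesis using le[of a] le[of b] mult_left_le[of "norm (chi b)" "norm (chi a)"] by simp
qed

text \<open>
  The discrete Fourier transform, modulo 4, of the indicator function of the excluded residue classes.
  It vanishes at \<open>j = 2\<close>, so the residues \<open>- 1\<close>, 0 and 1 suffice.
\<close>

definition excluded_weight :: "nat \<Rightarrow> int \<Rightarrow> complex" where
  "excluded_weight k j = (if j = 0 then 1/2 else - (1 + of_int j * (-1) ^ ((k + 1) div 2) * \<i>) / 4)"

definition excluded_part :: "nat \<Rightarrow> (complex \<Rightarrow> complex) \<Rightarrow> complex \<Rightarrow> complex" where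
  "excluded_part k f z = (\<Sum>j\<in>{-1, 0, 1}. excluded_weight k j * f (z + of_int j / 4))"

lemma excluded_weight_sum:
  "(\<Sum>j\<in>{-1, 0, 1}. excluded_weight k j * qexp (of_int j / 4) ^ n) = (if excluded_exponent k n then 1 else 0)"
proof -
  define q r where "q = n div 4" and "r = n mod 4"
  have n: "n = 4 * q + r" by (simp add: q_def r_def)
  have r: "r = 0 \<or> r = 1 \<or> r = 2 \<or> r = 3" unfolding r_def by linarith
  have q: "qexp (1 / 4) = \<i>" "qexp (- (1 / 4)) = - \<i>" "qexp 0 = 1"
    using qexp_quarter_int[of 1] qexp_quarter_int[of "-1"] qexp_int[of 0] by simp_all
  have pow: "\<i> ^ n = \<i> ^ r" "(- \<i>) ^ n = (- \<i>) ^ r" unfolding n by (simp_all add: power_add power_mult)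
  have "int n mod 4 = int r" by (simp add: r_def zmod_int)
  then have ex: "excluded_exponent k n \<longleftrightarrow> r = 2 \<or> int r = (-1) ^ ((k + 1) div 2) mod 4"
    unfolding excluded_exponent_def cong_def by auto
  have "(-1 :: int) ^ ((k + 1) div 2) = 1 \<and> (-1 :: complex) ^ ((k + 1) div 2) = 1 \<or>
      (-1 :: int) ^ ((k + 1) div 2) = -1 \<and> (-1 :: complex) ^ ((k + 1) div 2) = -1"
    by (cases "even ((k + 1) div 2)") auto
  then show ?thesis
    using r by (elim disjE conjE) (simp_all add: excluded_weight_def q pow ex complex_eq_iff power2_eq_square power3_eq_cube)
qed

lemma excluded_part_q_expansion:
  assumes "has_q_expansion f a"
  shows "has_q_expansion (excluded_part k f) (\<lambda>n. if excluded_exponent k n then a n else 0)"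
  unfolding has_q_expansion_def
proof
  fix z assume "z \<in> upper_half_plane"
  then have z: "Im z > 0" by (simp add: upper_half_plane_def)
  have "(\<lambda>n. a (Suc n) * qexp (z + of_int j / 4) ^ Suc n) sums f (z + of_int j / 4)" for j
    using assms z Im_divide_of_real[of "of_int j" 4] by (simp add: has_q_expansion_def upper_half_plane_def)
  then have "(\<lambda>n. \<Sum>j\<in>{-1, 0, 1}. excluded_weight k j * (a (Suc n) * qexp (z + of_int j / 4) ^ Suc n)) sums excluded_part k f z"
    unfolding excluded_part_def by (intro sums_sum sums_mult)
  moreover have "(\<Sum>j\<in>{-1, 0, 1}. excluded_weight k j * (a (Suc n) * qexp (z + of_int j / 4) ^ Suc n)) =
      (if excluded_exponent k (Suc n) then a (Suc n) else 0) * qexp z ^ Suc n" for n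
  proof -
    have "(\<Sum>j\<in>{-1, 0, 1}. excluded_weight k j * (a (Suc n) * qexp (z + of_int j / 4) ^ Suc n)) =
        a (Suc n) * qexp z ^ Suc n * (\<Sum>j\<in>{-1, 0, 1}. excluded_weight k j * qexp (of_int j / 4) ^ Suc n)"
      unfolding sum_distrib_left by (intro sum.cong refl) (simp only: qexp_add power_mult_distrib mult_ac)
    then show ?thesis unfolding excluded_weight_sum by simp
  qed
  ultimately show "(\<lambda>n. (if excluded_exponent k (Suc n) then a (Suc n) else 0) * qexp z ^ Suc n) sums excluded_part k f z"
    by (simp only:)
qed

lemma excluded_part_holomorphic:
  assumes f: "f holomorphic_on upper_half_plane"
  shows "excluded_part k f holomorphic_on upper_half_plane"
proof -
  have "(\<lambda>z. f (z + of_int j / 4)) holomorphic_on upper_half_plane" for j :: int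
  proof (rule holomorphic_on_compose_gen[OF _ f, of "\<lambda>z. z + of_int j / 4", unfolded o_def])
    show "(\<lambda>z. z + of_int j / 4) ` upper_half_plane \<subseteq> upper_half_plane"
      using Im_divide_of_real[of "of_int j" 4] by (auto simp: upper_half_plane_def)
  qed (intro holomorphic_intros)
  then show ?thesis unfolding excluded_part_def by (intro holomorphic_intros)
qed

text \<open>
  All shifts of \<open>f\<close> transform with the same factor, so their combination does as well; its absolute
  value is determined by the transformation of \<open>\<bar>\<Theta>\<bar>\<^sup>4 y\<close>.
\<close>

lemma excluded_part_invariant:
  assumes f: "f \<in> modular_forms k N chi" and chi: "dirichlet_character N chi" and N: "N > 0" "4 dvd N"
    and A: "A \<in> Gamma0 (4 * N)" and z: "Im z > 0"
  shows "invariant_norm k (excluded_part k f) (moebius A z) = invariant_norm k (excluded_part k f) z"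
proof -
  have SL: "A \<in> SL2" and dvd: "int (4 * N) dvd A $ 2 $ 1" using A by (auto simp: Gamma0_iff)
  have "excluded_part k f (moebius A z) = chi (A $ 2 $ 2) * theta_factor A z ^ k * excluded_part k f z"
    unfolding excluded_part_def modular_form_quarter_shift[OF f chi N(2) A z] sum_distrib_left
    by (intro sum.cong refl) (simp only: mult_ac)
  moreover have "norm (chi (A $ 2 $ 2)) = 1"
  proof (rule norm_dirichlet_character[OF chi N(1)])
    obtain c where c: "A $ 2 $ 1 = int N * c" using dvd by (metis dvd_def dvd_trans dvd_triv_right of_nat_mult)
    have "A $ 1 $ 1 * A $ 2 $ 2 - A $ 1 $ 2 * A $ 2 $ 1 = 1" using SL by (simp only: SL2_iff)
    then have "A $ 2 $ 2 * A $ 1 $ 1 + int N * (- A $ 1 $ 2 * c) = 1" by (simp add: c algebra_simps)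
    then show "coprime (A $ 2 $ 2) (int N)" by (metis coprimeI dvd_add dvd_mult2)
  qed
  moreover have "norm (theta_factor A z) ^ 4 * Im (moebius A z) = Im z"
  proof -
    have "int 4 dvd A $ 2 $ 1" using dvd by (metis dvd_trans dvd_triv_left of_nat_mult)
    then have "theta_norm (moebius A z) = theta_norm z"
      using theta_Gamma0_4[of A z] SL z by (simp add: Gamma0_iff)
    then show ?thesis
      using Theta_nonzero[OF z] by (simp add: theta_norm_def theta_factor_def norm_divide power_divide)
  qed
  then have "(norm (theta_factor A z) ^ 4 * Im (moebius A z)) ^ k = Im z ^ k" by simp
  ultimately show ?thesis
    by (simp add: invariant_norm_def norm_mult norm_power power_mult_distrib mult_ac flip: power_mult)
qed

lemma sum3_power4_le:
  fixes F :: "int \<Rightarrow> real"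
  assumes "\<And>j. F j \<ge> 0"
  shows "(\<Sum>j\<in>{-1, 0, 1}. F j) ^ 4 \<le> 81 * (\<Sum>j\<in>{-1, 0, 1}. F j ^ 4)"
proof -
  define m where "m = Max (F ` {-1, 0, 1})"
  have "m \<in> F ` {-1, 0, 1}" unfolding m_def by (intro Max_in) auto
  then obtain i where i: "i \<in> {-1, 0, 1}" "m = F i" by auto
  have "F j \<le> m" if "j \<in> {-1, 0, 1}" for j unfolding m_def using that by (intro Max_ge) auto
  then have "(\<Sum>j\<in>{-1, 0, 1}. F j) \<le> (\<Sum>j\<in>{-1, 0, 1::int}. m)" by (intro sum_mono) auto
  then have "(\<Sum>j\<in>{-1, 0, 1}. F j) ^ 4 \<le> (3 * m) ^ 4"
    using assms by (intro power_mono sum_nonneg) auto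
  also have "\<dots> = 81 * F i ^ 4" by (simp add: i power_mult_distrib)
  also have "F i ^ 4 \<le> (\<Sum>j\<in>{-1, 0, 1}. F j ^ 4)"
    using i assms by (intro member_le_sum) auto
  finally show ?thesis by simp
qed

lemma excluded_part_growth:
  assumes A: "A \<in> SL2"
    and growth: "\<And>B. B \<in> SL2 \<Longrightarrow> moderate_growth k (\<lambda>z. invariant_norm k f (moebius B z))"
  shows "moderate_growth k (\<lambda>z. invariant_norm k (excluded_part k f) (moebius A z))"
proof -
  have "\<forall>j::int. moderate_growth k (\<lambda>z. invariant_norm k f (moebius A z + of_int j / 4))"
    using shift_growth[OF A growth] by blast
  then obtain K where K: "\<forall>j::int. \<forall>\<^sub>F y in at_top. \<forall>z. Im z = y \<longrightarrow> invariant_norm k f (moebius A z + of_int j / 4) \<le> K j * y ^ k"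
    by (rule choice[THEN exE])
  have "\<forall>\<^sub>F y in at_top. \<forall>j\<in>{-1, 0, 1}. \<forall>z. Im z = y \<longrightarrow> invariant_norm k f (moebius A z + of_int j / 4) \<le> K j * y ^ k"
    using K by (intro eventually_ball_finite) auto
  moreover have "\<forall>\<^sub>F y::real in at_top. y > 0" by (rule eventually_gt_at_top)
  ultimately have "\<forall>\<^sub>F y in at_top. \<forall>z. Im z = y \<longrightarrow>
      invariant_norm k (excluded_part k f) (moebius A z) \<le> (81 * (\<Sum>j\<in>{-1, 0, 1}. K j)) * y ^ k"
  proof eventually_elim
    case (elim y)
    show ?case
    proof (intro allI impI)
      fix z assume z: "Im z = y"
      define F where "F j = norm (f (moebius A z + of_int j / 4))" for j :: int
      define I where "I = Im (moebius A z)"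
      have I: "I > 0" unfolding I_def using elim z by (intro Im_moebius_pos[OF A]) auto
      have Im_j: "Im (moebius A z + of_int j / 4) = I" for j :: int
        using Im_divide_of_real[of "of_int j" 4] by (simp add: I_def)
      have weight: "norm (excluded_weight k j) \<le> 1" if "j \<in> {-1, 0, 1}" for j
      proof (cases "j = 0")
        case False
        then have "norm (of_int j * (-1) ^ ((k + 1) div 2) * \<i>) = 1" using that by (auto simp: norm_mult norm_power)
        then show ?thesis
          using norm_triangle_ineq[of 1 "of_int j * (-1) ^ ((k + 1) div 2) * \<i>"] False
          by (simp add: excluded_weight_def norm_divide del: minus_add_distrib)
      qed (simp add: excluded_weight_def)
      have "norm (excluded_part k f (moebius A z)) \<le> (\<Sum>j\<in>{-1, 0, 1}. F j)"
        unfolding excluded_part_def F_def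
        by (intro sum_norm_le) (use weight in \<open>simp add: norm_mult mult_left_le_one_le\<close>)
      then have "norm (excluded_part k f (moebius A z)) ^ 4 \<le> (\<Sum>j\<in>{-1, 0, 1}. F j) ^ 4"
        by (intro power_mono) auto
      also have "\<dots> \<le> 81 * (\<Sum>j\<in>{-1, 0, 1}. F j ^ 4)" by (intro sum3_power4_le) (simp add: F_def)
      finally have "invariant_norm k (excluded_part k f) (moebius A z) \<le> 81 * (\<Sum>j\<in>{-1, 0, 1}. F j ^ 4) * I ^ k"
        unfolding invariant_norm_def I_def[symmetric] using I by (intro mult_right_mono) auto
      also have "\<dots> = 81 * (\<Sum>j\<in>{-1, 0, 1}. invariant_norm k f (moebius A z + of_int j / 4))"
        unfolding invariant_norm_def Im_j F_def by (simp only: sum_distrib_right mult.assoc)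
      also have "\<dots> \<le> 81 * (\<Sum>j\<in>{-1, 0, 1}. K j * y ^ k)"
        using elim z by (intro mult_left_mono sum_mono) auto
      finally show "invariant_norm k (excluded_part k f) (moebius A z) \<le> (81 * (\<Sum>j\<in>{-1, 0, 1}. K j)) * y ^ k"
        by (simp only: sum_distrib_right mult.assoc)
    qed
  qed
  then show ?thesis by blast
qed

theorem proposition5p1:
  fixes k N :: nat and chi :: "int \<Rightarrow> complex"
    and f :: "complex \<Rightarrow> complex" and a :: "nat \<Rightarrow> complex"
  assumes "k > 0" and "N > 0" and "odd k" and "4 dvd N"
    and "dirichlet_character N chi" and "chi (-1) = 1"
    and "f \<in> cusp_forms k N chi" and "has_q_expansion f a"
  shows "f \<in> kohnen_plus_space k N chi \<longleftrightarrow>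
    (\<forall>n. 1 \<le> n \<and> real n \<le> sturm_bound k N \<and> excluded_exponent k n \<longrightarrow> a n = 0)"
proof
  assume "f \<in> kohnen_plus_space k N chi"
  then obtain b where b: "has_q_expansion f b" "\<forall>n\<ge>1. excluded_exponent k n \<longrightarrow> b n = 0"
    by (auto simp: kohnen_plus_space_def)
  then show "\<forall>n. 1 \<le> n \<and> real n \<le> sturm_bound k N \<and> excluded_exponent k n \<longrightarrow> a n = 0"
    using has_q_expansion_unique[OF assms(8) b(1)] by auto
next
  assume zero: "\<forall>n. 1 \<le> n \<and> real n \<le> sturm_bound k N \<and> excluded_exponent k n \<longrightarrow> a n = 0"
  define e where "e n = (if excluded_exponent k n then a n else 0)" for n
  define g where "g = excluded_part k f"
  \<comment> \<open>the least exponent above the bound, hence strictly larger than the bound, as \<open>sturm_vanishing\<close> requires\<close>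
  define m where "m = Suc (nat \<lfloor>sturm_bound k N\<rfloor>)"
  have f: "f \<in> modular_forms k N chi" using assms(7) by (simp add: cusp_forms_def)
  have g_exp: "has_q_expansion g e"
    unfolding g_def e_def by (rule excluded_part_q_expansion[OF assms(8)])
  have growth: "moderate_growth k (\<lambda>z. invariant_norm k f (moebius B z))" if "B \<in> SL2" for B
    using that f by (intro holomorphic_at_cusp_growth) (auto simp: modular_forms_def carrier_SL2Z)
  have "sturm_bound k N \<ge> 0" by (simp add: sturm_bound_def)
  have "e n = 0" if "1 \<le> n" "n < m" for n
  proof -
    have "int n \<le> \<lfloor>sturm_bound k N\<rfloor>" using that by (simp add: m_def)
    then have "real n \<le> sturm_bound k N" by (simp add: le_floor_iff)
    then show ?thesis using zero that by (simp add: e_def)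
  qed
  then obtain K where K: "\<And>z. Im z \<ge> 1 \<Longrightarrow> norm (g z) \<le> K * exp (- 2 * pi * real m * Im z)"
    using has_q_expansion_decay[OF g_exp, of m] by (auto simp: m_def)
  have "g z = 0" if "Im z > 0" for z
  proof (rule sturm_vanishing[of "4 * N" g k K "real m"])
    show "g holomorphic_on upper_half_plane"
      unfolding g_def using f by (intro excluded_part_holomorphic) (simp add: modular_forms_def)
    show "invariant_norm k g (moebius G z) = invariant_norm k g z" if "G \<in> Gamma0 (4 * N)" "Im z > 0" for G z
      unfolding g_def by (rule excluded_part_invariant[OF f assms(5,2,4) that])
    show "moderate_growth k (\<lambda>z. invariant_norm k g (moebius A z))" if "A \<in> SL2" for A
      unfolding g_def by (rule excluded_part_growth[OF that growth])
    show "\<forall>\<^sub>F y in at_top. \<forall>z. Im z = y \<longrightarrow> norm (g z) \<le> K * exp (- 2 * pi * real m * y)"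
      using K by (intro eventually_at_top_linorderI[of 1]) auto
    show "real k / 24 * real (Gamma0_index (4 * N)) < real m"
      unfolding sturm_bound_def[symmetric] m_def using \<open>sturm_bound k N \<ge> 0\<close> by linarith
  qed (use assms that in auto)
  then have "has_q_expansion g (\<lambda>_. 0)"
    by (auto simp: has_q_expansion_def upper_half_plane_def)
  then have e0: "e n = 0" if "n \<ge> 1" for n using has_q_expansion_unique[OF g_exp _ that] by simp
  have "a n = 0" if "n \<ge> 1" "excluded_exponent k n" for n
    using e0[OF that(1)] that(2) by (simp add: e_def)
  then show "f \<in> kohnen_plus_space k N chi"
    using assms(7,8) by (auto simp: kohnen_plus_space_def)
qed

end
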